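(* Let $R$ be a right generalized $\delta$-perfect ring. Then $R$ is right Noetherian if and only if $R$ is right Artinian.
   Context: Rings are associative with identity; modules are unitary right modules. A submodule $N$ of a module $M$ is $\delta$-small in $M$, written $N\ll_\delta M$, if $N+K\neq M$ for every proper submodule $K$ of $M$ with $M/K$ singular (a module is singular if each of its elements is annihilated by some essential right ideal of $R$). A flat $\delta$-cover of $M$ is an epimorphism $f:F\to M$ with $F$ flat and $\operatorname{Ker}(f)\ll_\delta F$. $R$ is right generalized $\delta$-perfect (right $G$-$\delta$-perfect) if every right $R$-module has a flat $\delta$-cover. *)

theory Defs
  imports "HOL-Algebra.Algebra" "HOL-Library.Equipollence"
begin

section \<open>Modules over a not necessarily commutative ring\<close>

text \<open>
  The record \<^typ>\<open>('a, 'b) module\<close> of HOL-Algebra is used for left and right modules alike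
  (its fields \<open>mult\<close> and \<open>one\<close> play no role); the locale \<open>module\<close> of the library is not
  suitable, because it requires the ring to be commutative. For a right module,
  \<open>r \<odot>\<^bsub>M\<^esub> x\<close> stands for \<open>x r\<close>, hence the order of the factors in \<open>smult_assoc\<close> below.
\<close>

locale right_module = R?: ring R + M?: abelian_group M
  for R :: "('a, 'r) ring_scheme" (structure) and M :: "('a, 'b) module" (structure) +
  assumes smult_closed:
      "\<lbrakk>r \<in> carrier R; x \<in> carrier M\<rbrakk> \<Longrightarrow> r \<odot>\<^bsub>M\<^esub> x \<in> carrier M"
    and smult_l_distr:
      "\<lbrakk>r \<in> carrier R; s \<in> carrier R; x \<in> carrier M\<rbrakk> \<Longrightarrow>
        (r \<oplus> s) \<odot>\<^bsub>M\<^esub> x = r \<odot>\<^bsub>M\<^esub> x \<oplus>\<^bsub>M\<^esub> s \<odot>\<^bsub>M\<^esub> x"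
    and smult_r_distr:
      "\<lbrakk>r \<in> carrier R; x \<in> carrier M; y \<in> carrier M\<rbrakk> \<Longrightarrow>
        r \<odot>\<^bsub>M\<^esub> (x \<oplus>\<^bsub>M\<^esub> y) = r \<odot>\<^bsub>M\<^esub> x \<oplus>\<^bsub>M\<^esub> r \<odot>\<^bsub>M\<^esub> y"
    and smult_assoc:
      "\<lbrakk>r \<in> carrier R; s \<in> carrier R; x \<in> carrier M\<rbrakk> \<Longrightarrow>
        (r \<otimes> s) \<odot>\<^bsub>M\<^esub> x = s \<odot>\<^bsub>M\<^esub> (r \<odot>\<^bsub>M\<^esub> x)"
    and smult_one:
      "x \<in> carrier M \<Longrightarrow> \<one> \<odot>\<^bsub>M\<^esub> x = x"

locale left_module = R?: ring R + M?: abelian_group M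
  for R :: "('a, 'r) ring_scheme" (structure) and M :: "('a, 'b) module" (structure) +
  assumes smult_closed:
      "\<lbrakk>r \<in> carrier R; x \<in> carrier M\<rbrakk> \<Longrightarrow> r \<odot>\<^bsub>M\<^esub> x \<in> carrier M"
    and smult_l_distr:
      "\<lbrakk>r \<in> carrier R; s \<in> carrier R; x \<in> carrier M\<rbrakk> \<Longrightarrow>
        (r \<oplus> s) \<odot>\<^bsub>M\<^esub> x = r \<odot>\<^bsub>M\<^esub> x \<oplus>\<^bsub>M\<^esub> s \<odot>\<^bsub>M\<^esub> x"
    and smult_r_distr:
      "\<lbrakk>r \<in> carrier R; x \<in> carrier M; y \<in> carrier M\<rbrakk> \<Longrightarrow>
        r \<odot>\<^bsub>M\<^esub> (x \<oplus>\<^bsub>M\<^esub> y) = r \<odot>\<^bsub>M\<^esub> x \<oplus>\<^bsub>M\<^esub> r \<odot>\<^bsub>M\<^esub> y"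
    and smult_assoc:
      "\<lbrakk>r \<in> carrier R; s \<in> carrier R; x \<in> carrier M\<rbrakk> \<Longrightarrow>
        (r \<otimes> s) \<odot>\<^bsub>M\<^esub> x = r \<odot>\<^bsub>M\<^esub> (s \<odot>\<^bsub>M\<^esub> x)"
    and smult_one:
      "x \<in> carrier M \<Longrightarrow> \<one> \<odot>\<^bsub>M\<^esub> x = x"

text \<open>
  The library locale \<open>submodule\<close> (an additive subgroup closed under \<open>\<odot>\<close>) does not depend on
  commutativity or on the side of the action, and is used as it is.
\<close>

definition mod_hom ::
    "('a, 'r) ring_scheme \<Rightarrow> ('a, 'b) module \<Rightarrow> ('a, 'c) module \<Rightarrow> ('b \<Rightarrow> 'c) set" where
  "mod_hom R M N = {f \<in> hom (add_monoid M) (add_monoid N).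
     \<forall>r\<in>carrier R. \<forall>x\<in>carrier M. f (r \<odot>\<^bsub>M\<^esub> x) = r \<odot>\<^bsub>N\<^esub> f x}"

definition quot_module :: "('a, 'b) module \<Rightarrow> 'b set \<Rightarrow> ('a, 'b set) module" where
  "quot_module M K =
    \<lparr>carrier = a_rcosets\<^bsub>M\<^esub> K, monoid.mult = undefined, one = undefined,
     ring.zero = K, ring.add = set_add M,
     smult = (\<lambda>r C. \<Union>x\<in>C. K +>\<^bsub>M\<^esub> (r \<odot>\<^bsub>M\<^esub> x))\<rparr>"

definition right_regular :: "('a, 'r) ring_scheme \<Rightarrow> ('a, 'a) module" where
  "right_regular R =
    \<lparr>carrier = carrier R, monoid.mult = undefined, one = undefined,
     ring.zero = \<zero>\<^bsub>R\<^esub>, ring.add = (\<oplus>\<^bsub>R\<^esub>), smult = (\<lambda>r x. x \<otimes>\<^bsub>R\<^esub> r)\<rparr>"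

abbreviation right_ideal :: "('a, 'r) ring_scheme \<Rightarrow> 'a set \<Rightarrow> bool" where
  "right_ideal R I \<equiv> submodule I R (right_regular R)"

definition right_noetherian :: "('a, 'r) ring_scheme \<Rightarrow> bool" where
  "right_noetherian R \<longleftrightarrow>
    (\<forall>I :: nat \<Rightarrow> 'a set. (\<forall>n. right_ideal R (I n)) \<and> (\<forall>n. I n \<subseteq> I (Suc n)) \<longrightarrow>
      (\<exists>n. \<forall>m\<ge>n. I m = I n))"

definition right_artinian :: "('a, 'r) ring_scheme \<Rightarrow> bool" where
  "right_artinian R \<longleftrightarrow>
    (\<forall>I :: nat \<Rightarrow> 'a set. (\<forall>n. right_ideal R (I n)) \<and> (\<forall>n. I (Suc n) \<subseteq> I n) \<longrightarrow>
      (\<exists>n. \<forall>m\<ge>n. I m = I n))"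


section \<open>Singular modules and \<open>\<delta>\<close>-small submodules\<close>

definition essential_submodule ::
    "('a, 'r) ring_scheme \<Rightarrow> ('a, 'b) module \<Rightarrow> 'b set \<Rightarrow> bool" where
  "essential_submodule R M N \<longleftrightarrow> submodule N R M \<and>
    (\<forall>K. submodule K R M \<and> N \<inter> K = {\<zero>\<^bsub>M\<^esub>} \<longrightarrow> K = {\<zero>\<^bsub>M\<^esub>})"

definition singular_module :: "('a, 'r) ring_scheme \<Rightarrow> ('a, 'b) module \<Rightarrow> bool" where
  "singular_module R M \<longleftrightarrow>
    (\<forall>x\<in>carrier M. \<exists>I. essential_submodule R (right_regular R) I \<and>
      (\<forall>r\<in>I. r \<odot>\<^bsub>M\<^esub> x = \<zero>\<^bsub>M\<^esub>))"

definition delta_small ::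
    "('a, 'r) ring_scheme \<Rightarrow> ('a, 'b) module \<Rightarrow> 'b set \<Rightarrow> bool" where
  "delta_small R M N \<longleftrightarrow> submodule N R M \<and>
    (\<forall>K. submodule K R M \<and> K \<noteq> carrier M \<and> singular_module R (quot_module M K) \<longrightarrow>
      N <+>\<^bsub>M\<^esub> K \<noteq> carrier M)"


section \<open>Tensor products and flat modules\<close>

text \<open>
  The tensor product over \<open>R\<close> of a right module \<open>F\<close> and a left module \<open>A\<close>, as an abelian group:
  the free abelian group on \<open>F \<times> A\<close> modulo the subgroup generated by the usual relations.
\<close>

definition tensor_relations ::
    "('a, 'r) ring_scheme \<Rightarrow> ('a, 'f) module \<Rightarrow> ('a, 'b) module \<Rightarrow> ('f \<times> 'b \<Rightarrow>\<^sub>0 int) set" where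
  "tensor_relations R F A =
     {frag_of (x \<oplus>\<^bsub>F\<^esub> y, a) - frag_of (x, a) - frag_of (y, a) | x y a.
        x \<in> carrier F \<and> y \<in> carrier F \<and> a \<in> carrier A}
   \<union> {frag_of (x, a \<oplus>\<^bsub>A\<^esub> b) - frag_of (x, a) - frag_of (x, b) | x a b.
        x \<in> carrier F \<and> a \<in> carrier A \<and> b \<in> carrier A}
   \<union> {frag_of (r \<odot>\<^bsub>F\<^esub> x, a) - frag_of (x, r \<odot>\<^bsub>A\<^esub> a) | r x a.
        r \<in> carrier R \<and> x \<in> carrier F \<and> a \<in> carrier A}"

definition tensor_null ::
    "('a, 'r) ring_scheme \<Rightarrow> ('a, 'f) module \<Rightarrow> ('a, 'b) module \<Rightarrow> ('f \<times> 'b \<Rightarrow>\<^sub>0 int) set" where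
  "tensor_null R F A =
    generate (free_Abelian_group (carrier F \<times> carrier A)) (tensor_relations R F A)"

definition tensor_product ::
    "('a, 'r) ring_scheme \<Rightarrow> ('a, 'f) module \<Rightarrow> ('a, 'b) module \<Rightarrow> ('f \<times> 'b \<Rightarrow>\<^sub>0 int) set monoid" where
  "tensor_product R F A = free_Abelian_group (carrier F \<times> carrier A) Mod tensor_null R F A"

text \<open>
  The map \<open>F \<otimes> A \<rightarrow> F \<otimes> B\<close> induced by \<open>g : A \<rightarrow> B\<close>, sending the class of a formal combination
  \<open>\<Sum> n\<^sub>i (x\<^sub>i, a\<^sub>i)\<close> to the class of \<open>\<Sum> n\<^sub>i (x\<^sub>i, g a\<^sub>i)\<close>. The union is over
  representatives of one class, which all yield the same coset.
\<close>

definition tensor_map ::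
    "('a, 'r) ring_scheme \<Rightarrow> ('a, 'f) module \<Rightarrow> ('a, 'b) module \<Rightarrow> ('b0 \<Rightarrow> 'b) \<Rightarrow>
      ('f \<times> 'b0 \<Rightarrow>\<^sub>0 int) set \<Rightarrow> ('f \<times> 'b \<Rightarrow>\<^sub>0 int) set" where
  "tensor_map R F B g C =
    (\<Union>c\<in>C. tensor_null R F B #>\<^bsub>free_Abelian_group (carrier F \<times> carrier B)\<^esub>
       frag_extend (\<lambda>(x, a). frag_of (x, g a)) c)"

text \<open>
  \<open>F\<close> is flat if \<open>F \<otimes> _\<close> preserves injectivity of homomorphisms of left modules. HOL cannot
  quantify over types inside a definition, so the type \<open>'m\<close> in which the left modules live is a
  parameter.
\<close>

definition flat_module ::
    "'m itself \<Rightarrow> ('a, 'r) ring_scheme \<Rightarrow> ('a, 'f) module \<Rightarrow> bool" where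
  "flat_module TYPE('m) R F \<longleftrightarrow> right_module R F \<and>
    (\<forall>(A :: ('a, 'm) module) (B :: ('a, 'm) module) g.
      left_module R A \<and> left_module R B \<and> g \<in> mod_hom R A B \<and> inj_on g (carrier A) \<longrightarrow>
      inj_on (tensor_map R F B g) (carrier (tensor_product R F A)))"


section \<open>Flat \<open>\<delta>\<close>-covers\<close>

definition flat_delta_cover ::
    "'m itself \<Rightarrow> ('a, 'r) ring_scheme \<Rightarrow> ('a, 'f) module \<Rightarrow> ('a, 'b) module \<Rightarrow> ('f \<Rightarrow> 'b) \<Rightarrow> bool" where
  "flat_delta_cover TYPE('m) R F M f \<longleftrightarrow>
    flat_module TYPE('m) R F \<and> f \<in> mod_hom R F M \<and> f ` carrier F = carrier M \<and>
    delta_small R F (a_kernel F M f)"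

text \<open>
  The right modules to be covered (and the left modules testing flatness) live in the type \<open>'m\<close>,
  the covers in the type \<open>'f\<close>. A ring all of whose right modules have flat \<open>\<delta>\<close>-covers satisfies
  this predicate for every \<open>'m\<close> and every \<open>'f\<close> that is large enough to hold covers of the modules
  in \<open>'m\<close>; a theorem that assumes the predicate for arbitrary \<open>'m\<close> and \<open>'f\<close>, with \<open>'m\<close> infinite and
  at least as large as \<open>R\<close>, therefore covers the universe-free notion. Without such a size
  condition on \<open>'m\<close> the predicate would be too weak: in a one-element type there is only the
  zero module.
\<close>

definition right_G_delta_perfect ::
    "'m itself \<Rightarrow> 'f itself \<Rightarrow> ('a, 'r) ring_scheme \<Rightarrow> bool" where
  "right_G_delta_perfect TYPE('m) TYPE('f) R \<longleftrightarrow>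
    (\<forall>M :: ('a, 'm) module. right_module R M \<longrightarrow>
      (\<exists>(F :: ('a, 'f) module) f. flat_delta_cover TYPE('m) R F M f))"

end

theory Submission
  imports Defs
begin

text \<open>
  Both chain conditions are studied on intervals in the modular lattice of right ideals. A right ideal between \<open>A\<close> and \<open>B\<close>
  is a submodule of \<open>B / A\<close>, and the conditions pass to extensions and to homomorphic images.

  A right Artinian ring is right Noetherian by the theorem of Hopkins
  (\<open>right_artinian_imp_right_noetherian\<close>): subquotients annihilated by the radical are semisimple, hence Noetherian. This
  property passes to products of ideals, so the smallest ideal that has it in place of the radical is idempotent
  and contained in the radical, and such an ideal is zero.

  Conversely, let \<open>R\<close> be right Noetherian and suppose that it is not right Artinian. There is an ideal \<open>p\<close>
  maximal among those for which \<open>R / p\<close> is not right Artinian. Then \<open>p\<close> is prime and \<open>R / p\<close> has no minimal right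
  ideal, because otherwise \<open>R / p\<close> would be assembled from finitely many Artinian modules (\<open>prime_step\<close>,
  \<open>no_minimal_right_ideal\<close>). In particular every maximal right ideal above \<open>p\<close> is essential, and this makes delta-small
  submodules behave like small ones, as long as one works modulo \<open>p\<close> (\<open>delta_small_sum_eq\<close>).

  Let \<open>V\<close> be the free module on countably many generators and \<open>Q\<close> a submodule that contains \<open>V p\<close>. A flat delta-cover of
  \<open>V / Q\<close>, reduced modulo \<open>p\<close>, has the form \<open>V / L\<close> with \<open>L \<subseteq> Q\<close>, where \<open>Q / L\<close> is small in \<open>V / L\<close> and \<open>L\<close> is
  pure in \<open>V\<close> modulo \<open>p\<close> (\<open>flat_delta_cover_resolution\<close>). Two choices of \<open>Q\<close> lead to a contradiction. Write \<open>J / p\<close>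
  for the Jacobson radical of \<open>R / p\<close>. If \<open>Q\<close> consists of the sequences over \<open>J\<close>, purity and Nakayama's lemma give
  \<open>L = V p\<close>, so \<open>V J\<close> is small modulo \<open>V p\<close>. As in Bass's theorem on perfect rings, \<open>J / p\<close> is then T-nilpotent, which in a prime
  ring means \<open>J = p\<close> (\<open>radical_subset\<close>). If \<open>V / Q\<close> has a simple summand \<open>R / I\<close>, purity and the Noetherian condition
  split \<open>L\<close> off, and smallness together with \<open>J = p\<close> shows that \<open>R / I\<close> embeds into \<open>R / p\<close> as a minimal right
  ideal (\<open>resolutions_impossible\<close>).
\<close>

section \<open>Submodules and right ideals\<close>

lemma (in right_module) smult_zero_right [simp]:
  "r \<in> carrier R \<Longrightarrow> r \<odot>\<^bsub>M\<^esub> \<zero>\<^bsub>M\<^esub> = \<zero>\<^bsub>M\<^esub>"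
  using smult_r_distr[of r "\<zero>\<^bsub>M\<^esub>" "\<zero>\<^bsub>M\<^esub>"] smult_closed[of r "\<zero>\<^bsub>M\<^esub>"] by simp

lemma (in right_module) smult_zero_left [simp]:
  "x \<in> carrier M \<Longrightarrow> \<zero> \<odot>\<^bsub>M\<^esub> x = \<zero>\<^bsub>M\<^esub>"
  using smult_l_distr[of \<zero> \<zero> x] smult_closed[of \<zero> x] by simp

lemma (in right_module) smult_minus_one:
  assumes "x \<in> carrier M" shows "(\<ominus> \<one>) \<odot>\<^bsub>M\<^esub> x = \<ominus>\<^bsub>M\<^esub> x"
proof -
  have "(\<ominus> \<one>) \<odot>\<^bsub>M\<^esub> x \<oplus>\<^bsub>M\<^esub> x = (\<ominus> \<one> \<oplus> \<one>) \<odot>\<^bsub>M\<^esub> x"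
    using assms by (simp add: smult_l_distr smult_one)
  also have "\<dots> = \<zero>\<^bsub>M\<^esub>" using assms by (simp add: R.l_neg)
  finally show ?thesis using assms by (simp add: M.minus_equality smult_closed)
qed

lemma (in right_module) smult_minus:
  assumes "r \<in> carrier R" "x \<in> carrier M" shows "r \<odot>\<^bsub>M\<^esub> (\<ominus>\<^bsub>M\<^esub> x) = \<ominus>\<^bsub>M\<^esub> (r \<odot>\<^bsub>M\<^esub> x)"
proof -
  have "r \<odot>\<^bsub>M\<^esub> (\<ominus>\<^bsub>M\<^esub> x) \<oplus>\<^bsub>M\<^esub> r \<odot>\<^bsub>M\<^esub> x = r \<odot>\<^bsub>M\<^esub> (\<ominus>\<^bsub>M\<^esub> x \<oplus>\<^bsub>M\<^esub> x)"
    using assms by (simp add: smult_r_distr)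
  then show ?thesis using assms by (simp add: M.l_neg M.minus_equality smult_closed)
qed

lemma (in right_module) submodule_iff:
  "submodule N R M \<longleftrightarrow> N \<subseteq> carrier M \<and> \<zero>\<^bsub>M\<^esub> \<in> N \<and> (\<forall>x\<in>N. \<forall>y\<in>N. x \<oplus>\<^bsub>M\<^esub> y \<in> N) \<and>
    (\<forall>r\<in>carrier R. \<forall>x\<in>N. r \<odot>\<^bsub>M\<^esub> x \<in> N)" (is "_ \<longleftrightarrow> ?r")
proof
  assume "submodule N R M"
  then show ?r unfolding submodule_def subgroup_def submodule_axioms_def by auto
next
  assume N: ?r
  have "\<ominus>\<^bsub>M\<^esub> x \<in> N" if "x \<in> N" for x
    using N that smult_minus_one[of x] by (metis R.add.inv_closed R.one_closed subsetD)
  with N show "submodule N R M"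
    unfolding submodule_def subgroup_def submodule_axioms_def by (auto simp: a_inv_def)
qed

lemma (in right_module) submodule_diff:
  assumes "submodule N R M" "x \<in> N" "y \<in> N" shows "x \<ominus>\<^bsub>M\<^esub> y \<in> N"
proof -
  have "\<ominus>\<^bsub>M\<^esub> y \<in> N"
    using assms smult_minus_one[of y] unfolding submodule_iff by (metis R.add.inv_closed R.one_closed subsetD)
  then show ?thesis using assms unfolding submodule_iff a_minus_def by blast
qed

lemma (in right_module) submodule_carrier: "submodule (carrier M) R M"
  unfolding submodule_iff using smult_closed by auto

lemma (in right_module) submodule_zero: "submodule {\<zero>\<^bsub>M\<^esub>} R M"
  unfolding submodule_iff by auto

lemma (in right_module) submodule_Int:
  "submodule A R M \<Longrightarrow> submodule B R M \<Longrightarrow> submodule (A \<inter> B) R M"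
  unfolding submodule_iff by auto

lemma mem_set_add: "z \<in> A <+>\<^bsub>G\<^esub> B \<longleftrightarrow> (\<exists>a\<in>A. \<exists>b\<in>B. z = a \<oplus>\<^bsub>G\<^esub> b)"
  unfolding set_add_def' by auto

lemma (in right_module) submodule_sum:
  assumes "submodule A R M" "submodule B R M"
  shows "submodule (A <+>\<^bsub>M\<^esub> B) R M" "A \<subseteq> A <+>\<^bsub>M\<^esub> B" "B \<subseteq> A <+>\<^bsub>M\<^esub> B"
proof -
  have A: "A \<subseteq> carrier M" "\<zero>\<^bsub>M\<^esub> \<in> A" "\<forall>x\<in>A. \<forall>y\<in>A. x \<oplus>\<^bsub>M\<^esub> y \<in> A" "\<forall>r\<in>carrier R. \<forall>x\<in>A. r \<odot>\<^bsub>M\<^esub> x \<in> A"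
    and B: "B \<subseteq> carrier M" "\<zero>\<^bsub>M\<^esub> \<in> B" "\<forall>x\<in>B. \<forall>y\<in>B. x \<oplus>\<^bsub>M\<^esub> y \<in> B" "\<forall>r\<in>carrier R. \<forall>x\<in>B. r \<odot>\<^bsub>M\<^esub> x \<in> B"
    using assms unfolding submodule_iff by auto
  have "a \<oplus>\<^bsub>M\<^esub> b \<oplus>\<^bsub>M\<^esub> (a' \<oplus>\<^bsub>M\<^esub> b') \<in> A <+>\<^bsub>M\<^esub> B" if "a \<in> A" "a' \<in> A" "b \<in> B" "b' \<in> B" for a b a' b'
  proof -
    have "a \<oplus>\<^bsub>M\<^esub> b \<oplus>\<^bsub>M\<^esub> (a' \<oplus>\<^bsub>M\<^esub> b') = (a \<oplus>\<^bsub>M\<^esub> a') \<oplus>\<^bsub>M\<^esub> (b \<oplus>\<^bsub>M\<^esub> b')"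
      using that A(1) B(1) by (simp add: M.a_ac subset_iff)
    then show ?thesis using that A B mem_set_add by metis
  qed
  moreover have "r \<odot>\<^bsub>M\<^esub> (a \<oplus>\<^bsub>M\<^esub> b) \<in> A <+>\<^bsub>M\<^esub> B" if "a \<in> A" "b \<in> B" "r \<in> carrier R" for a b r
  proof -
    have "r \<odot>\<^bsub>M\<^esub> (a \<oplus>\<^bsub>M\<^esub> b) = r \<odot>\<^bsub>M\<^esub> a \<oplus>\<^bsub>M\<^esub> r \<odot>\<^bsub>M\<^esub> b"
      using that A(1) B(1) by (simp add: smult_r_distr subset_iff)
    then show ?thesis using that A(4) B(4) unfolding mem_set_add by blast
  qed
  moreover have "\<zero>\<^bsub>M\<^esub> \<in> A <+>\<^bsub>M\<^esub> B"
    unfolding mem_set_add using A(2) B(2) by (intro bexI[of _ "\<zero>\<^bsub>M\<^esub>"]) simp_all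
  moreover have "A <+>\<^bsub>M\<^esub> B \<subseteq> carrier M" using A(1) B(1) by (auto simp: mem_set_add subset_iff)
  ultimately show "submodule (A <+>\<^bsub>M\<^esub> B) R M" unfolding submodule_iff by (auto simp: mem_set_add)
  show "A \<subseteq> A <+>\<^bsub>M\<^esub> B"
  proof
    fix a assume "a \<in> A"
    then show "a \<in> A <+>\<^bsub>M\<^esub> B" unfolding mem_set_add using A(1) B(2)
      by (intro bexI[of _ a] bexI[of _ "\<zero>\<^bsub>M\<^esub>"]) auto
  qed
  show "B \<subseteq> A <+>\<^bsub>M\<^esub> B"
  proof
    fix b assume "b \<in> B"
    then show "b \<in> A <+>\<^bsub>M\<^esub> B" unfolding mem_set_add using A(2) B(1)
      by (intro bexI[of _ b] bexI[of _ "\<zero>\<^bsub>M\<^esub>"]) auto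
  qed
qed

lemma (in right_module) submodule_sum_least:
  assumes "submodule C R M" "A \<subseteq> C" "B \<subseteq> C" shows "A <+>\<^bsub>M\<^esub> B \<subseteq> C"
  using assms unfolding submodule_iff by (auto simp: mem_set_add subset_iff)

text \<open>
  The common form of the maximality arguments: with \<open>D = {\<one>}\<close> it yields maximal right ideals, with
  \<open>D = A - {0}\<close> complements of a submodule \<open>A\<close>, and with \<open>D = {y}\<close> submodules \<open>A\<close> for which every nonzero
  submodule of the quotient by \<open>A\<close> contains the class of \<open>y\<close>.
\<close>

lemma (in right_module) submodule_maximal_avoiding:
  assumes "submodule S R M" "S \<inter> D = {}"
  obtains A where "submodule A R M" "S \<subseteq> A" "A \<inter> D = {}"
    "\<And>B. submodule B R M \<Longrightarrow> A \<subseteq> B \<Longrightarrow> B \<inter> D = {} \<Longrightarrow> B = A"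
proof -
  let ?F = "{A. submodule A R M \<and> S \<subseteq> A \<and> A \<inter> D = {}}"
  have "\<exists>A\<in>?F. \<forall>B\<in>?F. A \<subseteq> B \<longrightarrow> B = A"
  proof (rule subset_Zorn_nonempty)
    show "?F \<noteq> {}" using assms by blast
  next
    fix C assume C: "C \<noteq> {}" "subset.chain ?F C"
    have mem: "submodule A R M" "S \<subseteq> A" "A \<inter> D = {}" if "A \<in> C" for A
      using C that unfolding subset.chain_def by auto
    have dir: "\<exists>A\<in>C. x \<in> A \<and> y \<in> A" if xy: "x \<in> \<Union>C" "y \<in> \<Union>C" for x y
    proof -
      obtain A B where AB: "A \<in> C" "B \<in> C" "x \<in> A" "y \<in> B" using xy by blast
      then have "A \<subseteq> B \<or> B \<subseteq> A" using C(2) unfolding subset_chain_def by blast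
      with AB show ?thesis by blast
    qed
    have "submodule (\<Union>C) R M"
      unfolding submodule_iff
    proof (intro conjI ballI)
      show "\<Union>C \<subseteq> carrier M" using mem unfolding submodule_iff by blast
      show "\<zero>\<^bsub>M\<^esub> \<in> \<Union>C" using mem C(1) unfolding submodule_iff by blast
    next
      fix x y assume "x \<in> \<Union>C" "y \<in> \<Union>C"
      with dir obtain A where "A \<in> C" "x \<in> A" "y \<in> A" by blast
      then show "x \<oplus>\<^bsub>M\<^esub> y \<in> \<Union>C" using mem(1)[of A] unfolding submodule_iff by blast
    next
      fix r x assume "r \<in> carrier R" "x \<in> \<Union>C"
      then show "r \<odot>\<^bsub>M\<^esub> x \<in> \<Union>C" using mem(1) unfolding submodule_iff by blast
    qed
    then show "\<Union>C \<in> ?F" using mem(2,3) C(1) by blast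
  qed
  then obtain A where A: "A \<in> ?F" "\<forall>B\<in>?F. A \<subseteq> B \<longrightarrow> B = A" by blast
  show thesis
  proof (rule that)
    show "submodule A R M" "S \<subseteq> A" "A \<inter> D = {}" using A(1) by auto
    fix B assume "submodule B R M" "A \<subseteq> B" "B \<inter> D = {}"
    then show "B = A" using A by blast
  qed
qed

lemma (in ring) right_module_right_regular: "right_module R (right_regular R)"
proof -
  have "abelian_group (right_regular R)"
    by (rule abelian_groupI) (auto simp: right_regular_def a_ac intro: add.inv_closed l_neg)
  then show ?thesis
    by (intro right_module.intro right_module_axioms.intro ring_axioms)
       (auto simp: right_regular_def r_distr l_distr m_assoc)
qed

lemma right_regular_simps [simp]:
  "carrier (right_regular R) = carrier R" "\<zero>\<^bsub>right_regular R\<^esub> = \<zero>\<^bsub>R\<^esub>"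
  "x \<oplus>\<^bsub>right_regular R\<^esub> y = x \<oplus>\<^bsub>R\<^esub> y" "r \<odot>\<^bsub>right_regular R\<^esub> x = x \<otimes>\<^bsub>R\<^esub> r"
  "A <+>\<^bsub>right_regular R\<^esub> B = A <+>\<^bsub>R\<^esub> B"
  by (simp_all add: right_regular_def set_add_def')

context ring
begin

lemmas right_ideal_iff = right_module.submodule_iff[OF right_module_right_regular, simplified]
lemmas right_ideal_carrier = right_module.submodule_carrier[OF right_module_right_regular, simplified]
lemmas right_ideal_zero = right_module.submodule_zero[OF right_module_right_regular, simplified]
lemmas right_ideal_Int = right_module.submodule_Int[OF right_module_right_regular]
lemmas right_ideal_sum = right_module.submodule_sum[OF right_module_right_regular, simplified]
lemmas right_ideal_sum_least = right_module.submodule_sum_least[OF right_module_right_regular, simplified]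
lemmas right_ideal_maximal_avoiding = right_module.submodule_maximal_avoiding[OF right_module_right_regular]

lemma right_idealD:
  assumes "right_ideal R I"
  shows "I \<subseteq> carrier R" "\<zero> \<in> I" "x \<in> I \<Longrightarrow> x \<in> carrier R" "x \<in> I \<Longrightarrow> y \<in> I \<Longrightarrow> x \<oplus> y \<in> I"
    "x \<in> I \<Longrightarrow> r \<in> carrier R \<Longrightarrow> x \<otimes> r \<in> I" "x \<in> I \<Longrightarrow> \<ominus> x \<in> I" "x \<in> I \<Longrightarrow> y \<in> I \<Longrightarrow> x \<ominus> y \<in> I"
proof -
  show *: "I \<subseteq> carrier R" "\<zero> \<in> I" "x \<in> I \<Longrightarrow> x \<in> carrier R" "x \<in> I \<Longrightarrow> y \<in> I \<Longrightarrow> x \<oplus> y \<in> I"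
    "x \<in> I \<Longrightarrow> r \<in> carrier R \<Longrightarrow> x \<otimes> r \<in> I" for x y r
    using assms unfolding right_ideal_iff by auto
  show **: "x \<in> I \<Longrightarrow> \<ominus> x \<in> I" for x
    using *(3)[of x] *(5)[of x "\<ominus> \<one>"] by (simp add: r_minus)
  show "x \<in> I \<Longrightarrow> y \<in> I \<Longrightarrow> x \<ominus> y \<in> I"
    unfolding a_minus_def by (intro *(4) **)
qed

lemma right_ideal_add_cancel:
  assumes "right_ideal R I" "x \<in> I" "y \<in> carrier R" "x \<oplus> y \<in> I" shows "y \<in> I"
proof -
  have "y = (x \<oplus> y) \<ominus> x" using assms right_idealD(3)[OF assms(1,2)]
    by (simp add: minus_eq a_comm[of x] a_assoc r_neg)
  then show ?thesis using assms right_idealD(7) by metis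
qed

lemma ideal_right_ideal: "ideal D R \<Longrightarrow> right_ideal R D"
  using ideal.Icarr ideal.I_r_closed
  by (auto simp: right_ideal_iff additive_subgroup.zero_closed additive_subgroup.a_closed ideal.axioms)

lemma right_ideal_modular:
  assumes "right_ideal R A" "right_ideal R B" "right_ideal R C" "A \<subseteq> C"
  shows "C \<inter> (A <+>\<^bsub>R\<^esub> B) = A <+>\<^bsub>R\<^esub> (C \<inter> B)"
proof
  show "C \<inter> (A <+>\<^bsub>R\<^esub> B) \<subseteq> A <+>\<^bsub>R\<^esub> (C \<inter> B)"
  proof
    fix z assume "z \<in> C \<inter> (A <+>\<^bsub>R\<^esub> B)"
    then obtain a b where ab: "a \<in> A" "b \<in> B" "z = a \<oplus> b" "z \<in> C" by (auto simp: mem_set_add)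
    then have "b \<in> C" using assms right_ideal_add_cancel[of C a b] right_idealD(3)[OF assms(2)] by blast
    then show "z \<in> A <+>\<^bsub>R\<^esub> (C \<inter> B)" using ab by (auto simp: mem_set_add)
  qed
  show "A <+>\<^bsub>R\<^esub> (C \<inter> B) \<subseteq> C \<inter> (A <+>\<^bsub>R\<^esub> B)"
    using assms(4) right_idealD(4)[OF assms(3)] unfolding mem_set_add subset_iff Int_iff by blast
qed

definition maximal_right_ideal :: "'a set \<Rightarrow> bool" where
  "maximal_right_ideal I \<longleftrightarrow> right_ideal R I \<and> I \<noteq> carrier R \<and>
     (\<forall>K. right_ideal R K \<and> I \<subset> K \<longrightarrow> K = carrier R)"

lemma right_ideal_one: "right_ideal R I \<Longrightarrow> \<one> \<in> I \<Longrightarrow> I = carrier R"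
  using right_idealD(1,5)[of I] l_one by (metis subsetI subset_antisym)

lemma maximal_right_ideal_ex:
  assumes "right_ideal R S" "S \<noteq> carrier R"
  obtains I where "maximal_right_ideal I" "S \<subseteq> I"
proof -
  have "S \<inter> {\<one>} = {}" using assms right_ideal_one by blast
  with assms(1) obtain A where A: "right_ideal R A" "S \<subseteq> A" "A \<inter> {\<one>} = {}"
    "\<And>B. right_ideal R B \<Longrightarrow> A \<subseteq> B \<Longrightarrow> B \<inter> {\<one>} = {} \<Longrightarrow> B = A"
    using right_ideal_maximal_avoiding by blast
  have "maximal_right_ideal A" unfolding maximal_right_ideal_def
  proof (intro conjI allI impI)
    show "right_ideal R A" by fact
    show "A \<noteq> carrier R" using A(3) by auto
    fix K assume "right_ideal R K \<and> A \<subset> K"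
    then have "\<one> \<in> K" using A(4)[of K] by blast
    then show "K = carrier R" using right_ideal_one \<open>right_ideal R K \<and> A \<subset> K\<close> by blast
  qed
  then show thesis using that A(2) by blast
qed

end

lemma wf_iff_chains_stabilize:
  assumes r: "trans r" "irrefl r" "r \<subseteq> A \<times> A"
  shows "wf r \<longleftrightarrow> (\<forall>f :: nat \<Rightarrow> 'a. (\<forall>n. f n \<in> A) \<and> (\<forall>n. f (Suc n) = f n \<or> (f (Suc n), f n) \<in> r) \<longrightarrow>
    (\<exists>n. \<forall>m\<ge>n. f m = f n))" (is "_ \<longleftrightarrow> ?stab")
proof
  assume wf: "wf r"
  show ?stab
  proof (intro allI impI)
    fix f assume f: "(\<forall>n. f n \<in> A) \<and> (\<forall>n. f (Suc n) = f n \<or> (f (Suc n), f n) \<in> r)"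
    obtain n where n: "\<And>y. (y, f n) \<in> r \<Longrightarrow> y \<notin> range f"
      using wfE_min[OF wf, of "f 0" "range f"] by blast
    have "f m = f n \<or> (f m, f n) \<in> r" if "m \<ge> n" for m
      using that
    proof (induction m rule: dec_induct)
      case (step m)
      have "f (Suc m) = f m \<or> (f (Suc m), f m) \<in> r" using f by blast
      with step.IH show ?case using transD[OF r(1)] by metis
    qed simp
    then show "\<exists>n. \<forall>m\<ge>n. f m = f n" using n by blast
  qed
next
  assume stab: ?stab
  show "wf r" unfolding wf_iff_no_infinite_down_chain
  proof
    assume "\<exists>f. \<forall>i. (f (Suc i), f i) \<in> r"
    then obtain f where f: "\<And>i. (f (Suc i), f i) \<in> r" by blast
    then have "f n \<in> A" for n using r(3) by blast
    then have "(\<forall>n. f n \<in> A) \<and> (\<forall>n. f (Suc n) = f n \<or> (f (Suc n), f n) \<in> r)" using f by simp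
    from stab[rule_format, OF this] obtain n where "\<forall>m\<ge>n. f m = f n" ..
    then have "f (Suc n) = f n" by (rule allE[of _ "Suc n"]) (erule mp, simp)
    then show False using f[of n] r(2) by (simp add: irrefl_def)
  qed
qed

lemma wf_lex_map:
  assumes "wf r" "wf s"
    and "\<And>x y. (x, y) \<in> t \<Longrightarrow> (f x, f y) \<in> r \<or> f x = f y \<and> (g x, g y) \<in> s"
  shows "wf t"
proof (rule wf_subset)
  show "wf (inv_image (r <*lex*> s) (\<lambda>x. (f x, g x)))" using assms(1,2) by blast
  show "t \<subseteq> inv_image (r <*lex*> s) (\<lambda>x. (f x, g x))" using assms(3) by auto
qed

context ring
begin

lemma add_eq_imp_diff_eq:
  assumes "a \<oplus> a' = b \<oplus> c" "a \<in> carrier R" "a' \<in> carrier R" "b \<in> carrier R" "c \<in> carrier R"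
  shows "a' \<ominus> c = b \<ominus> a"
proof -
  have "a' \<ominus> c = (\<ominus> a) \<oplus> (a \<oplus> a') \<ominus> c" using assms(2-5) by (simp add: a_assoc[symmetric] l_neg)
  also have "\<dots> = b \<ominus> a"
    unfolding assms(1) using assms(2-5) by (simp add: minus_eq a_assoc r_neg a_comm[of _ b])
  finally show ?thesis .
qed

section \<open>Chain conditions on intervals of right ideals\<close>

definition proper_pairs :: "'a set \<Rightarrow> 'a set \<Rightarrow> ('a set \<times> 'a set) set" where
  "proper_pairs A B =
    {(U, V). right_ideal R U \<and> right_ideal R V \<and> A \<subseteq> U \<and> U \<subset> V \<and> V \<subseteq> B}"

definition dcc_between :: "'a set \<Rightarrow> 'a set \<Rightarrow> bool" where
  "dcc_between A B \<longleftrightarrow> wf (proper_pairs A B)"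

definition acc_between :: "'a set \<Rightarrow> 'a set \<Rightarrow> bool" where
  "acc_between A B \<longleftrightarrow> wf ((proper_pairs A B)\<inverse>)"

lemma proper_pairs_strict: "trans (proper_pairs A B)" "irrefl (proper_pairs A B)"
  unfolding proper_pairs_def by (auto intro!: transI simp: irrefl_def)

lemma right_artinian_iff_dcc: "right_artinian R \<longleftrightarrow> dcc_between {\<zero>} (carrier R)"
proof -
  let ?I = "{U. right_ideal R U}" and ?r = "proper_pairs {\<zero>} (carrier R)"
  have step: "V \<subseteq> U \<longleftrightarrow> V = U \<or> (V, U) \<in> ?r" if "U \<in> ?I" "V \<in> ?I" for U V
    using that right_idealD(1)[of U] right_idealD(2)[of V] unfolding proper_pairs_def by blast
  have "?r \<subseteq> ?I \<times> ?I" unfolding proper_pairs_def by blast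
  from wf_iff_chains_stabilize[OF proper_pairs_strict this] show ?thesis
    unfolding right_artinian_def dcc_between_def using step by (simp cong: conj_cong)
qed

lemma right_noetherian_iff_acc: "right_noetherian R \<longleftrightarrow> acc_between {\<zero>} (carrier R)"
proof -
  let ?I = "{U. right_ideal R U}" and ?r = "(proper_pairs {\<zero>} (carrier R))\<inverse>"
  have step: "U \<subseteq> V \<longleftrightarrow> V = U \<or> (V, U) \<in> ?r" if "U \<in> ?I" "V \<in> ?I" for U V
    using that right_idealD(1)[of V] right_idealD(2)[of U] unfolding proper_pairs_def by blast
  have "?r \<subseteq> ?I \<times> ?I" unfolding proper_pairs_def by blast
  moreover have "trans ?r" "irrefl ?r"
    using proper_pairs_strict[of "{\<zero>}" "carrier R"] by (simp_all add: irrefl_def)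
  ultimately show ?thesis
    using wf_iff_chains_stabilize[of ?r ?I] step unfolding right_noetherian_def acc_between_def
    by (simp cong: conj_cong)
qed

lemma right_noetherian_maximal:
  assumes "right_noetherian R" "A \<in> \<F>" "\<And>B. B \<in> \<F> \<Longrightarrow> right_ideal R B"
  obtains M where "M \<in> \<F>" "\<And>B. B \<in> \<F> \<Longrightarrow> M \<subseteq> B \<Longrightarrow> B = M"
proof -
  have wf: "wf ((proper_pairs {\<zero>} (carrier R))\<inverse>)"
    using assms(1) unfolding right_noetherian_iff_acc acc_between_def .
  obtain M where M: "M \<in> \<F>" "\<And>y. (y, M) \<in> (proper_pairs {\<zero>} (carrier R))\<inverse> \<Longrightarrow> y \<notin> \<F>"
    using wfE_min[OF wf assms(2)] by blast
  show thesis
  proof (rule that[OF M(1)])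
    fix B assume B: "B \<in> \<F>" "M \<subseteq> B"
    then have "(B, M) \<notin> (proper_pairs {\<zero>} (carrier R))\<inverse>" using M(2) by blast
    then show "B = M" using B assms(3)[OF B(1)] assms(3)[OF M(1)] right_idealD(1)[of B] right_idealD(2)[of M]
      unfolding proper_pairs_def by blast
  qed
qed

lemma right_artinian_minimal:
  assumes "right_artinian R" "A \<in> \<F>" "\<And>B. B \<in> \<F> \<Longrightarrow> right_ideal R B"
  obtains M where "M \<in> \<F>" "\<And>B. B \<in> \<F> \<Longrightarrow> B \<subseteq> M \<Longrightarrow> B = M"
proof -
  have wf: "wf (proper_pairs {\<zero>} (carrier R))"
    using assms(1) unfolding right_artinian_iff_dcc dcc_between_def .
  obtain M where M: "M \<in> \<F>" "\<And>y. (y, M) \<in> proper_pairs {\<zero>} (carrier R) \<Longrightarrow> y \<notin> \<F>"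
    using wfE_min[OF wf assms(2)] by blast
  show thesis
  proof (rule that[OF M(1)])
    fix B assume B: "B \<in> \<F>" "B \<subseteq> M"
    then have "(B, M) \<notin> proper_pairs {\<zero>} (carrier R)" using M(2) by blast
    then show "B = M" using B assms(3)[OF B(1)] assms(3)[OF M(1)] right_idealD(1)[of M] right_idealD(2)[of B]
      unfolding proper_pairs_def by blast
  qed
qed

text \<open>
  By the modular law, comparable right ideals \<open>U\<close> and \<open>V\<close> with \<open>U \<inter> B = V \<inter> B\<close> and \<open>U + B = V + B\<close> are equal. This
  is what makes both chain conditions pass from two adjacent intervals to their union.
\<close>

lemma proper_pairs_split:
  assumes "right_ideal R B" "right_ideal R C" "A \<subseteq> B" "B \<subseteq> C" "(U, V) \<in> proper_pairs A C"
  shows "(U \<inter> B, V \<inter> B) \<in> proper_pairs A B \<or>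
    U \<inter> B = V \<inter> B \<and> (U <+>\<^bsub>R\<^esub> B, V <+>\<^bsub>R\<^esub> B) \<in> proper_pairs B C"
proof -
  have UV: "right_ideal R U" "right_ideal R V" "A \<subseteq> U" "U \<subset> V" "V \<subseteq> C"
    using assms(5) unfolding proper_pairs_def by auto
  have ne: "U <+>\<^bsub>R\<^esub> B \<noteq> V <+>\<^bsub>R\<^esub> B" if eq: "U \<inter> B = V \<inter> B"
  proof
    assume "U <+>\<^bsub>R\<^esub> B = V <+>\<^bsub>R\<^esub> B"
    then have "V \<subseteq> V \<inter> (U <+>\<^bsub>R\<^esub> B)" using right_ideal_sum(2)[OF UV(2) assms(1)] by blast
    also have "\<dots> = U <+>\<^bsub>R\<^esub> (U \<inter> B)"
      using right_ideal_modular[OF UV(1) assms(1) UV(2)] UV(4) eq by auto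
    also have "\<dots> \<subseteq> U" by (rule right_ideal_sum_least[OF UV(1)]) auto
    finally show False using UV(4) by blast
  qed
  have le: "U <+>\<^bsub>R\<^esub> B \<subseteq> V <+>\<^bsub>R\<^esub> B"
    using UV right_ideal_sum[OF UV(2) assms(1)] by (intro right_ideal_sum_least) auto
  have "(U \<inter> B, V \<inter> B) \<in> proper_pairs A B" if "U \<inter> B \<noteq> V \<inter> B"
    unfolding proper_pairs_def using that UV assms right_ideal_Int by auto
  moreover have "(U <+>\<^bsub>R\<^esub> B, V <+>\<^bsub>R\<^esub> B) \<in> proper_pairs B C" if "U \<inter> B = V \<inter> B"
    unfolding proper_pairs_def using ne[OF that] le right_ideal_sum[OF UV(1) assms(1)]
      right_ideal_sum[OF UV(2) assms(1)] right_ideal_sum_least[OF assms(2) UV(5) assms(4)] by auto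
  ultimately show ?thesis by blast
qed

lemma dcc_between_trans:
  assumes "right_ideal R B" "right_ideal R C" "A \<subseteq> B" "B \<subseteq> C"
    and "dcc_between A B" "dcc_between B C"
  shows "dcc_between A C"
  unfolding dcc_between_def
  by (rule wf_lex_map[of "proper_pairs A B" "proper_pairs B C" _ "\<lambda>U. U \<inter> B" "\<lambda>U. U <+>\<^bsub>R\<^esub> B"])
     (use assms(5,6) proper_pairs_split[OF assms(1-4)] in \<open>auto simp: dcc_between_def\<close>)

lemma acc_between_trans:
  assumes "right_ideal R B" "right_ideal R C" "A \<subseteq> B" "B \<subseteq> C"
    and "acc_between A B" "acc_between B C"
  shows "acc_between A C"
  unfolding acc_between_def
proof (rule wf_lex_map[of "(proper_pairs A B)\<inverse>" "(proper_pairs B C)\<inverse>" _ "\<lambda>U. U \<inter> B" "\<lambda>U. U <+>\<^bsub>R\<^esub> B"])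
  show "wf ((proper_pairs A B)\<inverse>)" "wf ((proper_pairs B C)\<inverse>)"
    using assms(5,6) unfolding acc_between_def .
  fix V U assume "(V, U) \<in> (proper_pairs A C)\<inverse>"
  then have "(U, V) \<in> proper_pairs A C" by simp
  from proper_pairs_split[OF assms(1-4) this]
  show "(V \<inter> B, U \<inter> B) \<in> (proper_pairs A B)\<inverse> \<or>
      V \<inter> B = U \<inter> B \<and> (V <+>\<^bsub>R\<^esub> B, U <+>\<^bsub>R\<^esub> B) \<in> (proper_pairs B C)\<inverse>" by auto
qed

lemma simple_interval:
  assumes "\<And>U. right_ideal R U \<Longrightarrow> A \<subseteq> U \<Longrightarrow> U \<subseteq> B \<Longrightarrow> U = A \<or> U = B"
  shows "dcc_between A B" "acc_between A B"
proof -
  have sub: "proper_pairs A B \<subseteq> {(A, B)} \<inter> {(U, V). U \<noteq> V}"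
    using assms unfolding proper_pairs_def by blast
  have fin: "wf ({(A, B)} \<inter> {(U, V). U \<noteq> V})" "wf (({(A, B)} \<inter> {(U, V). U \<noteq> V})\<inverse>)"
    by (auto simp: wf_eq_minimal)
  show "dcc_between A B" unfolding dcc_between_def using fin(1) sub by (rule wf_subset)
  show "acc_between A B" unfolding acc_between_def
    by (rule wf_subset[OF fin(2)]) (use sub in blast)
qed

text \<open>
  \<open>D / (C \<inter> D)\<close> is isomorphic to \<open>(C + D) / C\<close>, a submodule of \<open>B / C\<close>.
\<close>

lemma acc_between_Int:
  assumes "right_ideal R B" "right_ideal R C" "right_ideal R D" "C \<subseteq> B" "D \<subseteq> B" "acc_between C B"
  shows "acc_between (C \<inter> D) D"
  unfolding acc_between_def
proof (rule wf_subset)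
  show "wf (inv_image ((proper_pairs C B)\<inverse>) (\<lambda>U. C <+>\<^bsub>R\<^esub> U))"
    using assms(6) unfolding acc_between_def by blast
  have "(C <+>\<^bsub>R\<^esub> U, C <+>\<^bsub>R\<^esub> V) \<in> proper_pairs C B" if "(U, V) \<in> proper_pairs (C \<inter> D) D" for U V
  proof -
    have UV: "right_ideal R U" "right_ideal R V" "C \<inter> D \<subseteq> U" "U \<subset> V" "V \<subseteq> D"
      using that unfolding proper_pairs_def by auto
    have inv: "D \<inter> (W <+>\<^bsub>R\<^esub> C) = W" if W: "right_ideal R W" "C \<inter> D \<subseteq> W" "W \<subseteq> D" for W
    proof
      show "D \<inter> (W <+>\<^bsub>R\<^esub> C) \<subseteq> W"
        using right_ideal_modular[OF W(1) assms(2,3) W(3)]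
          right_ideal_sum_least[OF W(1) order_refl, of "D \<inter> C"] W(2) by (simp add: Int_commute)
      show "W \<subseteq> D \<inter> (W <+>\<^bsub>R\<^esub> C)" using W(3) right_ideal_sum(2)[OF W(1) assms(2)] by blast
    qed
    have comm: "W <+>\<^bsub>R\<^esub> C = C <+>\<^bsub>R\<^esub> W" if "right_ideal R W" for W
      using right_idealD(1)[OF that] right_idealD(1)[OF assms(2)] set_add_comm by blast
    have "U = D \<inter> (C <+>\<^bsub>R\<^esub> U)" "V = D \<inter> (C <+>\<^bsub>R\<^esub> V)"
      using inv[OF UV(1,3)] inv[OF UV(2)] UV comm by auto
    then have "C <+>\<^bsub>R\<^esub> U \<noteq> C <+>\<^bsub>R\<^esub> V" using UV(4) by blast
    moreover have "C <+>\<^bsub>R\<^esub> U \<subseteq> C <+>\<^bsub>R\<^esub> V"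
      using right_ideal_sum[OF assms(2) UV(2)] UV(4) by (intro right_ideal_sum_least) auto
    ultimately show ?thesis
      unfolding proper_pairs_def
      using right_ideal_sum[OF assms(2) UV(1)] right_ideal_sum[OF assms(2) UV(2)]
        right_ideal_sum_least[OF assms(1,4), of V] UV(5) assms(5) by auto
  qed
  then show "(proper_pairs (C \<inter> D) D)\<inverse> \<subseteq> inv_image ((proper_pairs C B)\<inverse>) (\<lambda>U. C <+>\<^bsub>R\<^esub> U)"
    by auto
qed

text \<open>
  Left multiplication by a fixed element is a homomorphism of right modules.
\<close>

lemma right_ideal_lmult:
  assumes "right_ideal R W" "x \<in> carrier R"
  shows "right_ideal R ((\<lambda>w. x \<otimes> w) ` W)"
proof -
  note W = right_idealD[OF assms(1)]
  have "\<zero> \<in> (\<lambda>w. x \<otimes> w) ` W" using W(2) assms(2) by (intro image_eqI[of _ _ \<zero>]) auto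
  then show ?thesis unfolding right_ideal_iff
    using W assms(2) by (auto simp: r_distr[symmetric] m_assoc)
qed

lemma right_ideal_vimage:
  assumes "right_ideal R U" "x \<in> carrier R" "right_ideal R W"
  shows "right_ideal R {w \<in> W. x \<otimes> w \<in> U}"
  unfolding right_ideal_iff
  using right_idealD[OF assms(1)] right_idealD[OF assms(3)] assms(2)
  by (auto simp: r_distr m_assoc[symmetric])

text \<open>Left multiplication by \<open>x\<close> induces an epimorphism from \<open>W / B\<close> to \<open>(A + x W) / A\<close>.\<close>

lemma dcc_between_lmult:
  assumes "right_ideal R A" "right_ideal R W" "x \<in> carrier R"
    and "\<And>b. b \<in> B \<Longrightarrow> x \<otimes> b \<in> A" "B \<subseteq> W" "dcc_between B W"
  shows "dcc_between A (A <+>\<^bsub>R\<^esub> (\<lambda>w. x \<otimes> w) ` W)"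
  unfolding dcc_between_def
proof (rule wf_subset)
  let ?f = "\<lambda>U. {w \<in> W. x \<otimes> w \<in> U}"
  show "wf (inv_image (proper_pairs B W) ?f)"
    using assms(6) unfolding dcc_between_def by blast
  have "(?f U, ?f V) \<in> proper_pairs B W" if "(U, V) \<in> proper_pairs A (A <+>\<^bsub>R\<^esub> (\<lambda>w. x \<otimes> w) ` W)" for U V
  proof -
    have UV: "right_ideal R U" "right_ideal R V" "A \<subseteq> U" "U \<subset> V" "V \<subseteq> A <+>\<^bsub>R\<^esub> (\<lambda>w. x \<otimes> w) ` W"
      using that unfolding proper_pairs_def by auto
    from UV(4) obtain v where v: "v \<in> V" "v \<notin> U" by blast
    then have "v \<in> A <+>\<^bsub>R\<^esub> (\<lambda>w. x \<otimes> w) ` W" using UV(5) by blast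
    then obtain a w where aw: "a \<in> A" "w \<in> W" "v = a \<oplus> x \<otimes> w" unfolding mem_set_add by blast
    have xw: "x \<otimes> w \<in> carrier R" using aw(2) assms(2,3) right_idealD(3) by blast
    have "x \<otimes> w \<in> V" using right_ideal_add_cancel[OF UV(2) _ xw, of a] aw v UV(3,4) by blast
    moreover have "x \<otimes> w \<notin> U" using aw v UV(3) right_idealD(4)[OF UV(1), of a "x \<otimes> w"] by blast
    ultimately have "?f U \<subset> ?f V" using UV(4) aw(2) by blast
    then show ?thesis
      unfolding proper_pairs_def
      using right_ideal_vimage[OF UV(1) assms(3,2)] right_ideal_vimage[OF UV(2) assms(3,2)]
        assms(4,5) UV(3) by auto
  qed
  then show "proper_pairs A (A <+>\<^bsub>R\<^esub> (\<lambda>w. x \<otimes> w) ` W) \<subseteq> inv_image (proper_pairs B W) ?f" by auto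
qed

lemma right_ideal_imp_ideal:
  assumes "right_ideal R D" "\<And>d r. d \<in> D \<Longrightarrow> r \<in> carrier R \<Longrightarrow> r \<otimes> d \<in> D"
  shows "ideal D R"
  using right_idealD[OF assms(1)] assms(2)
  by (intro idealI ring_axioms subgroup.intro) (auto simp: a_inv_def[symmetric])

section \<open>The radical over an ideal\<close>

text \<open>The preimage in \<open>R\<close> of the Jacobson radical of \<open>R / p\<close>.\<close>

definition radical_over :: "'a set \<Rightarrow> 'a set" where
  "radical_over p = {x \<in> carrier R. \<forall>I. maximal_right_ideal I \<and> p \<subseteq> I \<longrightarrow> x \<in> I}"

lemma right_ideal_right_inverse:
  assumes "right_ideal R p" "j \<in> radical_over p"
  obtains u q where "u \<in> carrier R" "q \<in> p" "\<one> = q \<oplus> (\<one> \<ominus> j) \<otimes> u"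
proof -
  have j: "j \<in> carrier R" using assms(2) unfolding radical_over_def by auto
  let ?K = "p <+>\<^bsub>R\<^esub> (\<lambda>w. (\<one> \<ominus> j) \<otimes> w) ` carrier R"
  have xR: "right_ideal R ((\<lambda>w. (\<one> \<ominus> j) \<otimes> w) ` carrier R)"
    by (rule right_ideal_lmult[OF right_ideal_carrier]) (use j in auto)
  note K = right_ideal_sum[OF assms(1) xR]
  have "?K = carrier R"
  proof (rule ccontr)
    assume "?K \<noteq> carrier R"
    then obtain I where I: "maximal_right_ideal I" "?K \<subseteq> I" using maximal_right_ideal_ex K(1) by blast
    then have ri: "right_ideal R I" "I \<noteq> carrier R" unfolding maximal_right_ideal_def by auto
    have "j \<in> I" using assms(2) I K(2) unfolding radical_over_def by blast
    moreover have "\<one> \<ominus> j \<in> I"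
    proof -
      have "\<one> \<ominus> j \<in> (\<lambda>w. (\<one> \<ominus> j) \<otimes> w) ` carrier R"
        using j by (intro image_eqI[of _ _ \<one>]) auto
      then show ?thesis using K(3) I(2) by blast
    qed
    ultimately have "(\<one> \<ominus> j) \<oplus> j \<in> I" using right_idealD(4)[OF ri(1)] by blast
    moreover have "(\<one> \<ominus> j) \<oplus> j = \<one>" using j by (simp add: minus_eq a_assoc l_neg)
    ultimately show False using right_ideal_one ri by auto
  qed
  then have "\<one> \<in> ?K" by simp
  then obtain q u where "q \<in> p" "u \<in> carrier R" "\<one> = q \<oplus> (\<one> \<ominus> j) \<otimes> u"
    by (auto simp: mem_set_add)
  then show thesis using that by blast
qed

text \<open>
  A left multiple \<open>r x\<close> of a radical element stays in each maximal right ideal \<open>I\<close>, because the right ideal of all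
  \<open>s\<close> with \<open>r s \<in> I\<close> is again maximal or all of \<open>R\<close>.
\<close>

lemma ideal_radical_over:
  assumes "ideal p R"
  shows "ideal (radical_over p) R" "p \<subseteq> radical_over p"
proof -
  have p: "p \<subseteq> carrier R" using ideal.Icarr[OF assms] by blast
  show "p \<subseteq> radical_over p" using p unfolding radical_over_def by blast
  have max: "right_ideal R I" if "maximal_right_ideal I" for I
    using that unfolding maximal_right_ideal_def by blast
  have ri: "right_ideal R (radical_over p)"
    unfolding right_ideal_iff radical_over_def using right_idealD[OF max] by auto
  have "r \<otimes> x \<in> radical_over p" if x: "x \<in> radical_over p" and r: "r \<in> carrier R" for r x
  proof -
    have xc: "x \<in> carrier R" using x right_idealD(3)[OF ri] by blast
    have "r \<otimes> x \<in> I" if I: "maximal_right_ideal I" "p \<subseteq> I" for I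
    proof (rule ccontr)
      assume rx: "r \<otimes> x \<notin> I"
      let ?E = "{s \<in> carrier R. r \<otimes> s \<in> I}"
      have E: "right_ideal R ?E" by (rule right_ideal_vimage[OF max[OF I(1)] r right_ideal_carrier])
      have "maximal_right_ideal ?E" unfolding maximal_right_ideal_def
      proof (intro conjI allI impI)
        show "right_ideal R ?E" by (rule E)
        show "?E \<noteq> carrier R" using rx xc by blast
        fix K assume K: "right_ideal R K \<and> ?E \<subset> K"
        then obtain k where k: "k \<in> K" "k \<notin> ?E" by blast
        have kc: "k \<in> carrier R" using k K right_idealD(3) by blast
        have rk: "right_ideal R ((\<lambda>w. (r \<otimes> k) \<otimes> w) ` carrier R)"
          by (rule right_ideal_lmult[OF right_ideal_carrier]) (use r kc in auto)
        have "r \<otimes> k \<in> (\<lambda>w. (r \<otimes> k) \<otimes> w) ` carrier R"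
          using r kc by (intro image_eqI[of _ _ \<one>]) auto
        then have "r \<otimes> k \<in> I <+>\<^bsub>R\<^esub> (\<lambda>w. (r \<otimes> k) \<otimes> w) ` carrier R"
          using right_ideal_sum(3)[OF max[OF I(1)] rk] by blast
        then have full: "I <+>\<^bsub>R\<^esub> (\<lambda>w. (r \<otimes> k) \<otimes> w) ` carrier R = carrier R"
          using I(1) right_ideal_sum(1,2)[OF max[OF I(1)] rk] k kc
          unfolding maximal_right_ideal_def by blast
        have "s \<in> K" if s: "s \<in> carrier R" for s
        proof -
          have "r \<otimes> s \<in> I <+>\<^bsub>R\<^esub> (\<lambda>w. (r \<otimes> k) \<otimes> w) ` carrier R" using full r s by simp
          then obtain i t where it: "i \<in> I" "t \<in> carrier R" "r \<otimes> s = i \<oplus> (r \<otimes> k) \<otimes> t"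
            by (auto simp: mem_set_add)
          have ic: "i \<in> carrier R" using it(1) right_idealD(3)[OF max[OF I(1)]] by blast
          have "r \<otimes> (s \<ominus> k \<otimes> t) = i"
            using it ic r s kc by (simp add: minus_eq r_distr r_minus m_assoc a_assoc r_neg)
          then have "s \<ominus> k \<otimes> t \<in> ?E" using it kc s by simp
          then have "s \<ominus> k \<otimes> t \<in> K" using K by blast
          moreover have "k \<otimes> t \<in> K" using K k it right_idealD(5) by blast
          ultimately have "(s \<ominus> k \<otimes> t) \<oplus> k \<otimes> t \<in> K" using K right_idealD(4) by blast
          then show "s \<in> K" using s kc it(2) by (simp add: minus_eq a_assoc l_neg)
        qed
        then show "K = carrier R" using K right_idealD(1) by blast
      qed
      moreover have "p \<subseteq> ?E" using I(2) p ideal.I_l_closed[OF assms _ r] by blast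
      ultimately have "x \<in> ?E" using x unfolding radical_over_def by blast
      then show False using rx by blast
    qed
    then show ?thesis using xc r unfolding radical_over_def by auto
  qed
  with ri show "ideal (radical_over p) R" by (rule right_ideal_imp_ideal)
qed


section \<open>Right Artinian rings are right Noetherian\<close>

abbreviation jacobson :: "'a set" where "jacobson \<equiv> radical_over {\<zero>}"

lemma ideal_zero: "ideal {\<zero>} R"
  by (rule zeroideal)

lemma right_ideal_jacobson: "right_ideal R jacobson"
  using ideal_right_ideal ideal_radical_over(1) ideal_zero by blast

lemma jacobson_iff: "x \<in> jacobson \<longleftrightarrow> x \<in> carrier R \<and> (\<forall>I. maximal_right_ideal I \<longrightarrow> x \<in> I)"
  using right_idealD(2) unfolding radical_over_def maximal_right_ideal_def by blast

lemma maximal_right_ideal_sum: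
  assumes "maximal_right_ideal I" "right_ideal R K" "\<not> K \<subseteq> I"
  shows "I <+>\<^bsub>R\<^esub> K = carrier R"
proof -
  have I: "right_ideal R I" using assms(1) unfolding maximal_right_ideal_def by blast
  have "I \<subset> I <+>\<^bsub>R\<^esub> K" using right_ideal_sum(2,3)[OF I assms(2)] assms(3) by blast
  then show ?thesis using assms(1) right_ideal_sum(1)[OF I assms(2)]
    unfolding maximal_right_ideal_def by blast
qed

text \<open>
  A right ideal \<open>E'\<close> that is minimal with \<open>E + E' = R\<close> is a complement of \<open>E\<close> modulo the radical: if \<open>E \<inter> E'\<close>
  left some maximal right ideal \<open>I\<close>, then \<open>E' \<inter> I\<close> would do as well.
\<close>

lemma artinian_complement:
  assumes "right_artinian R" "right_ideal R E" "jacobson \<subseteq> E"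
  obtains E' where "right_ideal R E'" "E <+>\<^bsub>R\<^esub> E' = carrier R" "E \<inter> E' = jacobson"
proof -
  let ?F = "{E'. right_ideal R E' \<and> jacobson \<subseteq> E' \<and> E <+>\<^bsub>R\<^esub> E' = carrier R}"
  have "E <+>\<^bsub>R\<^esub> carrier R = carrier R"
    using right_ideal_sum(1,3)[OF assms(2) right_ideal_carrier] right_idealD(1) by blast
  then have "carrier R \<in> ?F" using right_ideal_carrier right_idealD(1)[OF right_ideal_jacobson] by blast
  then obtain E' where E': "E' \<in> ?F" and min: "\<And>B. B \<in> ?F \<Longrightarrow> B \<subseteq> E' \<Longrightarrow> B = E'"
    using right_artinian_minimal[OF assms(1), of "carrier R" ?F] by blast
  then have rE': "right_ideal R E'" and sum: "E <+>\<^bsub>R\<^esub> E' = carrier R" and J: "jacobson \<subseteq> E'" by auto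
  have "x \<in> jacobson" if x: "x \<in> E \<inter> E'" for x
  proof (rule ccontr)
    assume "x \<notin> jacobson"
    then obtain I where I: "maximal_right_ideal I" "x \<notin> I"
      using x right_idealD(3)[OF assms(2)] unfolding jacobson_iff by blast
    have rI: "right_ideal R I" using I unfolding maximal_right_ideal_def by blast
    let ?B = "E' \<inter> I"
    have full: "I <+>\<^bsub>R\<^esub> (E \<inter> E') = carrier R"
      using I x by (intro maximal_right_ideal_sum right_ideal_Int assms(2) rE') auto
    have "E' \<subseteq> E <+>\<^bsub>R\<^esub> ?B"
    proof
      fix e assume e: "e \<in> E'"
      then have "e \<in> I <+>\<^bsub>R\<^esub> (E \<inter> E')" using full right_idealD(3)[OF rE'] by blast
      then obtain i d where id: "i \<in> I" "d \<in> E \<inter> E'" "e = i \<oplus> d" unfolding mem_set_add by blast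
      have c: "i \<in> carrier R" "d \<in> carrier R"
        using id right_idealD(3)[OF rI] right_idealD(3)[OF rE'] by auto
      have "d \<oplus> i \<in> E'" using e id c a_comm by simp
      then have "i \<in> E'" using right_ideal_add_cancel[OF rE' _ c(1), of d] id by blast
      then show "e \<in> E <+>\<^bsub>R\<^esub> ?B" unfolding mem_set_add using id c a_comm by blast
    qed
    moreover have B: "right_ideal R ?B" using rE' rI by (rule right_ideal_Int)
    ultimately have "E <+>\<^bsub>R\<^esub> E' \<subseteq> E <+>\<^bsub>R\<^esub> ?B"
      using right_ideal_sum[OF assms(2) B] by (intro right_ideal_sum_least) auto
    then have "E <+>\<^bsub>R\<^esub> ?B = carrier R"
      using sum right_ideal_sum(1)[OF assms(2) B] right_idealD(1) by blast
    moreover have "jacobson \<subseteq> ?B" using J I(1) unfolding jacobson_iff subset_iff by blast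
    ultimately have "?B = E'" using min[of ?B] B by blast
    then show False using x I(2) by blast
  qed
  then have "E \<inter> E' = jacobson" using J assms(3) by blast
  then show thesis using that rE' sum by blast
qed

text \<open>
  Every right ideal of the semisimple ring \<open>R / J\<close> is an intersection of maximal ones. A right ideal \<open>A\<close> that is maximal
  without \<open>r\<close> is a maximal right ideal, because its complement modulo \<open>J\<close> has to be simple.
\<close>

lemma artinian_maximal_avoiding:
  assumes "right_artinian R" "right_ideal R E" "jacobson \<subseteq> E" "r \<in> carrier R" "r \<notin> E"
  obtains I where "maximal_right_ideal I" "E \<subseteq> I" "r \<notin> I"
proof -
  have "E \<inter> {r} = {}" using assms(5) by blast
  then obtain A where A: "right_ideal R A" "E \<subseteq> A" "A \<inter> {r} = {}"
    and Amax: "\<And>B. right_ideal R B \<Longrightarrow> A \<subseteq> B \<Longrightarrow> B \<inter> {r} = {} \<Longrightarrow> B = A"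
    using right_ideal_maximal_avoiding[OF assms(2)] by blast
  obtain A' where A': "right_ideal R A'" "A <+>\<^bsub>R\<^esub> A' = carrier R" "A \<inter> A' = jacobson"
    using artinian_complement[OF assms(1) A(1)] A(2) assms(3) by blast
  have "r \<in> A <+>\<^bsub>R\<^esub> A'" using A'(2) assms(4) by simp
  then obtain a a' where r: "a \<in> A" "a' \<in> A'" "r = a \<oplus> a'" unfolding mem_set_add by blast
  have ac: "a \<in> carrier R" "a' \<in> carrier R" using r right_idealD(3) A(1) A'(1) by blast+
  have "a' \<notin> jacobson"
    using A'(3) r A(3) right_idealD(4)[OF A(1), of a a'] by blast
  then obtain I0 where I0: "maximal_right_ideal I0" "a' \<notin> I0"
    using ac unfolding jacobson_iff by blast
  have rI0: "right_ideal R I0" using I0 unfolding maximal_right_ideal_def by blast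
  have J_I0: "jacobson \<subseteq> I0" using I0(1) unfolding jacobson_iff subset_iff by blast
  have rB: "right_ideal R (A' \<inter> I0)" using A'(1) rI0 by (rule right_ideal_Int)
  note sB = right_ideal_sum[OF A(1) rB]
  have "r \<notin> A <+>\<^bsub>R\<^esub> (A' \<inter> I0)"
  proof
    assume "r \<in> A <+>\<^bsub>R\<^esub> (A' \<inter> I0)"
    then obtain b c where bc: "b \<in> A" "c \<in> A' \<inter> I0" "r = b \<oplus> c" unfolding mem_set_add by blast
    have bcc: "b \<in> carrier R" "c \<in> carrier R" using bc right_idealD(3) A(1) rI0 by blast+
    have "a' \<ominus> c = b \<ominus> a"
      using add_eq_imp_diff_eq[of a a' b c] r bc ac bcc by simp
    moreover have "b \<ominus> a \<in> A" using right_idealD(7)[OF A(1)] bc r by blast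
    moreover have "a' \<ominus> c \<in> A'" using right_idealD(7)[OF A'(1)] bc r by blast
    ultimately have "a' \<ominus> c \<in> I0" using A'(3) J_I0 by auto
    moreover have "a' = c \<oplus> (a' \<ominus> c)" using ac bcc by (simp add: minus_eq a_comm[of a'] a_assoc[symmetric] r_neg)
    ultimately show False using right_idealD(4)[OF rI0, of c "a' \<ominus> c"] bc I0(2) by auto
  qed
  then have "A <+>\<^bsub>R\<^esub> (A' \<inter> I0) = A" using Amax[OF sB(1,2)] by blast
  then have AI0: "A' \<inter> I0 \<subseteq> A" using sB(3) by blast
  have "maximal_right_ideal A" unfolding maximal_right_ideal_def
  proof (intro conjI allI impI)
    show "right_ideal R A" by (rule A(1))
    show "A \<noteq> carrier R" using A(3) assms(4) by blast
    fix K assume K: "right_ideal R K \<and> A \<subset> K"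
    then have rK: "right_ideal R K" and AK: "A \<subseteq> K" by auto
    have "r \<in> K" using Amax[OF rK AK] K by blast
    then have a'K: "a' \<in> K" using right_ideal_add_cancel[OF rK _ ac(2), of a] r AK by blast
    have rKA: "right_ideal R (K \<inter> A')" using rK A'(1) by (rule right_ideal_Int)
    have "I0 <+>\<^bsub>R\<^esub> (K \<inter> A') = carrier R"
      using a'K r I0 by (intro maximal_right_ideal_sum rKA) auto
    have "A' \<subseteq> K"
    proof
      fix e assume e: "e \<in> A'"
      then have "e \<in> I0 <+>\<^bsub>R\<^esub> (K \<inter> A')"
        using \<open>I0 <+>\<^bsub>R\<^esub> (K \<inter> A') = carrier R\<close> right_idealD(3)[OF A'(1)] by blast
      then obtain i d where id: "i \<in> I0" "d \<in> K \<inter> A'" "e = i \<oplus> d" unfolding mem_set_add by blast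
      have c: "i \<in> carrier R" "d \<in> carrier R"
        using id right_idealD(3)[OF rI0] right_idealD(3)[OF rK] by auto
      have "d \<oplus> i \<in> A'" using e id c a_comm by simp
      then have "i \<in> A'" using right_ideal_add_cancel[OF A'(1) _ c(1), of d] id by blast
      then have "i \<in> K" using AI0 AK id by blast
      then show "e \<in> K" using id right_idealD(4)[OF rK] by blast
    qed
    then have "A <+>\<^bsub>R\<^esub> A' \<subseteq> K" using AK right_ideal_sum_least[OF rK] by blast
    then show "K = carrier R" using A'(2) right_idealD(1)[OF rK] by blast
  qed
  then show thesis using that[of A] A by blast
qed

text \<open>
  \<open>B / A\<close> is a module over the semisimple ring \<open>R / J\<close>. Its quotient by a submodule \<open>N / A\<close> that is maximal without the
  class of \<open>x\<close> has \<open>x\<close> in every nonzero submodule. A cyclic module over \<open>R / J\<close> with this property is simple.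
\<close>

lemma artinian_residually_simple:
  assumes "right_artinian R" "right_ideal R A" "right_ideal R B" "A \<subseteq> B"
    and "\<And>b j. b \<in> B \<Longrightarrow> j \<in> jacobson \<Longrightarrow> b \<otimes> j \<in> A"
    and "x \<in> B" "x \<notin> A"
  obtains N where "right_ideal R N" "A \<subseteq> N" "N \<subseteq> B" "x \<notin> N"
    "\<And>K. right_ideal R K \<Longrightarrow> N \<subseteq> K \<Longrightarrow> K \<subseteq> B \<Longrightarrow> K = N \<or> K = B"
proof -
  let ?D = "insert x (carrier R - B)"
  have "A \<inter> ?D = {}" using assms(4,7) by blast
  then obtain N where N: "right_ideal R N" "A \<subseteq> N" "N \<inter> ?D = {}"
    and Nmax: "\<And>K. right_ideal R K \<Longrightarrow> N \<subseteq> K \<Longrightarrow> K \<inter> ?D = {} \<Longrightarrow> K = N"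
    using right_ideal_maximal_avoiding[OF assms(2), of ?D] by blast
  have NB: "N \<subseteq> B" "x \<notin> N" using N(3) right_idealD(1)[OF N(1)] by blast+
  have "K = N \<or> K = B" if K: "right_ideal R K" "N \<subseteq> K" "K \<subseteq> B" for K
  proof (rule ccontr)
    assume "\<not> (K = N \<or> K = B)"
    then obtain y where y: "y \<in> B" "y \<notin> K" and "K \<noteq> N" using K(3) by blast
    then have xK: "x \<in> K" using Nmax[OF K(1,2)] K(3) by blast
    have yc: "y \<in> carrier R" using y right_idealD(3)[OF assms(3)] by blast
    let ?yR = "\<lambda>S. (\<lambda>w. y \<otimes> w) ` S"
    have sub: "N <+>\<^bsub>R\<^esub> ?yR S \<subseteq> B" if "S \<subseteq> carrier R" for S
      using NB(1) right_idealD(5)[OF assms(3) y(1)] that by (intro right_ideal_sum_least[OF assms(3)]) auto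
    have yR: "right_ideal R (?yR (carrier R))" by (rule right_ideal_lmult[OF right_ideal_carrier yc])
    have "y \<in> ?yR (carrier R)" using yc by (intro image_eqI[of _ _ \<one>]) auto
    then have yin: "y \<in> N <+>\<^bsub>R\<^esub> ?yR (carrier R)" using right_ideal_sum(3)[OF N(1) yR] by blast
    have "x \<in> N <+>\<^bsub>R\<^esub> ?yR (carrier R)"
    proof (rule ccontr)
      assume "x \<notin> N <+>\<^bsub>R\<^esub> ?yR (carrier R)"
      then have "N <+>\<^bsub>R\<^esub> ?yR (carrier R) = N"
        using Nmax[OF right_ideal_sum(1,2)[OF N(1) yR]] sub[OF order_refl] by blast
      then show False using yin y(2) K(2) by blast
    qed
    then obtain n r where nr: "n \<in> N" "r \<in> carrier R" "x = n \<oplus> y \<otimes> r" unfolding mem_set_add by blast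
    have nc: "n \<in> carrier R" using nr right_idealD(3)[OF N(1)] by blast
    let ?E = "{s \<in> carrier R. y \<otimes> s \<in> N}"
    have E: "right_ideal R ?E" by (rule right_ideal_vimage[OF N(1) yc right_ideal_carrier])
    have JE: "jacobson \<subseteq> ?E"
      using assms(5)[OF y(1)] N(2) right_idealD(1)[OF right_ideal_jacobson] by blast
    have "r \<notin> ?E" using nr NB(2) right_idealD(4)[OF N(1)] by blast
    then obtain I where I: "maximal_right_ideal I" "?E \<subseteq> I" "r \<notin> I"
      using artinian_maximal_avoiding[OF assms(1) E JE nr(2)] by blast
    then have rI: "right_ideal R I" unfolding maximal_right_ideal_def by blast
    have yI: "right_ideal R (?yR I)" by (rule right_ideal_lmult[OF rI yc])
    have "x \<notin> N <+>\<^bsub>R\<^esub> ?yR I"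
    proof
      assume "x \<in> N <+>\<^bsub>R\<^esub> ?yR I"
      then obtain n' i where ni: "n' \<in> N" "i \<in> I" "x = n' \<oplus> y \<otimes> i" unfolding mem_set_add by blast
      have c: "n' \<in> carrier R" "i \<in> carrier R"
        using ni right_idealD(3)[OF N(1)] right_idealD(3)[OF rI] by auto
      have "y \<otimes> (r \<ominus> i) = n' \<ominus> n"
        using add_eq_imp_diff_eq[of n "y \<otimes> r" n' "y \<otimes> i"] nr ni nc c yc
        by (simp add: minus_eq r_distr r_minus)
      then have "r \<ominus> i \<in> ?E" using right_idealD(7)[OF N(1) ni(1) nr(1)] nr c by auto
      then have "i \<oplus> (r \<ominus> i) \<in> I" using I(2) ni right_idealD(4)[OF rI] by blast
      then show False using I(3) nr c by (simp add: minus_eq a_comm[of r] a_assoc[symmetric] r_neg)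
    qed
    then have "N <+>\<^bsub>R\<^esub> ?yR I = N"
      using Nmax[OF right_ideal_sum(1,2)[OF N(1) yI]] sub[OF right_idealD(1)[OF rI]] by blast
    then have "I \<subseteq> ?E" using right_ideal_sum(3)[OF N(1) yI] right_idealD(1)[OF rI] by blast
    then have IE: "I = ?E" using I(2) by blast
    let ?E' = "{s \<in> carrier R. y \<otimes> s \<in> K}"
    have E': "right_ideal R ?E'" by (rule right_ideal_vimage[OF K(1) yc right_ideal_carrier])
    have "y \<otimes> r \<in> K"
      using right_ideal_add_cancel[OF K(1), of n "y \<otimes> r"] nr xK K(2) yc by auto
    then have "I \<subset> ?E'" using IE K(2) I(3) nr(2) by blast
    then have "?E' = carrier R" using I(1) E' unfolding maximal_right_ideal_def by blast
    then have "\<one> \<in> ?E'" by simp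
    then show False using y(2) yc by simp
  qed
  then show thesis using that N NB by blast
qed

text \<open>
  The condition concerns all subquotients of \<open>R\<close> that \<open>E\<close> annihilates, not only \<open>R / E\<close>, so that it passes to
  products of ideals.
\<close>

definition acc_over :: "'a set \<Rightarrow> bool" where
  "acc_over E \<longleftrightarrow> (\<forall>A B. right_ideal R A \<and> right_ideal R B \<and> A \<subseteq> B \<and>
     (\<forall>b\<in>B. \<forall>e\<in>E. b \<otimes> e \<in> A) \<longrightarrow> acc_between A B)"

text \<open>
  A right ideal \<open>C\<close> minimal with \<open>B / C\<close> Noetherian lies in every \<open>N\<close> for which \<open>B / N\<close> is simple, and the
  intersection of these \<open>N\<close> is \<open>A\<close>.
\<close>

lemma artinian_acc_over_jacobson:
  assumes "right_artinian R"
  shows "acc_over jacobson"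
  unfolding acc_over_def
proof (intro allI impI)
  fix A B
  assume "right_ideal R A \<and> right_ideal R B \<and> A \<subseteq> B \<and> (\<forall>b\<in>B. \<forall>e\<in>jacobson. b \<otimes> e \<in> A)"
  then have A: "right_ideal R A" and B: "right_ideal R B" and AB: "A \<subseteq> B"
    and ann: "\<And>b j. b \<in> B \<Longrightarrow> j \<in> jacobson \<Longrightarrow> b \<otimes> j \<in> A" by auto
  let ?F = "{C. right_ideal R C \<and> A \<subseteq> C \<and> C \<subseteq> B \<and> acc_between C B}"
  have "acc_between B B" by (rule simple_interval(2)) auto
  then have "B \<in> ?F" using A B AB by blast
  then obtain C where C: "C \<in> ?F" and Cmin: "\<And>K. K \<in> ?F \<Longrightarrow> K \<subseteq> C \<Longrightarrow> K = C"
    using right_artinian_minimal[OF assms, of B ?F] by blast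
  then have rC: "right_ideal R C" "A \<subseteq> C" "C \<subseteq> B" "acc_between C B" by auto
  have "C \<subseteq> A"
  proof (rule ccontr)
    assume "\<not> C \<subseteq> A"
    then obtain x where x: "x \<in> C" "x \<notin> A" by blast
    then obtain N where N: "right_ideal R N" "A \<subseteq> N" "N \<subseteq> B" "x \<notin> N"
      "\<And>K. right_ideal R K \<Longrightarrow> N \<subseteq> K \<Longrightarrow> K \<subseteq> B \<Longrightarrow> K = N \<or> K = B"
      using artinian_residually_simple[OF assms A B AB ann, of x] rC(3) by blast
    have "acc_between N B" using N(5) by (rule simple_interval(2))
    then have "acc_between (N \<inter> C) C" using acc_between_Int[OF B N(1) rC(1) N(3) rC(3)] by blast
    moreover have NC: "right_ideal R (N \<inter> C)" using N(1) rC(1) by (rule right_ideal_Int)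
    ultimately have "acc_between (N \<inter> C) B"
      using acc_between_trans[OF rC(1) B _ rC(3) _ rC(4), of "N \<inter> C"] by blast
    then have "N \<inter> C = C" using Cmin[of "N \<inter> C"] NC N(2) rC by blast
    then show False using x N(4) by blast
  qed
  then show "acc_between A B" using rC by (metis subset_antisym)
qed

lemma acc_over_prod:
  assumes "ideal E R" "ideal E' R" "acc_over E" "acc_over E'"
  shows "acc_over (E \<cdot> E')"
  unfolding acc_over_def
proof (intro allI impI)
  fix A B
  assume "right_ideal R A \<and> right_ideal R B \<and> A \<subseteq> B \<and> (\<forall>b\<in>B. \<forall>e\<in>E \<cdot> E'. b \<otimes> e \<in> A)"
  then have A: "right_ideal R A" and B: "right_ideal R B" and AB: "A \<subseteq> B"
    and EE': "\<And>b t. b \<in> B \<Longrightarrow> t \<in> E \<cdot> E' \<Longrightarrow> b \<otimes> t \<in> A" by auto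
  have ann: "b \<otimes> (e \<otimes> e') \<in> A" if "b \<in> B" "e \<in> E" "e' \<in> E'" for b e e'
    using EE'[OF that(1) ideal_prod.prod[OF that(2,3)]] .
  note dA = right_idealD[OF A] and dB = right_idealD[OF B]
  have Ec: "e \<in> carrier R" if "e \<in> E" for e using ideal.Icarr[OF assms(1) that] .
  have Ec': "e \<in> carrier R" if "e \<in> E'" for e using ideal.Icarr[OF assms(2) that] .
  \<comment> \<open>The elements of \<open>B\<close> that \<open>E'\<close> carries into \<open>A\<close> separate the two factors.\<close>
  let ?C = "{c \<in> B. \<forall>e'\<in>E'. c \<otimes> e' \<in> A}"
  have "c \<otimes> r \<otimes> e' \<in> A" if "c \<in> ?C" "r \<in> carrier R" "e' \<in> E'" for c r e'
    using that dB(3) Ec' ideal.I_l_closed[OF assms(2)] by (simp add: m_assoc)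
  then have C: "right_ideal R ?C"
    unfolding right_ideal_iff using dA dB Ec' by (auto simp: l_distr)
  have "acc_between ?C B"
  proof -
    have "b \<otimes> e \<in> ?C" if "b \<in> B" "e \<in> E" for b e
      using that ann dB(3,5) Ec Ec' by (simp add: m_assoc)
    then show ?thesis using assms(3) C B unfolding acc_over_def by blast
  qed
  moreover have AC: "A \<subseteq> ?C" using AB dA(5) Ec' by blast
  moreover have "acc_between A ?C"
    using assms(4) A C AC unfolding acc_over_def by blast
  ultimately show "acc_between A B" using acc_between_trans[OF C B, of A] by blast
qed

text \<open>
  The smallest ideal \<open>N\<close> with \<open>acc_over N\<close> is idempotent and lies in the radical. A
  right ideal \<open>I\<close> minimal subject to \<open>I N \<noteq> 0\<close> would satisfy \<open>I = x N\<close> for some \<open>x \<in> I\<close>, hence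
  \<open>x = x n\<close> with \<open>n\<close> in the radical, which forces \<open>x = 0\<close>. So \<open>N = 0\<close>.
\<close>

theorem right_artinian_imp_right_noetherian:
  assumes art: "right_artinian R"
  shows "right_noetherian R"
proof -
  let ?F = "{E. ideal E R \<and> acc_over E}"
  have J: "jacobson \<in> ?F"
    using artinian_acc_over_jacobson[OF art] ideal_radical_over(1)[OF ideal_zero] by blast
  obtain N where N: "N \<in> ?F" and Nmin: "\<And>E. E \<in> ?F \<Longrightarrow> E \<subseteq> N \<Longrightarrow> E = N"
    using right_artinian_minimal[OF art J] ideal_right_ideal by blast
  have prodN: "N \<cdot> E = N" "N \<subseteq> E" if E: "E \<in> ?F" for E
  proof -
    have "N \<cdot> E \<in> ?F" using N E ideal_prod_is_ideal acc_over_prod by blast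
    moreover have "N \<cdot> E \<subseteq> N \<inter> E" using N E ideal_prod_inter by blast
    ultimately show "N \<cdot> E = N" "N \<subseteq> E" using Nmin by blast+
  qed
  have Nid: "ideal N R" using N by blast
  have Nc: "n \<in> carrier R" if "n \<in> N" for n using ideal.Icarr[OF Nid that] .
  have "N \<subseteq> {\<zero>}"
  proof (rule ccontr)
    assume "\<not> N \<subseteq> {\<zero>}"
    then obtain n where n: "n \<in> N" "n \<noteq> \<zero>" by blast
    let ?G = "{I. right_ideal R I \<and> (\<exists>x\<in>I. \<exists>n\<in>N. x \<otimes> n \<noteq> \<zero>)}"
    have "\<one> \<otimes> n \<noteq> \<zero>" using n Nc by simp
    then have "carrier R \<in> ?G" using right_ideal_carrier n(1) by blast
    then obtain I where I: "I \<in> ?G" and Imin: "\<And>K. K \<in> ?G \<Longrightarrow> K \<subseteq> I \<Longrightarrow> K = I"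
      using right_artinian_minimal[OF art, of "carrier R" ?G] by blast
    then obtain x n0 where x: "x \<in> I" "n0 \<in> N" "x \<otimes> n0 \<noteq> \<zero>" and rI: "right_ideal R I" by blast
    have xc: "x \<in> carrier R" using right_idealD(3)[OF rI x(1)] .
    have xN: "right_ideal R ((\<lambda>w. x \<otimes> w) ` N)" by (rule right_ideal_lmult[OF ideal_right_ideal[OF Nid] xc])
    have "\<exists>n\<in>N. \<exists>n'\<in>N. (x \<otimes> n) \<otimes> n' \<noteq> \<zero>"
    proof (rule ccontr)
      assume *: "\<not> ?thesis"
      have "x \<otimes> t = \<zero> \<and> t \<in> carrier R" if "t \<in> N \<cdot> N" for t
        using that
      proof induction
        case (prod i j)
        then show ?case using * xc Nc by (auto simp: m_assoc)
      next
        case (sum s1 s2)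
        then show ?case using xc by (simp add: r_distr)
      qed
      then show False using prodN(1)[OF N] x(2,3) by auto
    qed
    then have "(\<lambda>w. x \<otimes> w) ` N \<in> ?G" using xN by blast
    moreover have "(\<lambda>w. x \<otimes> w) ` N \<subseteq> I" using right_idealD(5)[OF rI x(1)] Nc by blast
    ultimately have "(\<lambda>w. x \<otimes> w) ` N = I" by (rule Imin)
    then obtain m where m: "m \<in> N" "x = x \<otimes> m" using x(1) by blast
    then have "m \<in> jacobson" using prodN(2)[OF J] by blast
    then obtain u q where "u \<in> carrier R" "q \<in> {\<zero>}" "\<one> = q \<oplus> (\<one> \<ominus> m) \<otimes> u"
      by (rule right_ideal_right_inverse[OF right_ideal_zero])
    then have u: "u \<in> carrier R" "\<one> = (\<one> \<ominus> m) \<otimes> u" using Nc[OF m(1)] by auto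
    have "x \<otimes> (\<one> \<ominus> m) = \<zero>"
      using xc Nc[OF m(1)] m(2)[symmetric] by (simp add: minus_eq r_distr r_minus r_neg)
    then have "x \<otimes> ((\<one> \<ominus> m) \<otimes> u) = \<zero>"
      using xc Nc[OF m(1)] u(1) by (simp add: m_assoc[symmetric])
    then have "x = \<zero>" using u(2) xc by simp
    then show False using x Nc by simp
  qed
  then have "N = {\<zero>}" using right_idealD(2)[OF ideal_right_ideal[OF Nid]] by blast
  then have "acc_over {\<zero>}" using N by blast
  then have "acc_between {\<zero>} (carrier R)"
    using right_ideal_zero right_ideal_carrier unfolding acc_over_def by auto
  then show ?thesis unfolding right_noetherian_iff_acc .
qed

end

section \<open>Ideals that are maximal among those with a non-Artinian quotient\<close>

text \<open>
  A Noetherian module generated by homomorphic images \<open>x W\<close> of an Artinian module \<open>W / B\<close> is Artinian. Instead of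
  choosing finitely many generators, one takes a submodule that is maximal among the Artinian ones.
\<close>

lemma (in ring) dcc_between_span:
  assumes "right_noetherian R" "right_ideal R p" "right_ideal R D" "p \<subseteq> D" "right_ideal R W"
    and "B \<subseteq> W" "dcc_between B W"
    and G: "\<And>x. x \<in> G \<Longrightarrow> x \<in> carrier R" "\<And>x b. x \<in> G \<Longrightarrow> b \<in> B \<Longrightarrow> x \<otimes> b \<in> p"
      "\<And>x w. x \<in> G \<Longrightarrow> w \<in> W \<Longrightarrow> x \<otimes> w \<in> D"
    and span: "\<And>A. right_ideal R A \<Longrightarrow> p \<subseteq> A \<Longrightarrow> (\<And>x w. x \<in> G \<Longrightarrow> w \<in> W \<Longrightarrow> x \<otimes> w \<in> A) \<Longrightarrow> D \<subseteq> A"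
  shows "dcc_between p D"
proof -
  let ?F = "{A. right_ideal R A \<and> p \<subseteq> A \<and> A \<subseteq> D \<and> dcc_between p A}"
  have "dcc_between p p" by (rule simple_interval(1)) auto
  then have "p \<in> ?F" using assms(2,4) by blast
  then obtain A where A: "A \<in> ?F" and Amax: "\<And>B. B \<in> ?F \<Longrightarrow> A \<subseteq> B \<Longrightarrow> B = A"
    using right_noetherian_maximal[OF assms(1), of p ?F] by blast
  then have rA: "right_ideal R A" "p \<subseteq> A" "A \<subseteq> D" "dcc_between p A" by auto
  have "x \<otimes> w \<in> A" if x: "x \<in> G" and w: "w \<in> W" for x w
  proof -
    let ?xW = "(\<lambda>w. x \<otimes> w) ` W"
    have xW: "right_ideal R ?xW" by (rule right_ideal_lmult[OF assms(5) G(1)[OF x]])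
    note s = right_ideal_sum[OF rA(1) xW]
    have "dcc_between A (A <+>\<^bsub>R\<^esub> ?xW)"
      using G(2)[OF x] rA(2) by (intro dcc_between_lmult[OF rA(1) assms(5) G(1)[OF x] _ assms(6,7)]) blast
    then have "dcc_between p (A <+>\<^bsub>R\<^esub> ?xW)"
      using dcc_between_trans[OF rA(1) s(1) rA(2) s(2) rA(4)] by blast
    moreover have "A <+>\<^bsub>R\<^esub> ?xW \<subseteq> D"
      using rA(3) G(3)[OF x] by (intro right_ideal_sum_least assms(3)) auto
    ultimately have "A <+>\<^bsub>R\<^esub> ?xW = A" using Amax s(1,2) rA(2) by blast
    then show ?thesis using s(3) w by blast
  qed
  then have "D \<subseteq> A" by (intro span rA(1,2))
  then show ?thesis using rA(3,4) by (metis subset_antisym)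
qed

locale critical_ideal = ring R for R :: "('a, 'r) ring_scheme" (structure) +
  fixes p :: "'a set"
  assumes noetherian: "right_noetherian R" and ideal_p: "ideal p R"
    and not_dcc: "\<not> dcc_between p (carrier R)"
    and dcc_above: "\<And>D. ideal D R \<Longrightarrow> p \<subset> D \<Longrightarrow> dcc_between D (carrier R)"

lemma (in ring) critical_ideal_ex:
  assumes "right_noetherian R" "\<not> right_artinian R"
  obtains p where "critical_ideal R p"
proof -
  let ?F = "{p. ideal p R \<and> \<not> dcc_between p (carrier R)}"
  have "{\<zero>} \<in> ?F" using assms(2) zeroideal unfolding right_artinian_iff_dcc by blast
  then obtain p where p: "p \<in> ?F" "\<And>B. B \<in> ?F \<Longrightarrow> p \<subseteq> B \<Longrightarrow> B = p"
    using right_noetherian_maximal[OF assms(1), of "{\<zero>}" ?F] ideal_right_ideal by blast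
  then have "critical_ideal R p"
    using assms(1) ring_axioms unfolding critical_ideal_def critical_ideal_axioms_def by blast
  then show thesis by (rule that)
qed

context critical_ideal
begin

lemma right_ideal_p: "right_ideal R p"
  using ideal_p by (rule ideal_right_ideal)

lemma p_carrier: "x \<in> p \<Longrightarrow> x \<in> carrier R"
  using ideal.Icarr[OF ideal_p] .

lemma p_proper: "\<one> \<notin> p"
proof
  assume "\<one> \<in> p"
  then have "p = carrier R" using right_ideal_one right_ideal_p by blast
  then show False using not_dcc simple_interval(1)[of "carrier R" "carrier R"] by blast
qed

lemma not_dcc_ideal:
  assumes "ideal D R" "p \<subset> D" shows "\<not> dcc_between p D"
  using dcc_between_trans[OF ideal_right_ideal[OF assms(1)] right_ideal_carrier, of p]
    dcc_above[OF assms] not_dcc assms right_idealD(1)[OF ideal_right_ideal[OF assms(1)]] by blast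

text \<open>
  The ideal \<open>p\<close> is prime. If \<open>J B \<subseteq> p\<close> for ideals \<open>J\<close> and \<open>B\<close> properly above \<open>p\<close>, then \<open>J / p\<close> is a
  finitely generated module over the Artinian ring \<open>R / B\<close>, so \<open>R / p\<close> is an extension of Artinian modules. Below,
  \<open>B\<close> is the set of all \<open>x\<close> with \<open>J x \<subseteq> p\<close>.
\<close>

lemma prime_step:
  assumes J: "ideal J R" "p \<subset> J" and c: "c \<in> carrier R" "c \<notin> p"
  shows "\<exists>a\<in>J. a \<otimes> c \<notin> p"
proof (rule ccontr)
  assume *: "\<not> ?thesis"
  note Jr = right_idealD[OF ideal_right_ideal[OF J(1)]] and pr = right_idealD[OF right_ideal_p]
  let ?B = "{x \<in> carrier R. \<forall>a\<in>J. a \<otimes> x \<in> p}"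
  have B: "right_ideal R ?B"
    unfolding right_ideal_iff using pr Jr(3) by (auto simp: r_distr m_assoc[symmetric])
  have "r \<otimes> x \<in> ?B" if "x \<in> ?B" "r \<in> carrier R" for r x
    using that Jr(3,5) by (auto simp: m_assoc[symmetric])
  with B have "ideal ?B R" by (rule right_ideal_imp_ideal)
  moreover have "p \<subseteq> ?B"
    using p_carrier ideal.I_l_closed[OF ideal_p] Jr(3) by auto
  moreover have "c \<in> ?B" using * c(1) by blast
  ultimately have dB: "dcc_between ?B (carrier R)" using dcc_above c(2) by blast
  have "dcc_between p J"
  proof (rule dcc_between_span[OF noetherian right_ideal_p ideal_right_ideal[OF J(1)] _ right_ideal_carrier _ dB])
    fix A assume A: "right_ideal R A" "\<And>x w. x \<in> J \<Longrightarrow> w \<in> carrier R \<Longrightarrow> x \<otimes> w \<in> A"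
    show "J \<subseteq> A"
    proof
      fix x assume "x \<in> J"
      then show "x \<in> A" using A(2)[of x \<one>] Jr(3) by simp
    qed
  qed (use J(2) Jr in auto)
  then show False using not_dcc_ideal[OF J] by blast
qed

text \<open>
  If \<open>W / p\<close> were simple, the two-sided ideal generated by \<open>W\<close> would be, modulo \<open>p\<close>, a finite sum of images of
  \<open>W / p\<close>, hence Artinian. So would then be \<open>R / p\<close>.
\<close>

lemma no_minimal_right_ideal:
  assumes W: "right_ideal R W" "p \<subset> W"
  shows "\<exists>U. right_ideal R U \<and> p \<subset> U \<and> U \<subset> W"
proof (rule ccontr)
  assume *: "\<not> ?thesis"
  have simple: "U = p \<or> U = W" if "right_ideal R U" "p \<subseteq> U" "U \<subseteq> W" for U
    using * that by (metis psubsetI)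
  have dW: "dcc_between p W" using simple by (rule simple_interval(1))
  have Wc: "W \<subseteq> carrier R" using right_idealD(1)[OF W(1)] .
  have D: "ideal (Idl W) R" "W \<subseteq> Idl W" using genideal_ideal[OF Wc] genideal_self[OF Wc] by auto
  have "dcc_between p (Idl W)"
  proof (rule dcc_between_span[OF noetherian right_ideal_p ideal_right_ideal[OF D(1)] _ W(1) _ dW, where G="carrier R"])
    show "p \<subseteq> Idl W" "p \<subseteq> W" using W(2) D(2) by auto
    show "x \<otimes> b \<in> p" if "x \<in> carrier R" "b \<in> p" for x b using ideal.I_l_closed[OF ideal_p] that by blast
    show "x \<otimes> w \<in> Idl W" if "x \<in> carrier R" "w \<in> W" for x w
      using ideal.I_l_closed[OF D(1)] that D(2) by blast
    fix A assume A: "right_ideal R A" "\<And>x w. x \<in> carrier R \<Longrightarrow> w \<in> W \<Longrightarrow> x \<otimes> w \<in> A"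
    \<comment> \<open>The largest two-sided ideal inside \<open>A\<close>.\<close>
    let ?C = "{d \<in> carrier R. \<forall>r\<in>carrier R. r \<otimes> d \<in> A}"
    note Ar = right_idealD[OF A(1)]
    have C: "right_ideal R ?C"
      unfolding right_ideal_iff using Ar by (auto simp: r_distr m_assoc[symmetric])
    have "s \<otimes> d \<in> ?C" if "d \<in> ?C" "s \<in> carrier R" for d s
      using that by (auto simp: m_assoc[symmetric])
    with C have "ideal ?C R" by (rule right_ideal_imp_ideal)
    then have "Idl W \<subseteq> ?C" using genideal_minimal A(2) Wc by blast
    moreover have "?C \<subseteq> A" by (auto dest: bspec[of _ _ \<one>])
    ultimately show "Idl W \<subseteq> A" by blast
  qed auto
  then show False using not_dcc_ideal[OF D(1)] W(2) D(2) by blast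
qed

text \<open>If \<open>I \<inter> W = p \<noteq> W\<close>, then \<open>I + W = R\<close>, so \<open>W / p\<close> is isomorphic to the simple module \<open>R / I\<close>.\<close>

lemma maximal_right_ideal_meets:
  assumes I: "maximal_right_ideal I" "p \<subseteq> I" and W: "right_ideal R W" "p \<subset> W"
  shows "\<not> I \<inter> W \<subseteq> p"
proof
  assume WI: "I \<inter> W \<subseteq> p"
  have rI: "right_ideal R I" using I(1) unfolding maximal_right_ideal_def by blast
  obtain U where U: "right_ideal R U" "p \<subset> U" "U \<subset> W"
    using no_minimal_right_ideal[OF W] by blast
  then have "\<not> U \<subseteq> I" using WI by blast
  then have IU: "I <+>\<^bsub>R\<^esub> U = carrier R" using maximal_right_ideal_sum[OF I(1) U(1)] by blast
  have "W \<subseteq> U"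
  proof
    fix w assume w: "w \<in> W"
    have wc: "w \<in> carrier R" using w right_idealD(3)[OF W(1)] by blast
    then have "w \<in> I <+>\<^bsub>R\<^esub> U" using IU by simp
    then obtain i u where iu: "i \<in> I" "u \<in> U" "w = i \<oplus> u" unfolding mem_set_add by blast
    have c: "i \<in> carrier R" "u \<in> carrier R"
      using iu right_idealD(3)[OF rI] right_idealD(3)[OF U(1)] by auto
    have "u \<oplus> i \<in> W" "u \<in> W" using w iu(3) c U(3) iu(2) a_comm by auto
    then have "i \<in> W" using right_ideal_add_cancel[OF W(1) _ c(1)] by blast
    then have "i \<in> U" using WI iu(1) U(2) by blast
    then show "w \<in> U" using iu right_idealD(4)[OF U(1)] by blast
  qed
  then show False using U(3) by blast
qed

lemma essential_maximal_right_ideal: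
  assumes I: "maximal_right_ideal I" "p \<subseteq> I"
  shows "essential_submodule R (right_regular R) I"
  unfolding essential_submodule_def
proof (intro conjI allI impI)
  show rI: "right_ideal R I" using I(1) unfolding maximal_right_ideal_def by blast
  fix K assume "right_ideal R K \<and> I \<inter> K = {\<zero>\<^bsub>right_regular R\<^esub>}"
  then have K: "right_ideal R K" "I \<inter> K = {\<zero>}" by auto
  note W = right_ideal_sum[OF right_ideal_p K(1)]
  have "I \<inter> (p <+>\<^bsub>R\<^esub> K) \<subseteq> p"
    unfolding right_ideal_modular[OF right_ideal_p K(1) rI I(2)] K(2)
    using right_idealD(2)[OF right_ideal_p] by (intro right_ideal_sum_least[OF right_ideal_p]) auto
  then have "\<not> p \<subset> p <+>\<^bsub>R\<^esub> K" using maximal_right_ideal_meets[OF I W(1)] by blast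
  then have "K \<subseteq> I" using W(2,3) I(2) by blast
  then show "K = {\<zero>\<^bsub>right_regular R\<^esub>}" using K(2) by auto
qed

end

section \<open>The free module on countably many generators\<close>

definition finite_sequences :: "('a, 'r) ring_scheme \<Rightarrow> ('a, nat \<Rightarrow> 'a) module" where
  "finite_sequences R =
    \<lparr>carrier = {v. range v \<subseteq> carrier R \<and> (\<exists>n. \<forall>i\<ge>n. v i = \<zero>\<^bsub>R\<^esub>)}, monoid.mult = undefined, one = undefined,
     ring.zero = (\<lambda>i. \<zero>\<^bsub>R\<^esub>), ring.add = (\<lambda>v w i. v i \<oplus>\<^bsub>R\<^esub> w i), smult = (\<lambda>r v i. v i \<otimes>\<^bsub>R\<^esub> r)\<rparr>"

lemma finite_sequences_simps [simp]:
  "\<zero>\<^bsub>finite_sequences R\<^esub> = (\<lambda>i. \<zero>\<^bsub>R\<^esub>)"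
  "v \<oplus>\<^bsub>finite_sequences R\<^esub> w = (\<lambda>i. v i \<oplus>\<^bsub>R\<^esub> w i)"
  "r \<odot>\<^bsub>finite_sequences R\<^esub> v = (\<lambda>i. v i \<otimes>\<^bsub>R\<^esub> r)"
  by (simp_all add: finite_sequences_def)

lemma finite_sequences_carrier:
  "v \<in> carrier (finite_sequences R) \<longleftrightarrow> (\<forall>i. v i \<in> carrier R) \<and> (\<exists>n. \<forall>i\<ge>n. v i = \<zero>\<^bsub>R\<^esub>)"
  by (auto simp: finite_sequences_def)

definition sequences_in :: "('a, 'r) ring_scheme \<Rightarrow> 'a set \<Rightarrow> (nat \<Rightarrow> 'a) set" where
  "sequences_in R I = {v \<in> carrier (finite_sequences R). \<forall>i. v i \<in> I}"

definition unit_seq :: "('a, 'r) ring_scheme \<Rightarrow> nat \<Rightarrow> 'a \<Rightarrow> nat \<Rightarrow> 'a" where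
  "unit_seq R i r = (\<lambda>j. if j = i then r else \<zero>\<^bsub>R\<^esub>)"

context ring
begin

lemma right_module_finite_sequences: "right_module R (finite_sequences R)"
proof -
  let ?V = "finite_sequences R"
  have add: "(\<lambda>i. v i \<oplus> w i) \<in> carrier ?V" if v: "v \<in> carrier ?V" and w: "w \<in> carrier ?V" for v w
  proof -
    from v w obtain m n where "\<forall>i\<ge>m. v i = \<zero>" "\<forall>i\<ge>n. w i = \<zero>" unfolding finite_sequences_carrier by blast
    then have "\<forall>i\<ge>max m n. v i \<oplus> w i = \<zero>" by simp
    then show ?thesis using v w unfolding finite_sequences_carrier by blast
  qed
  have smult: "(\<lambda>i. v i \<otimes> r) \<in> carrier ?V" if v: "v \<in> carrier ?V" and r: "r \<in> carrier R" for v r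
  proof -
    from v obtain n where "\<forall>i\<ge>n. v i = \<zero>" unfolding finite_sequences_carrier by blast
    then have "\<forall>i\<ge>n. v i \<otimes> r = \<zero>" using r by simp
    then show ?thesis using v r unfolding finite_sequences_carrier by blast
  qed
  have "abelian_group ?V"
  proof (rule abelian_groupI)
    fix v assume v: "v \<in> carrier ?V"
    then have "(\<lambda>i. \<ominus> v i) \<in> carrier ?V" unfolding finite_sequences_carrier by (metis a_inv_closed minus_zero)
    then show "\<exists>y\<in>carrier ?V. y \<oplus>\<^bsub>?V\<^esub> v = \<zero>\<^bsub>?V\<^esub>"
      using v by (intro bexI[of _ "\<lambda>i. \<ominus> v i"]) (auto simp: finite_sequences_carrier l_neg)
  qed (use add in \<open>auto simp: finite_sequences_carrier a_ac\<close>)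
  then show ?thesis
    by (intro right_module.intro right_module_axioms.intro ring_axioms)
       (simp_all add: smult, auto simp: finite_sequences_carrier r_distr l_distr m_assoc)
qed

lemma finite_sequences_diff:
  assumes "v \<in> carrier (finite_sequences R)" "w \<in> carrier (finite_sequences R)"
  shows "(\<lambda>i. v i \<ominus> w i) \<in> carrier (finite_sequences R)"
proof -
  obtain m n where "\<forall>i\<ge>m. v i = \<zero>" "\<forall>i\<ge>n. w i = \<zero>" using assms unfolding finite_sequences_carrier by blast
  then have "\<forall>i\<ge>max m n. v i \<ominus> w i = \<zero>" by (simp add: minus_eq)
  then show ?thesis using assms unfolding finite_sequences_carrier by blast
qed

lemma unit_seq_carrier [simp]: "r \<in> carrier R \<Longrightarrow> unit_seq R i r \<in> carrier (finite_sequences R)"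
  unfolding finite_sequences_carrier unit_seq_def by (intro conjI exI[of _ "Suc i"]) auto

lemma finite_sequences_generated:
  assumes v: "v \<in> carrier (finite_sequences R)" "\<And>i. v i \<in> I" and "\<zero> \<in> I"
    and T: "(\<lambda>i. \<zero>) \<in> T" "\<And>x y. x \<in> T \<Longrightarrow> y \<in> T \<Longrightarrow> x \<oplus>\<^bsub>finite_sequences R\<^esub> y \<in> T"
      "\<And>i r. r \<in> carrier R \<Longrightarrow> r \<in> I \<Longrightarrow> unit_seq R i r \<in> T"
  shows "v \<in> T"
proof -
  have "\<forall>v. (\<forall>i. v i \<in> carrier R \<and> v i \<in> I) \<and> (\<forall>i\<ge>n. v i = \<zero>) \<longrightarrow> v \<in> T" for n
  proof (induction n)
    case 0
    have "v = (\<lambda>i. \<zero>)" if "\<forall>i\<ge>(0::nat). v i = \<zero>" for v :: "nat \<Rightarrow> 'a" using that by auto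
    then show ?case using T(1) by blast
  next
    case (Suc n)
    show ?case
    proof (intro allI impI)
      fix v assume v: "(\<forall>i. v i \<in> carrier R \<and> v i \<in> I) \<and> (\<forall>i\<ge>Suc n. v i = \<zero>)"
      then have "v(n := \<zero>) \<in> T" using Suc assms(3) by (auto simp: Suc_le_eq)
      moreover have "unit_seq R n (v n) \<in> T" using v T(3) by blast
      moreover have "v = v(n := \<zero>) \<oplus>\<^bsub>finite_sequences R\<^esub> unit_seq R n (v n)"
        using v by (auto simp: unit_seq_def fun_eq_iff)
      ultimately show "v \<in> T" using T(2) by metis
    qed
  qed
  then show ?thesis using v unfolding finite_sequences_carrier by blast
qed

lemma submodule_sequences_in:
  assumes "right_ideal R I" shows "submodule (sequences_in R I) R (finite_sequences R)"
proof -
  interpret V: right_module R "finite_sequences R" by (rule right_module_finite_sequences)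
  note I = right_idealD[OF assms]
  show ?thesis unfolding V.submodule_iff
  proof (intro conjI ballI)
    show "sequences_in R I \<subseteq> carrier (finite_sequences R)" unfolding sequences_in_def by blast
    show "\<zero>\<^bsub>finite_sequences R\<^esub> \<in> sequences_in R I"
      unfolding sequences_in_def using I V.M.zero_closed by auto
    show "x \<oplus>\<^bsub>finite_sequences R\<^esub> y \<in> sequences_in R I" if "x \<in> sequences_in R I" "y \<in> sequences_in R I" for x y
      using that V.M.add.m_closed[of x y] I(4) unfolding sequences_in_def by auto
    show "r \<odot>\<^bsub>finite_sequences R\<^esub> x \<in> sequences_in R I" if "r \<in> carrier R" "x \<in> sequences_in R I" for x r
      using that V.smult_closed[of r x] I(5) unfolding sequences_in_def by auto
  qed
qed

end

section \<open>Relations in a flat module\<close>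

definition left_ideal :: "('a, 'r) ring_scheme \<Rightarrow> 'a set \<Rightarrow> bool" where
  "left_ideal R I \<longleftrightarrow> I \<subseteq> carrier R \<and> \<zero>\<^bsub>R\<^esub> \<in> I \<and> (\<forall>a\<in>I. \<forall>b\<in>I. a \<oplus>\<^bsub>R\<^esub> b \<in> I) \<and>
     (\<forall>r\<in>carrier R. \<forall>a\<in>I. r \<otimes>\<^bsub>R\<^esub> a \<in> I)"

text \<open>
  Flatness is tested on left modules of the type \<open>'m\<close>, so left ideals are transported along an injection \<open>\<phi>\<close>.
\<close>

definition left_ideal_copy :: "('a, 'r) ring_scheme \<Rightarrow> ('a \<Rightarrow> 'm) \<Rightarrow> 'a set \<Rightarrow> ('a, 'm) module" where
  "left_ideal_copy R \<phi> I =
    \<lparr>carrier = \<phi> ` I, monoid.mult = undefined, one = undefined, ring.zero = \<phi> \<zero>\<^bsub>R\<^esub>,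
     ring.add = (\<lambda>a b. \<phi> (inv_into (carrier R) \<phi> a \<oplus>\<^bsub>R\<^esub> inv_into (carrier R) \<phi> b)),
     smult = (\<lambda>r a. \<phi> (r \<otimes>\<^bsub>R\<^esub> inv_into (carrier R) \<phi> a))\<rparr>"

lemma left_ideal_copy_simps:
  assumes "inj_on \<phi> (carrier R)"
  shows "carrier (left_ideal_copy R \<phi> I) = \<phi> ` I" "\<zero>\<^bsub>left_ideal_copy R \<phi> I\<^esub> = \<phi> \<zero>\<^bsub>R\<^esub>"
    "a \<in> carrier R \<Longrightarrow> b \<in> carrier R \<Longrightarrow> \<phi> a \<oplus>\<^bsub>left_ideal_copy R \<phi> I\<^esub> \<phi> b = \<phi> (a \<oplus>\<^bsub>R\<^esub> b)"
    "a \<in> carrier R \<Longrightarrow> r \<odot>\<^bsub>left_ideal_copy R \<phi> I\<^esub> \<phi> a = \<phi> (r \<otimes>\<^bsub>R\<^esub> a)"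
  using assms by (simp_all add: left_ideal_copy_def)

lemma (in ring) left_module_left_ideal_copy:
  assumes I: "left_ideal R I" and \<phi>: "inj_on \<phi> (carrier R)"
  shows "left_module R (left_ideal_copy R \<phi> I)"
proof -
  let ?A = "left_ideal_copy R \<phi> I"
  note [simp] = left_ideal_copy_simps[OF \<phi>]
  have Ic [simp]: "a \<in> carrier R" if "a \<in> I" for a using I that unfolding left_ideal_def by blast
  have I0 [simp]: "\<zero> \<in> I" and Iadd [simp]: "a \<in> I \<Longrightarrow> b \<in> I \<Longrightarrow> a \<oplus> b \<in> I"
    and Imul [simp]: "a \<in> I \<Longrightarrow> r \<in> carrier R \<Longrightarrow> r \<otimes> a \<in> I" for a b r
    using I unfolding left_ideal_def by auto
  have neg: "\<ominus> a \<in> I" if "a \<in> I" for a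
    using Imul[OF that, of "\<ominus> \<one>"] that by (simp add: l_minus)
  have "abelian_group ?A"
  proof (rule abelian_groupI)
    fix x assume "x \<in> carrier ?A"
    then obtain a where "a \<in> I" "x = \<phi> a" by auto
    then show "\<exists>y\<in>carrier ?A. y \<oplus>\<^bsub>?A\<^esub> x = \<zero>\<^bsub>?A\<^esub>"
      using neg by (intro bexI[of _ "\<phi> (\<ominus> a)"]) (auto simp: l_neg)
  qed (auto simp: a_ac)
  then show ?thesis
    by (intro left_module.intro left_module_axioms.intro ring_axioms)
       (auto simp: r_distr l_distr m_assoc)
qed

lemma tensor_relations_carrier:
  assumes "right_module R F" "left_module R A"
  shows "tensor_relations R F A \<subseteq> carrier (free_Abelian_group (carrier F \<times> carrier A))"
proof -
  interpret F: right_module R F by fact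
  interpret A: left_module R A by fact
  show ?thesis
    unfolding tensor_relations_def using F.smult_closed A.smult_closed
    by (auto dest!: subsetD[OF keys_diff])
qed

lemma subgroup_tensor_null:
  assumes "right_module R F" "left_module R A"
  shows "subgroup (tensor_null R F A) (free_Abelian_group (carrier F \<times> carrier A))"
  unfolding tensor_null_def
  by (rule group.generate_is_subgroup) (use tensor_relations_carrier[OF assms] in auto)

text \<open>
  Flatness in terms of formal sums: a formal sum over \<open>F \<times> A\<close> whose class vanishes in the tensor product of \<open>F\<close> with a
  larger module \<open>B\<close> already vanishes in that with \<open>A\<close>.
\<close>

lemma flat_tensor_null_reflect:
  fixes A B :: "('a, 'm) module" and F :: "('a, 'f) module"
  assumes flat: "flat_module TYPE('m) R F" and A: "left_module R A" and B: "left_module R B"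
    and sub: "carrier A \<subseteq> carrier B" and hom: "(\<lambda>x. x) \<in> mod_hom R A B"
    and rel: "tensor_relations R F A \<subseteq> tensor_relations R F B"
    and c: "Poly_Mapping.keys c \<subseteq> carrier F \<times> carrier A" "c \<in> tensor_null R F B"
  shows "c \<in> tensor_null R F A"
proof -
  have F: "right_module R F" using flat unfolding flat_module_def by blast
  let ?SA = "carrier F \<times> carrier A" and ?SB = "carrier F \<times> carrier B"
  let ?GA = "free_Abelian_group ?SA" and ?GB = "free_Abelian_group ?SB"
  let ?NA = "tensor_null R F A" and ?NB = "tensor_null R F B"
  interpret GA: comm_group ?GA by (rule abelian_free_Abelian_group)
  interpret GB: comm_group ?GB by (rule abelian_free_Abelian_group)
  interpret NA: subgroup ?NA ?GA by (rule subgroup_tensor_null[OF F A])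
  interpret NB: subgroup ?NB ?GB by (rule subgroup_tensor_null[OF F B])
  have NAB: "x \<in> ?NB" if "x \<in> ?NA" for x
    using that unfolding tensor_null_def
  proof (induction rule: generate.induct)
    case one
    then show ?case using generate.one[of ?GB] by simp
  next
    case (incl h)
    then show ?case using rel by (blast intro: generate.incl)
  next
    case (inv h)
    then have "h \<in> carrier ?GA" using tensor_relations_carrier[OF F A] by blast
    then have "Poly_Mapping.keys h \<subseteq> ?SA" by simp
    then have "inv\<^bsub>?GA\<^esub> h = inv\<^bsub>?GB\<^esub> h" using sub by (subst (1 2) inv_free_Abelian_group) auto
    then show ?case using rel inv by (auto intro: generate.inv)
  next
    case (eng h1 h2)
    then show ?case using generate.eng[of h1 ?GB "tensor_relations R F B" h2] by simp
  qed
  have map: "tensor_map R F B (\<lambda>x. x) (?NA #>\<^bsub>?GA\<^esub> d) = ?NB" if d: "d \<in> ?NB" for d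
  proof -
    have ext: "frag_extend (\<lambda>(x, a). frag_of (x, a)) e = e" for e :: "'f \<times> 'm \<Rightarrow>\<^sub>0 int"
      using frag_expansion[of e] by (simp add: case_prod_unfold)
    have "?NB #>\<^bsub>?GB\<^esub> e = ?NB" if e: "e \<in> ?NA #>\<^bsub>?GA\<^esub> d" for e
    proof -
      obtain n where "n \<in> ?NA" "e = n + d" using e by (auto simp: r_coset_def)
      then have "e \<in> ?NB" using NAB d NB.m_closed[of n d] by simp
      then show ?thesis using NB.rcos_const[OF GB.is_group] by simp
    qed
    moreover have "?NA #>\<^bsub>?GA\<^esub> d \<noteq> {}" using NA.one_closed by (auto simp: r_coset_def)
    ultimately show ?thesis unfolding tensor_map_def ext by auto
  qed
  have inj: "inj_on (tensor_map R F B (\<lambda>x. x)) (carrier (tensor_product R F A))"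
    using flat A B hom sub unfolding flat_module_def by (metis inj_on_id2)
  have "0 \<in> ?NB" using NB.one_closed by simp
  then have "tensor_map R F B (\<lambda>x. x) (?NA #>\<^bsub>?GA\<^esub> c) = tensor_map R F B (\<lambda>x. x) (?NA #>\<^bsub>?GA\<^esub> 0)"
    using map c(2) by simp
  moreover have "?NA #>\<^bsub>?GA\<^esub> c \<in> carrier (tensor_product R F A)" "?NA #>\<^bsub>?GA\<^esub> 0 \<in> carrier (tensor_product R F A)"
    unfolding tensor_product_def FactGroup_def RCOSETS_def using c(1) by auto
  ultimately have "?NA #>\<^bsub>?GA\<^esub> c = ?NA #>\<^bsub>?GA\<^esub> 0" using inj_onD[OF inj] by blast
  moreover have "c \<in> ?NA #>\<^bsub>?GA\<^esub> c" using GA.rcos_self[OF _ NA.subgroup_axioms] c(1) by simp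
  ultimately show ?thesis by (auto simp: r_coset_def)
qed

text \<open>
  \<open>tensor_sum z g\<close> says that, for some formal sum of pairs \<open>(y, a)\<close>, the element \<open>z\<close> is its value
  under \<open>(y, a) \<mapsto> y a\<close> and \<open>g\<close> its value under \<open>(y, a) \<mapsto> \<beta> y a\<close>.
\<close>

inductive tensor_sum ::
    "('a, 'f) module \<Rightarrow> 'a set \<Rightarrow> ('a, 'b) module \<Rightarrow> ('f \<Rightarrow> 'a \<Rightarrow> 'b) \<Rightarrow> 'f \<Rightarrow> 'b \<Rightarrow> bool"
  for F I V \<beta> where
    pair: "y \<in> carrier F \<Longrightarrow> a \<in> I \<Longrightarrow> tensor_sum F I V \<beta> (a \<odot>\<^bsub>F\<^esub> y) (\<beta> y a)"
  | add: "tensor_sum F I V \<beta> z g \<Longrightarrow> tensor_sum F I V \<beta> z' g' \<Longrightarrow>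
      tensor_sum F I V \<beta> (z \<oplus>\<^bsub>F\<^esub> z') (g \<oplus>\<^bsub>V\<^esub> g')"

text \<open>
  The kernel of \<open>F \<otimes> I \<rightarrow> F\<close> is trivial for flat \<open>F\<close>, so a map \<open>\<beta>\<close> that is biadditive and balanced
  modulo \<open>W\<close> sends every formal sum with value \<open>0\<close> in \<open>F\<close> into \<open>W\<close>. Working modulo \<open>W\<close> leaves \<open>\<beta>\<close> free
  to be defined by a choice of representatives.
\<close>

lemma flat_tensor_sum_zero:
  fixes F :: "('a, 'f) module" and V :: "('a, 'b) module" and \<phi> :: "'a \<Rightarrow> 'm"
  assumes flat: "flat_module TYPE('m) R F" and \<phi>: "inj_on \<phi> (carrier R)" and I: "left_ideal R I"
    and V: "abelian_group V" and W: "subgroup W (add_monoid V)"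
    and \<beta>: "\<And>y a. y \<in> carrier F \<Longrightarrow> a \<in> I \<Longrightarrow> \<beta> y a \<in> carrier V"
    and add_l: "\<And>y y' a. y \<in> carrier F \<Longrightarrow> y' \<in> carrier F \<Longrightarrow> a \<in> I \<Longrightarrow>
      \<beta> (y \<oplus>\<^bsub>F\<^esub> y') a \<ominus>\<^bsub>V\<^esub> \<beta> y a \<ominus>\<^bsub>V\<^esub> \<beta> y' a \<in> W"
    and add_r: "\<And>y a b. y \<in> carrier F \<Longrightarrow> a \<in> I \<Longrightarrow> b \<in> I \<Longrightarrow>
      \<beta> y (a \<oplus>\<^bsub>R\<^esub> b) \<ominus>\<^bsub>V\<^esub> \<beta> y a \<ominus>\<^bsub>V\<^esub> \<beta> y b \<in> W"
    and bal: "\<And>r y a. r \<in> carrier R \<Longrightarrow> y \<in> carrier F \<Longrightarrow> a \<in> I \<Longrightarrow>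
      \<beta> (r \<odot>\<^bsub>F\<^esub> y) a \<ominus>\<^bsub>V\<^esub> \<beta> y (r \<otimes>\<^bsub>R\<^esub> a) \<in> W"
    and zero: "tensor_sum F I V \<beta> \<zero>\<^bsub>F\<^esub> g"
  shows "g \<in> W"
proof -
  have F: "right_module R F" using flat unfolding flat_module_def by blast
  interpret F: right_module R F by fact
  interpret V: abelian_group V by fact
  interpret W: subgroup W "add_monoid V" by fact
  have car: "left_ideal R (carrier R)" unfolding left_ideal_def by auto
  have Ic: "a \<in> carrier R" if "a \<in> I" for a using I that unfolding left_ideal_def by blast
  have Iadd: "a \<in> I \<Longrightarrow> b \<in> I \<Longrightarrow> a \<oplus>\<^bsub>R\<^esub> b \<in> I"
    and Imul: "a \<in> I \<Longrightarrow> r \<in> carrier R \<Longrightarrow> r \<otimes>\<^bsub>R\<^esub> a \<in> I" for a b r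
    using I unfolding left_ideal_def by auto
  let ?A = "left_ideal_copy R \<phi> I" and ?B = "left_ideal_copy R \<phi> (carrier R)"
  note copy = left_ideal_copy_simps[OF \<phi>]
  have A: "left_module R ?A" by (rule F.left_module_left_ideal_copy[OF I \<phi>])
  have B: "left_module R ?B" by (rule F.left_module_left_ideal_copy[OF car \<phi>])
  let ?SA = "carrier F \<times> \<phi> ` I" and ?SB = "carrier F \<times> \<phi> ` carrier R"
  let ?GA = "free_Abelian_group ?SA" and ?GB = "free_Abelian_group ?SB"
  let ?NA = "tensor_null R F ?A" and ?NB = "tensor_null R F ?B"
  have ops: "x \<oplus>\<^bsub>?A\<^esub> y = x \<oplus>\<^bsub>?B\<^esub> y" "r \<odot>\<^bsub>?A\<^esub> x = r \<odot>\<^bsub>?B\<^esub> x" for x y r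
    by (simp_all add: left_ideal_copy_def)
  have sub: "carrier ?A \<subseteq> carrier ?B" using Ic copy(1) by auto
  have hom: "(\<lambda>x. x) \<in> mod_hom R ?A ?B"
    unfolding mod_hom_def hom_def using sub ops by auto
  have rel: "tensor_relations R F ?A \<subseteq> tensor_relations R F ?B"
    unfolding tensor_relations_def ops using sub by blast
  interpret NB: subgroup ?NB ?GB using subgroup_tensor_null[OF F B] unfolding copy(1) .
  have NBadd: "x + y \<in> ?NB" if "x \<in> ?NB" "y \<in> ?NB" for x y using NB.m_closed that by simp
  have NBneg: "- x \<in> ?NB" if "x \<in> ?NB" for x
  proof -
    have "Poly_Mapping.keys x \<subseteq> ?SB" using NB.mem_carrier[OF that] by simp
    then show ?thesis using NB.m_inv_closed[OF that] by simp
  qed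
  have NBrel: "x \<in> ?NB" if "x \<in> tensor_relations R F ?B" for x
    using that unfolding tensor_null_def copy(1) by (rule generate.incl)
  define f where "f = (\<lambda>(y, x). \<beta> y (inv_into (carrier R) \<phi> x))"
  have f: "f (y, \<phi> a) = \<beta> y a" if "a \<in> carrier R" for y a using \<phi> that by (simp add: f_def)
  have "f ` ?SA \<subseteq> carrier (add_monoid V)" using \<beta> f Ic by auto
  then obtain h where h: "h \<in> hom ?GA (add_monoid V)" "\<And>x. x \<in> ?SA \<Longrightarrow> h (frag_of x) = f x"
    using comm_group.free_Abelian_group_universal[OF V.a_comm_group] by blast
  interpret h: group_hom ?GA "add_monoid V" h
    using h(1) V.a_group by (simp add: group_hom_def group_hom_axioms_def)
  have hof: "h (frag_of (y, \<phi> a)) = \<beta> y a" if "y \<in> carrier F" "a \<in> I" for y a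
    using that h(2) f Ic by simp
  have hadd: "h (x + y) = h x \<oplus>\<^bsub>V\<^esub> h y"
    if "Poly_Mapping.keys x \<subseteq> ?SA" "Poly_Mapping.keys y \<subseteq> ?SA" for x y
    using h.hom_mult[of x y] that by simp
  have hdiff: "h (x - y) = h x \<ominus>\<^bsub>V\<^esub> h y"
    if "Poly_Mapping.keys x \<subseteq> ?SA" "Poly_Mapping.keys y \<subseteq> ?SA" for x y
    using hadd[of x "- y"] h.hom_inv[of y] that by (simp add: a_minus_def a_inv_def)
  have kd: "Poly_Mapping.keys (a - b) \<subseteq> S" if "Poly_Mapping.keys a \<subseteq> S" "Poly_Mapping.keys b \<subseteq> S"
    for a b :: "'f \<times> 'm \<Rightarrow>\<^sub>0 int" and S
    using that keys_diff[of a b] by blast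
  have hrel: "h x \<in> W" if "x \<in> tensor_relations R F ?A" for x
    using that unfolding tensor_relations_def copy(1)
    by (auto simp: copy(3,4) Ic Iadd Imul hdiff kd hof F.smult_closed add_l add_r bal)
  have hnull: "h x \<in> W" if "x \<in> ?NA" for x
    using that unfolding tensor_null_def copy(1)
  proof (induction rule: generate.induct)
    case one
    then show ?case using h.hom_one W.one_closed by simp
  next
    case (incl x)
    then show ?case by (rule hrel)
  next
    case (inv x)
    then have "x \<in> carrier ?GA" using tensor_relations_carrier[OF F A] unfolding copy(1) by blast
    then have "h (inv\<^bsub>?GA\<^esub> x) = inv\<^bsub>add_monoid V\<^esub> h x" by (rule h.hom_inv)
    then show ?case using W.m_inv_closed[OF hrel[OF inv]] by (rule ssubst)
  next
    case (eng x y)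
    then have "x \<in> carrier ?GA" "y \<in> carrier ?GA"
      using subgroup.mem_carrier[OF subgroup_tensor_null[OF F A]] unfolding tensor_null_def copy(1) by auto
    then have "h (x \<otimes>\<^bsub>?GA\<^esub> y) = h x \<otimes>\<^bsub>add_monoid V\<^esub> h y" by (rule h.hom_mult)
    then show ?case using W.m_closed[OF eng.IH] by (rule ssubst)
  qed
  \<comment> \<open>Modulo the relations over \<open>R\<close>, the formal sum \<open>\<Sum> (y, a)\<close> becomes \<open>(\<Sum> y a, 1)\<close>.\<close>
  have "\<exists>c. Poly_Mapping.keys c \<subseteq> ?SA \<and> h c = g \<and> z \<in> carrier F \<and> c - frag_of (z, \<phi> \<one>\<^bsub>R\<^esub>) \<in> ?NB"
    if "tensor_sum F I V \<beta> z g" for z g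
    using that
  proof induction
    case (pair y a)
    have "frag_of (a \<odot>\<^bsub>F\<^esub> y, \<phi> \<one>\<^bsub>R\<^esub>) - frag_of (y, a \<odot>\<^bsub>?B\<^esub> \<phi> \<one>\<^bsub>R\<^esub>) \<in> tensor_relations R F ?B"
      unfolding tensor_relations_def copy(1) using pair Ic by blast
    then have "- (frag_of (a \<odot>\<^bsub>F\<^esub> y, \<phi> \<one>\<^bsub>R\<^esub>) - frag_of (y, a \<odot>\<^bsub>?B\<^esub> \<phi> \<one>\<^bsub>R\<^esub>)) \<in> ?NB"
      by (intro NBneg NBrel)
    then show ?case
      using pair hof F.smult_closed Ic by (intro exI[of _ "frag_of (y, \<phi> a)"]) (simp add: copy(4))
  next
    case (add z g z' g')
    then obtain c c' where c: "Poly_Mapping.keys c \<subseteq> ?SA" "h c = g" "z \<in> carrier F" "c - frag_of (z, \<phi> \<one>\<^bsub>R\<^esub>) \<in> ?NB"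
      and c': "Poly_Mapping.keys c' \<subseteq> ?SA" "h c' = g'" "z' \<in> carrier F" "c' - frag_of (z', \<phi> \<one>\<^bsub>R\<^esub>) \<in> ?NB"
      by blast
    have r: "frag_of (z \<oplus>\<^bsub>F\<^esub> z', \<phi> \<one>\<^bsub>R\<^esub>) - frag_of (z, \<phi> \<one>\<^bsub>R\<^esub>) - frag_of (z', \<phi> \<one>\<^bsub>R\<^esub>) \<in> tensor_relations R F ?B"
      unfolding tensor_relations_def copy(1) using c(3) c'(3) F.R.one_closed by blast
    have "(c - frag_of (z, \<phi> \<one>\<^bsub>R\<^esub>)) + (c' - frag_of (z', \<phi> \<one>\<^bsub>R\<^esub>)) +
        - (frag_of (z \<oplus>\<^bsub>F\<^esub> z', \<phi> \<one>\<^bsub>R\<^esub>) - frag_of (z, \<phi> \<one>\<^bsub>R\<^esub>) - frag_of (z', \<phi> \<one>\<^bsub>R\<^esub>)) \<in> ?NB"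
      by (intro NBadd NBneg NBrel c(4) c'(4) r)
    then have "(c + c') - frag_of (z \<oplus>\<^bsub>F\<^esub> z', \<phi> \<one>\<^bsub>R\<^esub>) \<in> ?NB" by (simp add: algebra_simps)
    moreover have "Poly_Mapping.keys (c + c') \<subseteq> ?SA" using c(1) c'(1) keys_add[of c c'] by blast
    ultimately show ?case using hadd c c' by blast
  qed
  with zero obtain c where c: "Poly_Mapping.keys c \<subseteq> ?SA" "h c = g"
    "c - frag_of (\<zero>\<^bsub>F\<^esub>, \<phi> \<one>\<^bsub>R\<^esub>) \<in> ?NB" by blast
  have r: "frag_of (\<zero>\<^bsub>F\<^esub> \<oplus>\<^bsub>F\<^esub> \<zero>\<^bsub>F\<^esub>, \<phi> \<one>\<^bsub>R\<^esub>) - frag_of (\<zero>\<^bsub>F\<^esub>, \<phi> \<one>\<^bsub>R\<^esub>) - frag_of (\<zero>\<^bsub>F\<^esub>, \<phi> \<one>\<^bsub>R\<^esub>)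
      \<in> tensor_relations R F ?B"
    unfolding tensor_relations_def copy(1) using F.R.one_closed F.M.zero_closed by blast
  have "(c - frag_of (\<zero>\<^bsub>F\<^esub>, \<phi> \<one>\<^bsub>R\<^esub>)) + - (frag_of (\<zero>\<^bsub>F\<^esub> \<oplus>\<^bsub>F\<^esub> \<zero>\<^bsub>F\<^esub>, \<phi> \<one>\<^bsub>R\<^esub>)
      - frag_of (\<zero>\<^bsub>F\<^esub>, \<phi> \<one>\<^bsub>R\<^esub>) - frag_of (\<zero>\<^bsub>F\<^esub>, \<phi> \<one>\<^bsub>R\<^esub>)) \<in> ?NB"
    by (intro NBadd NBneg NBrel c(3) r)
  then have "c \<in> ?NB" by simp
  then have "c \<in> ?NA"
    using flat_tensor_null_reflect[OF flat A B sub hom rel] c(1) copy(1) by metis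
  then show ?thesis using hnull c(2) by blast
qed

section \<open>Delta-small submodules without projective simple quotients\<close>

lemma (in right_module) submodule_add_cancel:
  assumes "submodule A R M" "x \<in> A" "y \<in> carrier M" "x \<oplus>\<^bsub>M\<^esub> y \<in> A"
  shows "y \<in> A"
proof -
  have x: "x \<in> carrier M" using assms(1,2) unfolding submodule_iff by blast
  have "y = (x \<oplus>\<^bsub>M\<^esub> y) \<ominus>\<^bsub>M\<^esub> x"
    using x assms(3) by (simp add: M.minus_eq M.a_comm[of x] M.a_assoc M.r_neg)
  then show ?thesis using submodule_diff[OF assms(1,4,2)] by simp
qed

lemma (in right_module) right_ideal_annihilator_mod:
  assumes "submodule A R M" "y \<in> carrier M"
  shows "right_ideal R {r \<in> carrier R. r \<odot>\<^bsub>M\<^esub> y \<in> A}"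
  using assms unfolding submodule_iff R.right_ideal_iff
  by (auto simp: smult_l_distr smult_assoc)

text \<open>
  If \<open>A\<close> is essential in \<open>M\<close>, then \<open>M / A\<close> is singular: if a right ideal \<open>K\<close> meets the annihilator of \<open>y\<close> modulo
  \<open>A\<close> trivially, then \<open>y K\<close> meets \<open>A\<close> trivially, so that \<open>y K = 0\<close>.
\<close>

lemma (in right_module) essential_annihilator_mod:
  assumes A: "essential_submodule R M A" and y: "y \<in> carrier M"
  shows "essential_submodule R (right_regular R) {r \<in> carrier R. r \<odot>\<^bsub>M\<^esub> y \<in> A}"
  unfolding essential_submodule_def
proof (intro conjI allI impI)
  let ?I = "{r \<in> carrier R. r \<odot>\<^bsub>M\<^esub> y \<in> A}"
  have sA: "submodule A R M" using A unfolding essential_submodule_def by blast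
  then have A0: "\<zero>\<^bsub>M\<^esub> \<in> A" unfolding submodule_iff by blast
  show "right_ideal R ?I" using sA y by (rule right_ideal_annihilator_mod)
  fix K assume "right_ideal R K \<and> ?I \<inter> K = {\<zero>\<^bsub>right_regular R\<^esub>}"
  then have K: "right_ideal R K" "?I \<inter> K = {\<zero>}" by auto
  note Kr = R.right_idealD[OF K(1)]
  let ?yK = "(\<lambda>k. k \<odot>\<^bsub>M\<^esub> y) ` K"
  have "\<zero>\<^bsub>M\<^esub> \<in> ?yK" using Kr(2) y by (intro image_eqI[of _ _ \<zero>]) auto
  then have yK: "submodule ?yK R M"
    unfolding submodule_iff using Kr y smult_closed
    by (auto simp: smult_l_distr[symmetric] smult_assoc[symmetric])
  have "A \<inter> ?yK = {\<zero>\<^bsub>M\<^esub>}"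
  proof
    show "A \<inter> ?yK \<subseteq> {\<zero>\<^bsub>M\<^esub>}"
    proof
      fix z assume "z \<in> A \<inter> ?yK"
      then obtain k where k: "k \<in> K" "z = k \<odot>\<^bsub>M\<^esub> y" "z \<in> A" by blast
      then have "k \<in> ?I \<inter> K" using Kr(3) by blast
      then have "k = \<zero>" using K(2) by blast
      then show "z \<in> {\<zero>\<^bsub>M\<^esub>}" using k y by simp
    qed
  qed (use A0 \<open>\<zero>\<^bsub>M\<^esub> \<in> ?yK\<close> in blast)
  then have "?yK = {\<zero>\<^bsub>M\<^esub>}" using A yK unfolding essential_submodule_def by blast
  then have "k \<odot>\<^bsub>M\<^esub> y = \<zero>\<^bsub>M\<^esub>" if "k \<in> K" for k using that by blast
  then have "K \<subseteq> ?I" using A0 Kr(3) by auto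
  then show "K = {\<zero>\<^bsub>right_regular R\<^esub>}" using K(2) by auto
qed

lemma (in right_module) singular_quot_module:
  assumes A: "submodule A R M"
    and ess: "\<And>y. y \<in> carrier M \<Longrightarrow>
      essential_submodule R (right_regular R) {r \<in> carrier R. r \<odot>\<^bsub>M\<^esub> y \<in> A}"
  shows "singular_module R (quot_module M A)"
  unfolding singular_module_def
proof
  have Ap: "A \<subseteq> carrier M" "\<zero>\<^bsub>M\<^esub> \<in> A" "\<And>x y. x \<in> A \<Longrightarrow> y \<in> A \<Longrightarrow> x \<oplus>\<^bsub>M\<^esub> y \<in> A"
    "\<And>r x. r \<in> carrier R \<Longrightarrow> x \<in> A \<Longrightarrow> r \<odot>\<^bsub>M\<^esub> x \<in> A"
    using A unfolding submodule_iff by auto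
  have add: "additive_subgroup A M"
    using A unfolding submodule_def by (simp add: additive_subgroup_def)
  fix C assume "C \<in> carrier (quot_module M A)"
  then obtain y where y: "y \<in> carrier M" "C = A +>\<^bsub>M\<^esub> y"
    unfolding quot_module_def A_RCOSETS_def' by auto
  let ?I = "{r \<in> carrier R. r \<odot>\<^bsub>M\<^esub> y \<in> A}"
  have "r \<odot>\<^bsub>quot_module M A\<^esub> C = \<zero>\<^bsub>quot_module M A\<^esub>" if r: "r \<in> ?I" for r
  proof -
    have "A +>\<^bsub>M\<^esub> (r \<odot>\<^bsub>M\<^esub> x) = A" if x: "x \<in> C" for x
    proof -
      obtain a where a: "a \<in> A" "x = a \<oplus>\<^bsub>M\<^esub> y" using x y(2) unfolding a_r_coset_def' by blast
      have "r \<odot>\<^bsub>M\<^esub> x = r \<odot>\<^bsub>M\<^esub> a \<oplus>\<^bsub>M\<^esub> r \<odot>\<^bsub>M\<^esub> y" using a r y(1) Ap(1) by (simp add: smult_r_distr subset_iff)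
      then have "r \<odot>\<^bsub>M\<^esub> x \<in> A" using Ap(3,4) a(1) r by simp
      then show ?thesis by (metis M.a_coset_join2 add additive_subgroup.a_subgroup Ap(1) subsetD)
    qed
    moreover have "C \<noteq> {}" using y Ap(2) unfolding a_r_coset_def' by blast
    ultimately show ?thesis unfolding quot_module_def by auto
  qed
  then show "\<exists>I. essential_submodule R (right_regular R) I \<and>
      (\<forall>r\<in>I. r \<odot>\<^bsub>quot_module M A\<^esub> C = \<zero>\<^bsub>quot_module M A\<^esub>)"
    using ess[OF y(1)] by blast
qed

text \<open>\<open>Y\<close> is maximal among the submodules that meet \<open>A\<close> trivially.\<close>

lemma (in right_module) essential_complement:
  assumes A: "submodule A R M"
  obtains Y where "submodule Y R M" "A \<inter> Y = {\<zero>\<^bsub>M\<^esub>}" "essential_submodule R M (A <+>\<^bsub>M\<^esub> Y)"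
proof -
  have "{\<zero>\<^bsub>M\<^esub>} \<inter> (A - {\<zero>\<^bsub>M\<^esub>}) = {}" by blast
  with submodule_zero obtain Y where Y: "submodule Y R M" "Y \<inter> (A - {\<zero>\<^bsub>M\<^esub>}) = {}"
    and Ymax: "\<And>B. submodule B R M \<Longrightarrow> Y \<subseteq> B \<Longrightarrow> B \<inter> (A - {\<zero>\<^bsub>M\<^esub>}) = {} \<Longrightarrow> B = Y"
    using submodule_maximal_avoiding[of "{\<zero>\<^bsub>M\<^esub>}" "A - {\<zero>\<^bsub>M\<^esub>}"] by (metis (no_types, lifting))
  have A0: "\<zero>\<^bsub>M\<^esub> \<in> A" "A \<subseteq> carrier M" using A unfolding submodule_iff by auto
  have Y0: "\<zero>\<^bsub>M\<^esub> \<in> Y" "Y \<subseteq> carrier M" using Y(1) unfolding submodule_iff by auto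
  note sAY = submodule_sum[OF A Y(1)]
  have "essential_submodule R M (A <+>\<^bsub>M\<^esub> Y)"
    unfolding essential_submodule_def
  proof (intro conjI allI impI)
    show "submodule (A <+>\<^bsub>M\<^esub> Y) R M" by (rule sAY(1))
    fix K assume K: "submodule K R M \<and> (A <+>\<^bsub>M\<^esub> Y) \<inter> K = {\<zero>\<^bsub>M\<^esub>}"
    then have sK: "submodule K R M" by blast
    have Kc: "K \<subseteq> carrier M" "\<zero>\<^bsub>M\<^esub> \<in> K" using sK unfolding submodule_iff by auto
    note sYK = submodule_sum[OF Y(1) sK]
    have "z = \<zero>\<^bsub>M\<^esub>" if z: "z \<in> Y <+>\<^bsub>M\<^esub> K" "z \<in> A" for z
    proof -
      obtain y k where yk: "y \<in> Y" "k \<in> K" "z = y \<oplus>\<^bsub>M\<^esub> k" using z(1) unfolding mem_set_add by blast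
      have "z \<in> A <+>\<^bsub>M\<^esub> Y" "y \<in> A <+>\<^bsub>M\<^esub> Y" using sAY(2,3) z(2) yk(1) by auto
      then have "k \<in> A <+>\<^bsub>M\<^esub> Y" using submodule_add_cancel[OF sAY(1), of y k] yk Kc(1) by blast
      then have "k = \<zero>\<^bsub>M\<^esub>" using K yk(2) by blast
      then have "z \<in> Y" using yk Y0(2) by auto
      then show ?thesis using z(2) Y(2) by blast
    qed
    then have "Y <+>\<^bsub>M\<^esub> K = Y" using Ymax[OF sYK(1,2)] by blast
    then have "K \<subseteq> A <+>\<^bsub>M\<^esub> Y" using sYK(3) sAY(3) by blast
    then show "K = {\<zero>\<^bsub>M\<^esub>}" using K by blast
  qed
  moreover have "A \<inter> Y = {\<zero>\<^bsub>M\<^esub>}" using Y(2) A0 Y0 by blast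
  ultimately show thesis using that Y(1) by blast
qed

text \<open>
  Suppose \<open>S + K = M\<close> with \<open>K\<close> delta-small. Every essential submodule above \<open>S\<close> is \<open>M\<close>, so every
  submodule above \<open>S\<close> has a complement in \<open>M\<close>. If \<open>S\<close> were proper, a submodule \<open>A\<close> that is maximal without a
  given element \<open>y\<close> outside \<open>S\<close> would have a simple quotient \<open>M / A\<close>, isomorphic to \<open>R\<close> modulo a
  maximal right ideal, which contains \<open>p\<close> because \<open>M p \<subseteq> S\<close>. As the latter is essential, \<open>M / A\<close> is singular,
  against delta-smallness.
\<close>

lemma (in right_module) delta_small_sum_eq:
  assumes K: "delta_small R M K" and S: "submodule S R M" and SK: "S <+>\<^bsub>M\<^esub> K = carrier M"
    and p: "\<And>y b. y \<in> carrier M \<Longrightarrow> b \<in> p \<Longrightarrow> b \<odot>\<^bsub>M\<^esub> y \<in> S" "p \<subseteq> carrier R"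
    and ess: "\<And>I. R.maximal_right_ideal I \<Longrightarrow> p \<subseteq> I \<Longrightarrow> essential_submodule R (right_regular R) I"
  shows "S = carrier M"
proof (rule ccontr)
  assume ne: "S \<noteq> carrier M"
  have sK: "submodule K R M" using K unfolding delta_small_def by blast
  have Sc: "S \<subseteq> carrier M" "\<zero>\<^bsub>M\<^esub> \<in> S" using S unfolding submodule_iff by auto
  have Kc: "K \<subseteq> carrier M" using sK unfolding submodule_iff by auto
  have full: "Z = carrier M"
    if Z: "submodule Z R M" "S \<subseteq> Z"
      "\<And>y. y \<in> carrier M \<Longrightarrow> essential_submodule R (right_regular R) {r \<in> carrier R. r \<odot>\<^bsub>M\<^esub> y \<in> Z}" for Z
  proof -
    have "carrier M \<subseteq> K <+>\<^bsub>M\<^esub> Z"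
      unfolding SK[symmetric] using submodule_sum[OF sK Z(1)] Z(2)
      by (intro submodule_sum_least) auto
    then have "K <+>\<^bsub>M\<^esub> Z = carrier M"
      using submodule_sum(1)[OF sK Z(1)] unfolding submodule_iff by blast
    then show ?thesis
      using K Z(1) singular_quot_module[OF Z(1,3)] unfolding delta_small_def by blast
  qed
  have compl: "\<exists>Y. submodule Y R M \<and> B \<inter> Y = {\<zero>\<^bsub>M\<^esub>} \<and> B <+>\<^bsub>M\<^esub> Y = carrier M"
    if B: "submodule B R M" "S \<subseteq> B" for B
  proof -
    obtain Y where Y: "submodule Y R M" "B \<inter> Y = {\<zero>\<^bsub>M\<^esub>}" "essential_submodule R M (B <+>\<^bsub>M\<^esub> Y)"
      using essential_complement[OF B(1)] by blast
    have "B <+>\<^bsub>M\<^esub> Y = carrier M"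
      using submodule_sum(1,2)[OF B(1) Y(1)] B(2) essential_annihilator_mod[OF Y(3)]
      by (intro full) auto
    then show ?thesis using Y by blast
  qed
  obtain y where y: "y \<in> carrier M" "y \<notin> S" using ne Sc by blast
  then have "S \<inter> {y} = {}" by blast
  then obtain A where A: "submodule A R M" "S \<subseteq> A" "A \<inter> {y} = {}"
    and Amax: "\<And>B. submodule B R M \<Longrightarrow> A \<subseteq> B \<Longrightarrow> B \<inter> {y} = {} \<Longrightarrow> B = A"
    using submodule_maximal_avoiding[OF S] by blast
  have yA: "y \<notin> A" and Ac: "A \<subseteq> carrier M" using A(1,3) unfolding submodule_iff by auto
  have simple: "B = carrier M" if B: "submodule B R M" "A \<subset> B" for B
  proof (rule ccontr)
    assume Bne: "B \<noteq> carrier M"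
    have yB: "y \<in> B" using Amax[OF B(1)] B(2) by blast
    obtain C where C: "submodule C R M" "B \<inter> C = {\<zero>\<^bsub>M\<^esub>}" "B <+>\<^bsub>M\<^esub> C = carrier M"
      using compl[OF B(1)] B(2) A(2) by blast
    note sAC = submodule_sum[OF A(1) C(1)]
    have "\<not> C \<subseteq> A"
    proof
      assume "C \<subseteq> A"
      then have "B <+>\<^bsub>M\<^esub> C \<subseteq> B" using submodule_sum_least[OF B(1)] B(2) by blast
      then show False using Bne C(3) B(1) unfolding submodule_iff by blast
    qed
    then have "A <+>\<^bsub>M\<^esub> C \<noteq> A" using sAC(3) by blast
    then have "y \<in> A <+>\<^bsub>M\<^esub> C" using Amax[OF sAC(1,2)] by blast
    then obtain a c where ac: "a \<in> A" "c \<in> C" "y = a \<oplus>\<^bsub>M\<^esub> c" unfolding mem_set_add by blast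
    have cc: "c \<in> carrier M" using ac C(1) unfolding submodule_iff by blast
    have "c \<in> B" using submodule_add_cancel[OF B(1), of a c] ac yB B(2) cc by blast
    then have "c = \<zero>\<^bsub>M\<^esub>" using C(2) ac(2) by blast
    then show False using ac yA Ac by auto
  qed
  let ?I = "{r \<in> carrier R. r \<odot>\<^bsub>M\<^esub> y \<in> A}"
  have rI: "right_ideal R ?I" using A(1) y(1) by (rule right_ideal_annihilator_mod)
  have gen: "A <+>\<^bsub>M\<^esub> (\<lambda>k. k \<odot>\<^bsub>M\<^esub> y) ` U = carrier M" if U: "right_ideal R U" "\<not> U \<subseteq> ?I" for U
  proof -
    note Ur = R.right_idealD[OF U(1)]
    let ?yU = "(\<lambda>k. k \<odot>\<^bsub>M\<^esub> y) ` U"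
    have "\<zero>\<^bsub>M\<^esub> \<in> ?yU" using Ur(2) y by (intro image_eqI[of _ _ \<zero>]) auto
    then have yU: "submodule ?yU R M"
      unfolding submodule_iff using Ur y smult_closed
      by (auto simp: smult_l_distr[symmetric] smult_assoc[symmetric])
    note s = submodule_sum[OF A(1) yU]
    obtain u where "u \<in> U" "u \<odot>\<^bsub>M\<^esub> y \<notin> A" using U(2) Ur(3) by blast
    then have "A \<subset> A <+>\<^bsub>M\<^esub> ?yU" using s(2,3) by blast
    then show ?thesis using simple[OF s(1)] by blast
  qed
  have "R.maximal_right_ideal ?I" unfolding R.maximal_right_ideal_def
  proof (intro conjI allI impI)
    show "right_ideal R ?I" by (rule rI)
    have "\<one> \<notin> ?I" using yA y(1) by (simp add: smult_one)
    then show "?I \<noteq> carrier R" by blast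
    fix U assume U: "right_ideal R U \<and> ?I \<subset> U"
    then have "y \<in> A <+>\<^bsub>M\<^esub> (\<lambda>k. k \<odot>\<^bsub>M\<^esub> y) ` U" using gen[of U] y(1) by blast
    then obtain a u where au: "a \<in> A" "u \<in> U" "y = a \<oplus>\<^bsub>M\<^esub> u \<odot>\<^bsub>M\<^esub> y" unfolding mem_set_add by blast
    have ac: "a \<in> carrier M" and uc: "u \<in> carrier R"
      using au Ac U R.right_idealD(3)[of U] by auto
    have "(\<one> \<ominus> u) \<odot>\<^bsub>M\<^esub> y = y \<ominus>\<^bsub>M\<^esub> u \<odot>\<^bsub>M\<^esub> y"
    proof -
      have "(\<one> \<ominus> u) \<odot>\<^bsub>M\<^esub> y \<oplus>\<^bsub>M\<^esub> u \<odot>\<^bsub>M\<^esub> y = ((\<one> \<ominus> u) \<oplus> u) \<odot>\<^bsub>M\<^esub> y"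
        using uc y(1) by (simp add: smult_l_distr)
      also have "(\<one> \<ominus> u) \<oplus> u = \<one>" using uc by (simp add: R.minus_eq R.a_assoc R.l_neg)
      finally have "(\<one> \<ominus> u) \<odot>\<^bsub>M\<^esub> y \<oplus>\<^bsub>M\<^esub> u \<odot>\<^bsub>M\<^esub> y = y" using y(1) by (simp add: smult_one)
      then have "y \<ominus>\<^bsub>M\<^esub> u \<odot>\<^bsub>M\<^esub> y = (\<one> \<ominus> u) \<odot>\<^bsub>M\<^esub> y \<oplus>\<^bsub>M\<^esub> u \<odot>\<^bsub>M\<^esub> y \<ominus>\<^bsub>M\<^esub> u \<odot>\<^bsub>M\<^esub> y" by simp
      also have "\<dots> = (\<one> \<ominus> u) \<odot>\<^bsub>M\<^esub> y"
        using uc y(1) smult_closed by (simp add: M.minus_eq M.a_assoc M.r_neg)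
      finally show ?thesis by simp
    qed
    also have "\<dots> = a"
    proof -
      have "y \<ominus>\<^bsub>M\<^esub> u \<odot>\<^bsub>M\<^esub> y = a \<oplus>\<^bsub>M\<^esub> u \<odot>\<^bsub>M\<^esub> y \<ominus>\<^bsub>M\<^esub> u \<odot>\<^bsub>M\<^esub> y" using au(3) by simp
      then show ?thesis using ac uc y(1) smult_closed by (simp add: M.minus_eq M.a_assoc M.r_neg)
    qed
    finally have "\<one> \<ominus> u \<in> ?I" using au(1) uc by simp
    then have "u \<oplus> (\<one> \<ominus> u) \<in> U" using U au(2) R.right_idealD(4)[of U] by blast
    then have "\<one> \<in> U" using uc by (simp add: R.minus_eq R.a_comm[of \<one>] R.a_assoc[symmetric] R.r_neg)
    then show "U = carrier R" using U R.right_ideal_one by blast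
  qed
  moreover have "p \<subseteq> ?I" using p A(2) y(1) by blast
  ultimately have essI: "essential_submodule R (right_regular R) ?I" by (rule ess)
  have "A = carrier M"
  proof (rule full[OF A(1,2)])
    fix z assume z: "z \<in> carrier M"
    have "\<not> carrier R \<subseteq> ?I" using yA y(1) by (auto dest!: subsetD[of _ _ \<one>] simp: smult_one)
    then have "z \<in> A <+>\<^bsub>M\<^esub> (\<lambda>k. k \<odot>\<^bsub>M\<^esub> y) ` carrier R" using gen[OF R.right_ideal_carrier] z by simp
    then obtain a u where au: "a \<in> A" "u \<in> carrier R" "z = a \<oplus>\<^bsub>M\<^esub> u \<odot>\<^bsub>M\<^esub> y" unfolding mem_set_add by blast
    interpret reg: right_module R "right_regular R" by (rule R.right_module_right_regular)
    have "{r \<in> carrier R. r \<odot>\<^bsub>right_regular R\<^esub> u \<in> ?I} = {r \<in> carrier R. r \<odot>\<^bsub>M\<^esub> z \<in> A}"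
    proof -
      have "u \<otimes> r \<in> ?I \<longleftrightarrow> r \<odot>\<^bsub>M\<^esub> z \<in> A" if r: "r \<in> carrier R" for r
      proof -
        have eq: "r \<odot>\<^bsub>M\<^esub> z = r \<odot>\<^bsub>M\<^esub> a \<oplus>\<^bsub>M\<^esub> (u \<otimes> r) \<odot>\<^bsub>M\<^esub> y"
          using au r y(1) Ac smult_closed by (auto simp: smult_r_distr smult_assoc)
        have ra: "r \<odot>\<^bsub>M\<^esub> a \<in> A" using au(1) r A(1) unfolding submodule_iff by blast
        have "(u \<otimes> r) \<odot>\<^bsub>M\<^esub> y \<in> carrier M" using au r y(1) smult_closed by simp
        then have "r \<odot>\<^bsub>M\<^esub> z \<in> A \<longleftrightarrow> (u \<otimes> r) \<odot>\<^bsub>M\<^esub> y \<in> A"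
          unfolding eq using submodule_add_cancel[OF A(1) ra] ra A(1) unfolding submodule_iff by blast
        then show ?thesis using au(2) r by simp
      qed
      then show ?thesis by auto
    qed
    then show "essential_submodule R (right_regular R) {r \<in> carrier R. r \<odot>\<^bsub>M\<^esub> z \<in> A}"
      using reg.essential_annihilator_mod[OF essI, of u] au(2) by simp
  qed
  then show False using yA y(1) by blast
qed

section \<open>Flat delta-covers of countably generated modules\<close>

lemma mod_homD:
  assumes "f \<in> mod_hom R M N"
  shows "x \<in> carrier M \<Longrightarrow> f x \<in> carrier N"
    "x \<in> carrier M \<Longrightarrow> y \<in> carrier M \<Longrightarrow> f (x \<oplus>\<^bsub>M\<^esub> y) = f x \<oplus>\<^bsub>N\<^esub> f y"
    "r \<in> carrier R \<Longrightarrow> x \<in> carrier M \<Longrightarrow> f (r \<odot>\<^bsub>M\<^esub> x) = r \<odot>\<^bsub>N\<^esub> f x"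
  using assms unfolding mod_hom_def hom_def by auto

lemma mod_hom_zero_diff:
  assumes "right_module R M" "right_module R N" "f \<in> mod_hom R M N"
  shows "f \<zero>\<^bsub>M\<^esub> = \<zero>\<^bsub>N\<^esub>"
    "x \<in> carrier M \<Longrightarrow> y \<in> carrier M \<Longrightarrow> f (x \<ominus>\<^bsub>M\<^esub> y) = f x \<ominus>\<^bsub>N\<^esub> f y"
proof -
  interpret M: right_module R M by fact
  interpret N: right_module R N by fact
  note f = mod_homD[OF assms(3)]
  show "f \<zero>\<^bsub>M\<^esub> = \<zero>\<^bsub>N\<^esub>"
    using f(3)[of "\<zero>\<^bsub>R\<^esub>" "\<zero>\<^bsub>M\<^esub>"] f(1)[of "\<zero>\<^bsub>M\<^esub>"] by simp
  show "f (x \<ominus>\<^bsub>M\<^esub> y) = f x \<ominus>\<^bsub>N\<^esub> f y" if "x \<in> carrier M" "y \<in> carrier M"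
    using f(2)[of x "\<ominus>\<^bsub>M\<^esub> y"] f(3)[of "\<ominus>\<^bsub>R\<^esub> \<one>\<^bsub>R\<^esub>" y] f(1)[of y] that
    by (simp add: M.smult_minus_one N.smult_minus_one a_minus_def)
qed

text \<open>
  The covers are available for modules of the type \<open>'m\<close>, so the quotient \<open>V / Q\<close> is realised there. Its elements are
  the images under \<open>j\<close> of representatives of the cosets.
\<close>


lemma quotient_on_type:
  fixes V :: "('a, 'c) module" and j :: "'c \<Rightarrow> 'm"
  assumes V: "right_module R V" and Q: "submodule Q R V" and j: "inj_on j (carrier V)"
  obtains N :: "('a, 'm) module" and q where "right_module R N" "q \<in> mod_hom R V N"
    "q ` carrier V = carrier N" "\<And>v. v \<in> carrier V \<Longrightarrow> q v = \<zero>\<^bsub>N\<^esub> \<longleftrightarrow> v \<in> Q"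
proof -
  interpret V: right_module R V by fact
  have Qs: "Q \<subseteq> carrier V" "\<zero>\<^bsub>V\<^esub> \<in> Q" "\<And>x y. x \<in> Q \<Longrightarrow> y \<in> Q \<Longrightarrow> x \<oplus>\<^bsub>V\<^esub> y \<in> Q"
    "\<And>r x. r \<in> carrier R \<Longrightarrow> x \<in> Q \<Longrightarrow> r \<odot>\<^bsub>V\<^esub> x \<in> Q"
    using Q unfolding V.submodule_iff by auto
  define rel where "rel v w \<longleftrightarrow> w \<in> carrier V \<and> w \<ominus>\<^bsub>V\<^esub> v \<in> Q" for v w
  define q where "q v = j (SOME w. rel v w)" for v
  have rel_refl: "rel v v" if "v \<in> carrier V" for v
    using that Qs(2) unfolding rel_def by (simp add: a_minus_def V.M.r_neg)
  have rel_sym: "rel w v" if "rel v w" "v \<in> carrier V" for v w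
  proof -
    have "v \<ominus>\<^bsub>V\<^esub> w = (\<ominus>\<^bsub>R\<^esub> \<one>\<^bsub>R\<^esub>) \<odot>\<^bsub>V\<^esub> (w \<ominus>\<^bsub>V\<^esub> v)"
      using that unfolding rel_def
      by (simp add: V.smult_minus_one a_minus_def V.M.minus_add V.M.a_comm)
    then show ?thesis using that Qs(4) unfolding rel_def by simp
  qed
  have rel_trans: "rel u w" if "rel u v" "rel v w" "u \<in> carrier V" for u v w
  proof -
    have "w \<ominus>\<^bsub>V\<^esub> u = (w \<ominus>\<^bsub>V\<^esub> v) \<oplus>\<^bsub>V\<^esub> (v \<ominus>\<^bsub>V\<^esub> u)"
      using that unfolding rel_def
      by (simp add: a_minus_def V.M.a_assoc V.M.r_neg1)
    then show ?thesis using that Qs(3) unfolding rel_def by simp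
  qed
  have q_eq: "q v = q w \<longleftrightarrow> w \<ominus>\<^bsub>V\<^esub> v \<in> Q" if vw: "v \<in> carrier V" "w \<in> carrier V" for v w
  proof
    have sv: "rel v (SOME u. rel v u)" using rel_refl[OF vw(1)] by (rule someI)
    have sw: "rel w (SOME u. rel w u)" using rel_refl[OF vw(2)] by (rule someI)
    assume "q v = q w"
    then have "(SOME u. rel v u) = (SOME u. rel w u)"
      using j sv sw unfolding q_def rel_def by (meson inj_onD)
    then have "rel v w" using rel_trans[OF sv _ vw(1)] rel_sym[OF sw vw(2)] by simp
    then show "w \<ominus>\<^bsub>V\<^esub> v \<in> Q" unfolding rel_def by blast
  next
    assume "w \<ominus>\<^bsub>V\<^esub> v \<in> Q"
    then have "rel v w" using vw unfolding rel_def by blast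
    then have "rel v = rel w" using rel_trans rel_sym vw by blast
    then show "q v = q w" unfolding q_def by simp
  qed
  define s where "s = inv_into (carrier V) q"
  have s: "s (q v) \<in> carrier V" "q (s (q v)) = q v" if "v \<in> carrier V" for v
    using that unfolding s_def by (simp_all add: inv_into_into f_inv_into_f)
  define N :: "('a, 'm) module" where "N =
    \<lparr>carrier = q ` carrier V, monoid.mult = undefined, one = undefined, ring.zero = q \<zero>\<^bsub>V\<^esub>,
     ring.add = (\<lambda>a b. q (s a \<oplus>\<^bsub>V\<^esub> s b)), smult = (\<lambda>r a. q (r \<odot>\<^bsub>V\<^esub> s a))\<rparr>"
  have add: "q v \<oplus>\<^bsub>N\<^esub> q w = q (v \<oplus>\<^bsub>V\<^esub> w)" if vw: "v \<in> carrier V" "w \<in> carrier V" for v w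
  proof -
    have d: "v \<ominus>\<^bsub>V\<^esub> s (q v) \<in> Q" "w \<ominus>\<^bsub>V\<^esub> s (q w) \<in> Q"
      using q_eq s vw by metis+
    have "(v \<oplus>\<^bsub>V\<^esub> w) \<ominus>\<^bsub>V\<^esub> (s (q v) \<oplus>\<^bsub>V\<^esub> s (q w)) = (v \<ominus>\<^bsub>V\<^esub> s (q v)) \<oplus>\<^bsub>V\<^esub> (w \<ominus>\<^bsub>V\<^esub> s (q w))"
      using vw s by (simp add: a_minus_def V.M.minus_add V.M.a_ac)
    then have "q (s (q v) \<oplus>\<^bsub>V\<^esub> s (q w)) = q (v \<oplus>\<^bsub>V\<^esub> w)"
      using q_eq Qs(3)[OF d] vw s by simp
    then show ?thesis unfolding N_def by simp
  qed
  have smult: "r \<odot>\<^bsub>N\<^esub> q v = q (r \<odot>\<^bsub>V\<^esub> v)" if v: "v \<in> carrier V" "r \<in> carrier R" for v r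
  proof -
    have d: "v \<ominus>\<^bsub>V\<^esub> s (q v) \<in> Q" using q_eq s v by metis
    have "(r \<odot>\<^bsub>V\<^esub> v) \<ominus>\<^bsub>V\<^esub> (r \<odot>\<^bsub>V\<^esub> s (q v)) = r \<odot>\<^bsub>V\<^esub> (v \<ominus>\<^bsub>V\<^esub> s (q v))"
      using v s by (simp add: a_minus_def V.smult_r_distr V.smult_minus)
    then have "q (r \<odot>\<^bsub>V\<^esub> s (q v)) = q (r \<odot>\<^bsub>V\<^esub> v)"
      using q_eq Qs(4)[OF v(2) d] v s V.smult_closed by simp
    then show ?thesis unfolding N_def by simp
  qed
  have carN: "carrier N = q ` carrier V" and zeroN: "\<zero>\<^bsub>N\<^esub> = q \<zero>\<^bsub>V\<^esub>" unfolding N_def by simp_all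
  have "abelian_group N"
  proof (rule abelian_groupI)
    fix x assume "x \<in> carrier N"
    then obtain v where v: "v \<in> carrier V" "x = q v" unfolding carN by blast
    then show "\<exists>y\<in>carrier N. y \<oplus>\<^bsub>N\<^esub> x = \<zero>\<^bsub>N\<^esub>"
      by (intro bexI[of _ "q (\<ominus>\<^bsub>V\<^esub> v)"]) (auto simp: add zeroN carN V.M.l_neg)
  qed (auto simp: carN zeroN add V.M.a_ac)
  then have "right_module R N"
    by (intro right_module.intro right_module_axioms.intro V.R.ring_axioms)
       (auto simp: carN add smult V.smult_closed V.smult_l_distr V.smult_r_distr V.smult_assoc V.smult_one)
  moreover have "q \<in> mod_hom R V N" unfolding mod_hom_def hom_def by (auto simp: carN add smult)
  moreover have "q v = \<zero>\<^bsub>N\<^esub> \<longleftrightarrow> v \<in> Q" if "v \<in> carrier V" for v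
    using q_eq[of "\<zero>\<^bsub>V\<^esub>" v] that V.M.add.inv_one[folded a_inv_def] unfolding zeroN by (auto simp: a_minus_def)
  ultimately show thesis using that carN by metis
qed

text \<open>A finite sequence is determined by the finite set of its nonzero entries together with their positions.\<close>

lemma (in ring) finite_sequences_lepoll:
  assumes "infinite (UNIV :: 'm set)" "carrier R \<lesssim> (UNIV :: 'm set)"
  shows "carrier (finite_sequences R) \<lesssim> (UNIV :: 'm set)"
proof -
  let ?S = "(UNIV :: nat set) \<times> carrier R"
  let ?T = "(UNIV :: 'm set) \<times> (UNIV :: 'm set)"
  let ?g = "\<lambda>v :: nat \<Rightarrow> 'a. {(i, v i) | i. v i \<noteq> \<zero>}"
  have "?g v \<in> Fpow ?S" if v: "v \<in> carrier (finite_sequences R)" for v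
  proof -
    obtain n where n: "\<forall>i\<ge>n. v i = \<zero>" using v unfolding finite_sequences_carrier by blast
    have "?g v \<subseteq> (\<lambda>i. (i, v i)) ` {..<n}" using n by (force simp: not_le[symmetric])
    then have "finite (?g v)" by (rule finite_subset) simp
    then show ?thesis using v unfolding Fpow_def finite_sequences_carrier by auto
  qed
  moreover have "inj_on ?g (carrier (finite_sequences R))"
  proof (rule inj_onI, rule ext)
    fix v w i assume eq: "?g v = ?g w"
    have g: "(i, x) \<in> ?g u \<longleftrightarrow> u i = x \<and> x \<noteq> \<zero>" for u :: "nat \<Rightarrow> 'a" and x by auto
    have "v i = x \<and> x \<noteq> \<zero> \<longleftrightarrow> w i = x \<and> x \<noteq> \<zero>" for x
      unfolding g[symmetric] eq ..
    from this[of "v i"] this[of "w i"] show "v i = w i" by auto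
  qed
  ultimately have "carrier (finite_sequences R) \<lesssim> Fpow ?S" unfolding lepoll_def by blast
  also have "Fpow ?S \<lesssim> Fpow ?T"
  proof -
    have "?S \<lesssim> ?T"
      using assms infinite_le_lepoll by (intro times_lepoll_mono) blast+
    then have "|?S| \<le>o |?T|" unfolding lepoll_def card_of_ordLeq .
    then have "|Fpow ?S| \<le>o |Fpow ?T|" by (rule card_of_Fpow_mono)
    then show ?thesis unfolding lepoll_def card_of_ordLeq .
  qed
  also have "Fpow ?T \<approx> ?T"
    using assms(1) by (intro eqpoll_Fpow) (metis finite_cartesian_productD1 UNIV_not_empty)
  also have "?T \<approx> (UNIV :: 'm set)"
    unfolding eqpoll_iff_card_of_ordIso using card_of_Times_same_infinite[OF assms(1)] by simp
  finally show ?thesis .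
qed

primrec partial_comb :: "('a, 'f) module \<Rightarrow> (nat \<Rightarrow> 'f) \<Rightarrow> (nat \<Rightarrow> 'a) \<Rightarrow> nat \<Rightarrow> 'f" where
  "partial_comb F y v 0 = \<zero>\<^bsub>F\<^esub>"
| "partial_comb F y v (Suc n) = partial_comb F y v n \<oplus>\<^bsub>F\<^esub> v n \<odot>\<^bsub>F\<^esub> y n"

text \<open>
  The universal property of the free module. The image of \<open>v\<close> is a partial linear combination that is long enough to
  contain all nonzero entries of \<open>v\<close>.
\<close>

lemma finite_sequences_lift:
  assumes F: "right_module R F" and y: "\<And>i. y i \<in> carrier F"
  shows "\<exists>h \<in> mod_hom R (finite_sequences R) F.
    \<forall>i. \<forall>r\<in>carrier R. h (unit_seq R i r) = r \<odot>\<^bsub>F\<^esub> y i"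
proof -
  interpret F: right_module R F by fact
  interpret V: right_module R "finite_sequences R" by (rule F.right_module_finite_sequences)
  let ?c = "partial_comb F y"
  have closed: "?c v n \<in> carrier F" if "\<And>i. v i \<in> carrier R" for v n
    by (induction n) (use that y F.smult_closed in auto)
  have stable: "?c v m = ?c v n" if "\<And>i. v i \<in> carrier R" "\<And>i. i \<ge> n \<Longrightarrow> v i = \<zero>\<^bsub>R\<^esub>" "m \<ge> n" for v m n
    using that(3) by (induction m rule: dec_induct) (use that y closed in auto)
  have add: "?c (\<lambda>i. v i \<oplus>\<^bsub>R\<^esub> w i) n = ?c v n \<oplus>\<^bsub>F\<^esub> ?c w n"
    if "\<And>i. v i \<in> carrier R" "\<And>i. w i \<in> carrier R" for v w n
    by (induction n) (use that y closed F.smult_closed in \<open>auto simp: F.smult_l_distr F.M.a_ac\<close>)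
  have smult: "?c (\<lambda>i. v i \<otimes>\<^bsub>R\<^esub> r) n = r \<odot>\<^bsub>F\<^esub> ?c v n"
    if "\<And>i. v i \<in> carrier R" "r \<in> carrier R" for v r n
    by (induction n) (use that y closed F.smult_closed in \<open>auto simp: F.smult_r_distr F.smult_assoc\<close>)
  define h where "h v = ?c v (LEAST n. \<forall>i\<ge>n. v i = \<zero>\<^bsub>R\<^esub>)" for v
  have h: "h v = ?c v n" if v: "\<And>i. v i \<in> carrier R" "\<And>i. i \<ge> n \<Longrightarrow> v i = \<zero>\<^bsub>R\<^esub>" for v n
  proof -
    have n: "\<forall>i\<ge>n. v i = \<zero>\<^bsub>R\<^esub>" using v(2) by blast
    define k where "k = (LEAST n. \<forall>i\<ge>n. v i = \<zero>\<^bsub>R\<^esub>)"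
    have k: "\<forall>i\<ge>k. v i = \<zero>\<^bsub>R\<^esub>" unfolding k_def by (rule LeastI[of _ n]) (rule n)
    have "k \<le> n" unfolding k_def using n by (rule Least_le)
    then have "?c v n = ?c v k" using k by (intro stable v(1)) auto
    then show ?thesis unfolding h_def k_def by simp
  qed
  have h2: "\<exists>n. h v = ?c v n \<and> h w = ?c w n \<and> h (\<lambda>i. v i \<oplus>\<^bsub>R\<^esub> w i) = ?c (\<lambda>i. v i \<oplus>\<^bsub>R\<^esub> w i) n"
    if vw: "v \<in> carrier (finite_sequences R)" "w \<in> carrier (finite_sequences R)" for v w
  proof -
    obtain m n where mn: "\<forall>i\<ge>m. v i = \<zero>\<^bsub>R\<^esub>" "\<forall>i\<ge>n. w i = \<zero>\<^bsub>R\<^esub>" "\<forall>i. v i \<in> carrier R" "\<forall>i. w i \<in> carrier R"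
      using vw unfolding finite_sequences_carrier by blast
    show ?thesis by (intro exI[of _ "max m n"] conjI h) (use mn in auto)
  qed
  have "h \<in> mod_hom R (finite_sequences R) F"
    unfolding mod_hom_def hom_def
  proof (safe, simp_all)
    fix v assume v: "v \<in> carrier (finite_sequences R)"
    then obtain n where n: "\<forall>i\<ge>n. v i = \<zero>\<^bsub>R\<^esub>" "\<forall>i. v i \<in> carrier R" unfolding finite_sequences_carrier by blast
    then have hv: "h v = ?c v n" by (intro h) auto
    then show "h v \<in> carrier F" using closed n by simp
    fix r assume r: "r \<in> carrier R"
    have "h (\<lambda>i. v i \<otimes>\<^bsub>R\<^esub> r) = ?c (\<lambda>i. v i \<otimes>\<^bsub>R\<^esub> r) n" by (rule h) (use n r in auto)
    then show "h (\<lambda>i. v i \<otimes>\<^bsub>R\<^esub> r) = r \<odot>\<^bsub>F\<^esub> h v" using smult n r hv by simp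
  next
    fix v w assume vw: "v \<in> carrier (finite_sequences R)" "w \<in> carrier (finite_sequences R)"
    then obtain n where n: "h v = ?c v n" "h w = ?c w n" "h (\<lambda>i. v i \<oplus>\<^bsub>R\<^esub> w i) = ?c (\<lambda>i. v i \<oplus>\<^bsub>R\<^esub> w i) n"
      using h2 by blast
    have "\<And>i. v i \<in> carrier R" "\<And>i. w i \<in> carrier R" using vw unfolding finite_sequences_carrier by auto
    then show "h (\<lambda>i. v i \<oplus>\<^bsub>R\<^esub> w i) = h v \<oplus>\<^bsub>F\<^esub> h w" unfolding n by (rule add)
  qed
  moreover have "h (unit_seq R i r) = r \<odot>\<^bsub>F\<^esub> y i" if r: "r \<in> carrier R" for i r
  proof -
    have "?c (unit_seq R i r) n = \<zero>\<^bsub>F\<^esub>" if "n \<le> i" for n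
      using that by (induction n) (use y in \<open>auto simp: unit_seq_def\<close>)
    then have "?c (unit_seq R i r) (Suc i) = r \<odot>\<^bsub>F\<^esub> y i"
      using y r F.smult_closed by (simp add: unit_seq_def)
    moreover have "h (unit_seq R i r) = ?c (unit_seq R i r) (Suc i)"
      by (rule h) (use r in \<open>auto simp: unit_seq_def\<close>)
    ultimately show ?thesis by simp
  qed
  ultimately show ?thesis by blast
qed

text \<open>
  For a right ideal \<open>p\<close> this is the submodule \<open>F p\<close>, since the products are then closed under scalars, in particular
  under negation.
\<close>

inductive_set module_times :: "('a, 'f) module \<Rightarrow> 'a set \<Rightarrow> 'f set" for F p where
  times: "y \<in> carrier F \<Longrightarrow> b \<in> p \<Longrightarrow> b \<odot>\<^bsub>F\<^esub> y \<in> module_times F p"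
| add: "z \<in> module_times F p \<Longrightarrow> z' \<in> module_times F p \<Longrightarrow> z \<oplus>\<^bsub>F\<^esub> z' \<in> module_times F p"

lemma (in right_module) submodule_module_times:
  assumes p: "right_ideal R p"
  shows "submodule (module_times M p) R M"
proof -
  note pr = R.right_idealD[OF p]
  have c: "z \<in> carrier M" if "z \<in> module_times M p" for z
    using that by induction (use pr smult_closed in auto)
  have "r \<odot>\<^bsub>M\<^esub> z \<in> module_times M p" if "z \<in> module_times M p" "r \<in> carrier R" for r z
    using that
  proof induction
    case (times y b)
    then show ?case using module_times.times[of y M "b \<otimes> r" p] pr(3,5) by (simp add: smult_assoc)
  next
    case (add z z')
    then show ?case using module_times.add c by (simp add: smult_r_distr)
  qed
  moreover have "\<zero>\<^bsub>M\<^esub> \<in> module_times M p" using module_times.times[OF M.zero_closed pr(2)] pr(2) by simp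
  ultimately show ?thesis unfolding submodule_iff
    by (intro conjI ballI subsetI) (simp_all add: c module_times.add)
qed

context abelian_group
begin

lemma add_diff_add:
  assumes "a \<in> carrier G" "b \<in> carrier G" "c \<in> carrier G" "d \<in> carrier G"
  shows "(a \<oplus> b) \<ominus> (c \<oplus> d) = (a \<ominus> c) \<oplus> (b \<ominus> d)"
  using assms by (simp add: a_minus_def minus_add a_ac)

lemma diff_diff_diff:
  assumes "a \<in> carrier G" "s \<in> carrier G" "t \<in> carrier G"
  shows "(s \<ominus> t) \<ominus> (s \<ominus> a) = a \<ominus> t"
proof -
  have "(s \<ominus> t) \<ominus> (s \<ominus> a) = s \<oplus> (\<ominus> s \<oplus> (a \<oplus> \<ominus> t))"
    using assms by (simp add: a_minus_def minus_add a_ac)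
  also have "\<dots> = a \<ominus> t" using assms by (simp add: a_minus_def r_neg2)
  finally show ?thesis .
qed

lemma diff_diff_eq_diff_add:
  assumes "a \<in> carrier G" "b \<in> carrier G" "c \<in> carrier G"
  shows "a \<ominus> b \<ominus> c = a \<ominus> (b \<oplus> c)"
  using assms by (simp add: a_minus_def minus_add a_ac)

lemma diff_add_cancel:
  assumes "a \<in> carrier G" "b \<in> carrier G" shows "b \<oplus> (a \<ominus> b) = a"
proof -
  have "b \<oplus> (a \<ominus> b) = b \<oplus> (\<ominus> b \<oplus> a)" using assms by (simp add: a_minus_def a_comm)
  then show ?thesis using assms by (simp add: r_neg2)
qed

end

text \<open>
  What a flat delta-cover \<open>F\<close> of \<open>V / Q\<close> says about the free module \<open>V\<close> modulo \<open>p\<close>, when \<open>V p \<subseteq> Q\<close>. The flat module is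
  \<open>F / F p = V / L\<close>; smallness of the kernel turns into smallness of \<open>Q / L\<close>, and flatness over \<open>R / p\<close> into
  the purity statement \<open>L \<inter> V I \<subseteq> L I + V p\<close> for the left ideals \<open>I\<close> above \<open>p\<close>. Here \<open>W\<close> stands for an arbitrary
  subgroup that contains \<open>L I + V p\<close>.
\<close>

definition flat_resolution :: "('a, 'r) ring_scheme \<Rightarrow> 'a set \<Rightarrow> (nat \<Rightarrow> 'a) set \<Rightarrow> (nat \<Rightarrow> 'a) set \<Rightarrow> bool" where
  "flat_resolution R p Q L \<longleftrightarrow>
    submodule L R (finite_sequences R) \<and> sequences_in R p \<subseteq> L \<and> L \<subseteq> Q \<and>
    (\<forall>S. submodule S R (finite_sequences R) \<and> L \<subseteq> S \<and>
       S <+>\<^bsub>finite_sequences R\<^esub> Q = carrier (finite_sequences R) \<longrightarrow> S = carrier (finite_sequences R)) \<and>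
    (\<forall>I W v. left_ideal R I \<and> p \<subseteq> I \<and> v \<in> L \<and> (\<forall>i. v i \<in> I) \<and>
       subgroup W (add_monoid (finite_sequences R)) \<and> sequences_in R p \<subseteq> W \<and>
       (\<forall>l\<in>L. \<forall>a\<in>I. a \<odot>\<^bsub>finite_sequences R\<^esub> l \<in> W) \<longrightarrow> v \<in> W)"

lemma flat_resolutionD:
  assumes "flat_resolution R p Q L"
  shows "submodule L R (finite_sequences R)" "sequences_in R p \<subseteq> L" "L \<subseteq> Q"
    "submodule S R (finite_sequences R) \<Longrightarrow> L \<subseteq> S \<Longrightarrow>
      S <+>\<^bsub>finite_sequences R\<^esub> Q = carrier (finite_sequences R) \<Longrightarrow> S = carrier (finite_sequences R)"
    "left_ideal R I \<Longrightarrow> p \<subseteq> I \<Longrightarrow> v \<in> L \<Longrightarrow> (\<And>i. v i \<in> I) \<Longrightarrow>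
       subgroup W (add_monoid (finite_sequences R)) \<Longrightarrow> sequences_in R p \<subseteq> W \<Longrightarrow>
       (\<And>l a. l \<in> L \<Longrightarrow> a \<in> I \<Longrightarrow> a \<odot>\<^bsub>finite_sequences R\<^esub> l \<in> W) \<Longrightarrow> v \<in> W"
proof -
  note def = assms[unfolded flat_resolution_def]
  show "submodule L R (finite_sequences R)" "sequences_in R p \<subseteq> L" "L \<subseteq> Q"
    using def by blast+
  note small = def[THEN conjunct2, THEN conjunct2, THEN conjunct2, THEN conjunct1]
  show "submodule S R (finite_sequences R) \<Longrightarrow> L \<subseteq> S \<Longrightarrow>
      S <+>\<^bsub>finite_sequences R\<^esub> Q = carrier (finite_sequences R) \<Longrightarrow> S = carrier (finite_sequences R)"
    by (rule small[rule_format]) (intro conjI)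
  note pure = def[THEN conjunct2, THEN conjunct2, THEN conjunct2, THEN conjunct2]
  show "v \<in> W" if "left_ideal R I" "p \<subseteq> I" "v \<in> L" "\<And>i. v i \<in> I"
    "subgroup W (add_monoid (finite_sequences R))" "sequences_in R p \<subseteq> W"
    "\<And>l a. l \<in> L \<Longrightarrow> a \<in> I \<Longrightarrow> a \<odot>\<^bsub>finite_sequences R\<^esub> l \<in> W"
    by (rule pure[rule_format, of I v W]) (intro conjI allI ballI that)
qed

text \<open>
  Lift \<open>V \<rightarrow> V / Q\<close> to \<open>h : V \<rightarrow> F\<close> and let \<open>L\<close> be the preimage of \<open>F p\<close>. Since the kernel of the cover contains
  \<open>F p\<close> and behaves like a small submodule, \<open>h(V) + F p = F\<close>. For purity, send \<open>(z, a)\<close> to \<open>w a\<close> with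
  \<open>z \<in> h(w) + F p\<close>; this is well defined modulo \<open>L I\<close>, hence balanced modulo \<open>L I + V p\<close>, and flatness of \<open>F\<close> applies to
  the relation that expresses \<open>h(v) \<in> F p\<close>.
\<close>

lemma flat_delta_cover_resolution:
  fixes R :: "('a, 'r) ring_scheme" (structure) and p :: "'a set"
  defines "V \<equiv> finite_sequences R"
  assumes ring: "ring R" and inf: "infinite (UNIV :: 'm set)" and le: "carrier R \<lesssim> (UNIV :: 'm set)"
    and perfect: "right_G_delta_perfect TYPE('m) TYPE('f) R"
    and p: "ideal p R"
    and ess: "\<And>I. ring.maximal_right_ideal R I \<Longrightarrow> p \<subseteq> I \<Longrightarrow> essential_submodule R (right_regular R) I"
    and Q: "submodule Q R V" and pQ: "sequences_in R p \<subseteq> Q"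
  shows "\<exists>L. flat_resolution R p Q L"
proof -
  interpret ring R by fact
  interpret V: right_module R V unfolding V_def by (rule right_module_finite_sequences)
  have rp: "right_ideal R p" using p by (rule ideal_right_ideal)
  obtain \<phi> :: "'a \<Rightarrow> 'm" where \<phi>: "inj_on \<phi> (carrier R)" using le unfolding lepoll_def by blast
  obtain j :: "(nat \<Rightarrow> 'a) \<Rightarrow> 'm" where j: "inj_on j (carrier V)"
    using finite_sequences_lepoll[OF inf le] unfolding lepoll_def V_def by blast
  obtain N :: "('a, 'm) module" and q where N: "right_module R N" and q: "q \<in> mod_hom R V N"
    and q_surj: "q ` carrier V = carrier N" and q_ker: "\<And>v. v \<in> carrier V \<Longrightarrow> q v = \<zero>\<^bsub>N\<^esub> \<longleftrightarrow> v \<in> Q"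
    using quotient_on_type[OF V.right_module_axioms Q j] by metis
  obtain F :: "('a, 'f) module" and f where cover: "flat_delta_cover TYPE('m) R F N f"
    using perfect N unfolding right_G_delta_perfect_def by blast
  then have flat: "flat_module TYPE('m) R F" and f: "f \<in> mod_hom R F N"
    and f_surj: "f ` carrier F = carrier N" and K: "delta_small R F (a_kernel F N f)"
    unfolding flat_delta_cover_def by auto
  have Fm: "right_module R F" using flat unfolding flat_module_def by blast
  interpret N: right_module R N by fact
  interpret F: right_module R F by fact
  let ?K = "a_kernel F N f"
  have K_iff: "z \<in> ?K \<longleftrightarrow> z \<in> carrier F \<and> f z = \<zero>\<^bsub>N\<^esub>" for z by (simp add: a_kernel_def')
  note qh = mod_homD[OF q] and fh = mod_homD[OF f]
  let ?e = "\<lambda>i. unit_seq R i \<one>"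
  have e: "?e i \<in> carrier V" for i unfolding V_def by simp
  have re: "unit_seq R i r = r \<odot>\<^bsub>V\<^esub> ?e i" if "r \<in> carrier R" for i r
    unfolding V_def using that by (auto simp: unit_seq_def fun_eq_iff)
  have "\<exists>y. y \<in> carrier F \<and> f y = q (?e i)" for i using f_surj qh(1)[OF e[of i]] by (metis imageE)
  then obtain y where y: "\<And>i. y i \<in> carrier F" "\<And>i. f (y i) = q (?e i)" by metis
  obtain h where h: "h \<in> mod_hom R V F"
    and h_unit: "\<And>i r. r \<in> carrier R \<Longrightarrow> h (unit_seq R i r) = r \<odot>\<^bsub>F\<^esub> y i"
    using finite_sequences_lift[where F=F and y=y, OF Fm y(1)] unfolding V_def by blast
  note hh = mod_homD[OF h]
  note h_diff = mod_hom_zero_diff(2)[OF V.right_module_axioms Fm h]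
  note h_zero = mod_hom_zero_diff(1)[OF V.right_module_axioms Fm h]
  have fh_q: "f (h v) = q v" if v: "v \<in> carrier V" for v
  proof -
    have "v \<in> {v \<in> carrier V. f (h v) = q v}"
    proof (rule finite_sequences_generated[where I="carrier R"])
      show "v \<in> carrier (finite_sequences R)" "\<And>i. v i \<in> carrier R"
        using v unfolding V_def finite_sequences_carrier by auto
      show "(\<lambda>i. \<zero>) \<in> {v \<in> carrier V. f (h v) = q v}"
        using h_zero mod_hom_zero_diff(1)[OF V.right_module_axioms N q]
          mod_hom_zero_diff(1)[OF Fm N f] V.M.zero_closed unfolding V_def by simp
      show "x \<oplus>\<^bsub>finite_sequences R\<^esub> z \<in> {v \<in> carrier V. f (h v) = q v}"
        if "x \<in> {v \<in> carrier V. f (h v) = q v}" "z \<in> {v \<in> carrier V. f (h v) = q v}" for x z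
        using that hh(1,2) fh(2) qh(2) unfolding V_def[symmetric] by simp
      show "unit_seq R i r \<in> {v \<in> carrier V. f (h v) = q v}" if "r \<in> carrier R" for i r
      proof -
        have "f (h (unit_seq R i r)) = r \<odot>\<^bsub>N\<^esub> q (?e i)"
          using h_unit[OF that] fh(3)[OF that y(1)] y(2) by simp
        also have "\<dots> = q (unit_seq R i r)" using qh(3)[OF that e] re[OF that] by metis
        finally show ?thesis unfolding V_def using that by simp
      qed
    qed simp
    then show ?thesis by simp
  qed
  let ?P = "module_times F p"
  have P: "submodule ?P R F" by (rule F.submodule_module_times[OF rp])
  have Pc: "z \<in> carrier F" if "z \<in> ?P" for z using P that unfolding F.submodule_iff by blast
  have Pa: "z \<oplus>\<^bsub>F\<^esub> z' \<in> ?P" if "z \<in> ?P" "z' \<in> ?P" for z z' using P that unfolding F.submodule_iff by blast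
  have P0: "\<zero>\<^bsub>F\<^esub> \<in> ?P" and Ps: "r \<in> carrier R \<Longrightarrow> z \<in> ?P \<Longrightarrow> r \<odot>\<^bsub>F\<^esub> z \<in> ?P" for r z
    using P unfolding F.submodule_iff by auto
  note Pd = F.submodule_diff[OF P]
  have PK: "z \<in> ?K" if "z \<in> ?P" for z
    using that
  proof induction
    case (times z b)
    have b: "b \<in> carrier R" using times(2) right_idealD(3)[OF rp] by blast
    obtain v where v: "v \<in> carrier V" "f z = q v" using fh(1)[OF times(1)] q_surj by (metis imageE)
    have "b \<odot>\<^bsub>V\<^esub> v \<in> sequences_in R p"
      using V.smult_closed[OF b v(1)] v(1) ideal.I_l_closed[OF p times(2)]
      unfolding sequences_in_def V_def finite_sequences_carrier by simp
    then have "q (b \<odot>\<^bsub>V\<^esub> v) = \<zero>\<^bsub>N\<^esub>" using pQ q_ker V.smult_closed[OF b v(1)] by blast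
    then show ?case unfolding K_iff using fh(3)[OF b times(1)] qh(3)[OF b v(1)] v(2) F.smult_closed b times(1) by simp
  next
    case (add z z')
    then show ?case using fh(2) unfolding K_iff by simp
  qed
  have hS: "submodule (h ` S) R F" if S: "submodule S R V" for S
  proof -
    have Ss: "S \<subseteq> carrier V" "\<zero>\<^bsub>V\<^esub> \<in> S" "\<And>x y. x \<in> S \<Longrightarrow> y \<in> S \<Longrightarrow> x \<oplus>\<^bsub>V\<^esub> y \<in> S"
      "\<And>r x. r \<in> carrier R \<Longrightarrow> x \<in> S \<Longrightarrow> r \<odot>\<^bsub>V\<^esub> x \<in> S"
      using S unfolding V.submodule_iff by auto
    have "\<zero>\<^bsub>F\<^esub> \<in> h ` S" using Ss(2) h_zero by (metis imageI)
    moreover have "h v \<oplus>\<^bsub>F\<^esub> h w \<in> h ` S" if "v \<in> S" "w \<in> S" for v w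
      using that Ss hh(2)[of v w] by (metis imageI subsetD)
    moreover have "r \<odot>\<^bsub>F\<^esub> h v \<in> h ` S" if "r \<in> carrier R" "v \<in> S" for v r
      using that Ss hh(3)[of r v] by (metis imageI subsetD)
    ultimately show ?thesis unfolding F.submodule_iff using Ss(1) hh(1) by blast
  qed
  \<comment> \<open>\<open>h(S) + F p\<close> and the kernel span \<open>F\<close>, and the kernel is delta-small.\<close>
  have full: "h ` S <+>\<^bsub>F\<^esub> ?P = carrier F" if S: "submodule S R V" "S <+>\<^bsub>V\<^esub> Q = carrier V" for S
  proof (rule F.delta_small_sum_eq[OF K, of _ p])
    let ?T = "h ` S <+>\<^bsub>F\<^esub> ?P"
    note sT = F.submodule_sum[OF hS[OF S(1)] P]
    show "submodule ?T R F" by (rule sT(1))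
    show "b \<odot>\<^bsub>F\<^esub> z \<in> ?T" if "z \<in> carrier F" "b \<in> p" for z b
      using sT(3) module_times.times[OF that] by blast
    show "p \<subseteq> carrier R" using right_idealD(1)[OF rp] .
    show "essential_submodule R (right_regular R) I" if "maximal_right_ideal I" "p \<subseteq> I" for I
      using ess that by blast
    have sK: "submodule ?K R F" using K unfolding delta_small_def by blast
    have Sc: "S \<subseteq> carrier V" and Qc: "Q \<subseteq> carrier V" using S(1) Q unfolding V.submodule_iff by auto
    have "z \<in> ?T <+>\<^bsub>F\<^esub> ?K" if z: "z \<in> carrier F" for z
    proof -
      obtain v where v: "v \<in> carrier V" "f z = q v" using fh(1)[OF z] q_surj by (metis imageE)
      then have "v \<in> S <+>\<^bsub>V\<^esub> Q" using S(2) by simp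
      then obtain s t where st: "s \<in> S" "t \<in> Q" "v = s \<oplus>\<^bsub>V\<^esub> t" unfolding mem_set_add by blast
      have c: "s \<in> carrier V" "t \<in> carrier V" using st Sc Qc by auto
      have "f (z \<ominus>\<^bsub>F\<^esub> h s) = q v \<ominus>\<^bsub>N\<^esub> q s"
        using mod_hom_zero_diff(2)[OF Fm N f z hh(1)[OF c(1)]] v(2) fh_q[OF c(1)] by simp
      also have "q v = q s" using st(3) qh(2)[OF c] q_ker[OF c(2)] st(2) qh(1)[OF c(1)] by simp
      also have "q s \<ominus>\<^bsub>N\<^esub> q s = \<zero>\<^bsub>N\<^esub>" using qh(1)[OF c(1)] by (simp add: a_minus_def N.M.r_neg)
      finally have "z \<ominus>\<^bsub>F\<^esub> h s \<in> ?K" unfolding K_iff using z hh(1)[OF c(1)] by simp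
      moreover have "h s \<in> ?T" using sT(2) st(1) by blast
      moreover have "z = h s \<oplus>\<^bsub>F\<^esub> (z \<ominus>\<^bsub>F\<^esub> h s)" using F.M.diff_add_cancel[OF z hh(1)[OF c(1)]] by simp
      ultimately show ?thesis unfolding mem_set_add[of z] by blast
    qed
    moreover have "?T <+>\<^bsub>F\<^esub> ?K \<subseteq> carrier F"
      using F.submodule_sum(1)[OF sT(1) sK] unfolding F.submodule_iff by blast
    ultimately show "?T <+>\<^bsub>F\<^esub> ?K = carrier F" by blast
  qed
  define L where "L = {v \<in> carrier V. h v \<in> ?P}"
  have L: "submodule L R V"
    unfolding V.submodule_iff L_def using hh h_zero Pa P0 Ps V.smult_closed by auto
  have pL: "sequences_in R p \<subseteq> L"
  proof
    fix v assume v: "v \<in> sequences_in R p"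
    show "v \<in> L"
    proof (rule finite_sequences_generated[where I=p])
      show "v \<in> carrier (finite_sequences R)" "\<And>i. v i \<in> p" using v unfolding sequences_in_def by auto
      show "\<zero> \<in> p" using right_idealD(2)[OF rp] .
      show "(\<lambda>i. \<zero>) \<in> L" using L unfolding V.submodule_iff unfolding V_def by simp
      show "x \<oplus>\<^bsub>finite_sequences R\<^esub> z \<in> L" if "x \<in> L" "z \<in> L" for x z
        using L that unfolding V.submodule_iff unfolding V_def by blast
      show "unit_seq R i r \<in> L" if "r \<in> carrier R" "r \<in> p" for i r
        unfolding L_def V_def using that h_unit module_times.times[OF y(1) that(2)] by simp
    qed
  qed
  have LQ: "L \<subseteq> Q"
  proof
    fix v assume "v \<in> L"
    then have v: "v \<in> carrier V" "h v \<in> ?P" unfolding L_def by auto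
    have "f (h v) = \<zero>\<^bsub>N\<^esub>" using PK[OF v(2)] unfolding K_iff by blast
    then show "v \<in> Q" using fh_q[OF v(1)] q_ker[OF v(1)] by simp
  qed
  have Lc: "v \<in> carrier V" if "v \<in> L" for v using that unfolding L_def by blast
  have small: "S = carrier V" if S: "submodule S R V" "L \<subseteq> S" "S <+>\<^bsub>V\<^esub> Q = carrier V" for S
  proof -
    have Sc: "S \<subseteq> carrier V" and Sa: "\<And>x y. x \<in> S \<Longrightarrow> y \<in> S \<Longrightarrow> x \<oplus>\<^bsub>V\<^esub> y \<in> S"
      using S(1) unfolding V.submodule_iff by auto
    have "v \<in> S" if v: "v \<in> carrier V" for v
    proof -
      have "h v \<in> h ` S <+>\<^bsub>F\<^esub> ?P" using full[OF S(1,3)] hh(1)[OF v] by simp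
      then obtain s z where sz: "s \<in> S" "z \<in> ?P" "h v = h s \<oplus>\<^bsub>F\<^esub> z" unfolding mem_set_add by blast
      have sc: "s \<in> carrier V" using sz(1) Sc by blast
      have "h (v \<ominus>\<^bsub>V\<^esub> s) = h s \<oplus>\<^bsub>F\<^esub> z \<ominus>\<^bsub>F\<^esub> h s" using h_diff[OF v sc] sz(3) by simp
      also have "\<dots> = z" using hh(1)[OF sc] Pc[OF sz(2)]
        by (simp add: a_minus_def F.M.a_comm[of "h s"] F.M.a_assoc F.M.r_neg)
      finally have "v \<ominus>\<^bsub>V\<^esub> s \<in> L" unfolding L_def using sz(2) v sc by simp
      then have "s \<oplus>\<^bsub>V\<^esub> (v \<ominus>\<^bsub>V\<^esub> s) \<in> S" using S(2) Sa sz(1) by blast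
      then show ?thesis using V.M.diff_add_cancel[OF v sc] by simp
    qed
    then show ?thesis using Sc by blast
  qed
  have sumV: "carrier V <+>\<^bsub>V\<^esub> Q = carrier V"
    using V.submodule_sum(1,2)[OF V.submodule_carrier Q] unfolding V.submodule_iff by blast
  have "\<exists>w. w \<in> carrier V \<and> z \<ominus>\<^bsub>F\<^esub> h w \<in> ?P" if z: "z \<in> carrier F" for z
  proof -
    have "z \<in> h ` carrier V <+>\<^bsub>F\<^esub> ?P" using full[OF V.submodule_carrier sumV] z by simp
    then obtain w t where wt: "w \<in> carrier V" "t \<in> ?P" "z = h w \<oplus>\<^bsub>F\<^esub> t" unfolding mem_set_add by blast
    have "z \<ominus>\<^bsub>F\<^esub> h w = t" using hh(1)[OF wt(1)] Pc[OF wt(2)] wt(3)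
      by (simp add: a_minus_def F.M.a_comm[of "h w"] F.M.a_assoc F.M.r_neg)
    then show ?thesis using wt by blast
  qed
  then obtain w where w: "\<And>z. z \<in> carrier F \<Longrightarrow> w z \<in> carrier V"
    "\<And>z. z \<in> carrier F \<Longrightarrow> z \<ominus>\<^bsub>F\<^esub> h (w z) \<in> ?P" by metis
  have pure: "v \<in> W" if I: "left_ideal R I" and pI: "p \<subseteq> I" and v: "v \<in> L" "\<And>i. v i \<in> I"
    and W: "subgroup W (add_monoid V)" and pW: "sequences_in R p \<subseteq> W"
    and LW: "\<And>l a. l \<in> L \<Longrightarrow> a \<in> I \<Longrightarrow> a \<odot>\<^bsub>V\<^esub> l \<in> W" for I W v
  proof -
    interpret W: subgroup W "add_monoid V" by fact
    have Wc: "x \<in> carrier V" if "x \<in> W" for x using W.mem_carrier[OF that] by simp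
    have Wa: "x \<oplus>\<^bsub>V\<^esub> z \<in> W" if "x \<in> W" "z \<in> W" for x z using W.m_closed[OF that] by simp
    have Wn: "\<ominus>\<^bsub>V\<^esub> x \<in> W" if "x \<in> W" for x using W.m_inv_closed[OF that] by (simp add: a_inv_def)
    have Wd: "x \<ominus>\<^bsub>V\<^esub> z \<in> W" if "x \<in> W" "z \<in> W" for x z unfolding a_minus_def by (intro Wa Wn that)
    have W0: "\<zero>\<^bsub>V\<^esub> \<in> W" using W.one_closed by simp
    have Ic: "a \<in> carrier R" if "a \<in> I" for a using I that unfolding left_ideal_def by blast
    have I0: "\<zero> \<in> I" using I unfolding left_ideal_def by blast
    let ?\<beta> = "\<lambda>z a. a \<odot>\<^bsub>V\<^esub> w z"
    have zero: "g \<in> W" if "tensor_sum F I V ?\<beta> \<zero>\<^bsub>F\<^esub> g" for g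
    proof (rule flat_tensor_sum_zero[OF flat \<phi> I V.M.abelian_group_axioms W _ _ _ _ that])
      show "a \<odot>\<^bsub>V\<^esub> w z \<in> carrier V" if "z \<in> carrier F" "a \<in> I" for z a
        using that w(1) Ic V.smult_closed by simp
      show "a \<odot>\<^bsub>V\<^esub> w (z \<oplus>\<^bsub>F\<^esub> z') \<ominus>\<^bsub>V\<^esub> a \<odot>\<^bsub>V\<^esub> w z \<ominus>\<^bsub>V\<^esub> a \<odot>\<^bsub>V\<^esub> w z' \<in> W"
        if z: "z \<in> carrier F" "z' \<in> carrier F" and a: "a \<in> I" for z z' a
      proof -
        have zz: "z \<oplus>\<^bsub>F\<^esub> z' \<in> carrier F" using z by simp
        let ?u = "w (z \<oplus>\<^bsub>F\<^esub> z') \<ominus>\<^bsub>V\<^esub> (w z \<oplus>\<^bsub>V\<^esub> w z')"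
        have "h ?u = h (w (z \<oplus>\<^bsub>F\<^esub> z')) \<ominus>\<^bsub>F\<^esub> (h (w z) \<oplus>\<^bsub>F\<^esub> h (w z'))"
          using w(1)[OF zz] w(1)[OF z(1)] w(1)[OF z(2)] h_diff hh(2) by simp
        also have "\<dots> = ((z \<oplus>\<^bsub>F\<^esub> z') \<ominus>\<^bsub>F\<^esub> (h (w z) \<oplus>\<^bsub>F\<^esub> h (w z'))) \<ominus>\<^bsub>F\<^esub> ((z \<oplus>\<^bsub>F\<^esub> z') \<ominus>\<^bsub>F\<^esub> h (w (z \<oplus>\<^bsub>F\<^esub> z')))"
          using w(1)[OF zz] w(1)[OF z(1)] w(1)[OF z(2)] hh(1) z by (subst F.M.diff_diff_diff) simp_all
        also have "(z \<oplus>\<^bsub>F\<^esub> z') \<ominus>\<^bsub>F\<^esub> (h (w z) \<oplus>\<^bsub>F\<^esub> h (w z')) = (z \<ominus>\<^bsub>F\<^esub> h (w z)) \<oplus>\<^bsub>F\<^esub> (z' \<ominus>\<^bsub>F\<^esub> h (w z'))"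
          using w(1)[OF z(1)] w(1)[OF z(2)] hh(1) z by (intro F.M.add_diff_add) simp_all
        finally have "h ?u \<in> ?P" using w(2)[OF zz] w(2)[OF z(1)] w(2)[OF z(2)] Pa Pd by simp
        then have "?u \<in> L" unfolding L_def using w(1) z zz by simp
        then have "a \<odot>\<^bsub>V\<^esub> ?u \<in> W" using LW a by blast
        moreover have "a \<odot>\<^bsub>V\<^esub> ?u = a \<odot>\<^bsub>V\<^esub> w (z \<oplus>\<^bsub>F\<^esub> z') \<ominus>\<^bsub>V\<^esub> a \<odot>\<^bsub>V\<^esub> w z \<ominus>\<^bsub>V\<^esub> a \<odot>\<^bsub>V\<^esub> w z'"
          using w(1)[OF zz] w(1)[OF z(1)] w(1)[OF z(2)] Ic[OF a] V.smult_closed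
          by (simp add: V.M.diff_diff_eq_diff_add) (simp add: a_minus_def V.smult_r_distr V.smult_minus)
        ultimately show ?thesis by simp
      qed
      show "(a \<oplus> b) \<odot>\<^bsub>V\<^esub> w z \<ominus>\<^bsub>V\<^esub> a \<odot>\<^bsub>V\<^esub> w z \<ominus>\<^bsub>V\<^esub> b \<odot>\<^bsub>V\<^esub> w z \<in> W"
        if "z \<in> carrier F" "a \<in> I" "b \<in> I" for z a b
        using that w(1) Ic V.smult_closed W0
        by (simp add: V.M.diff_diff_eq_diff_add V.smult_l_distr) (simp add: a_minus_def V.M.r_neg)
      show "a \<odot>\<^bsub>V\<^esub> w (r \<odot>\<^bsub>F\<^esub> z) \<ominus>\<^bsub>V\<^esub> (r \<otimes> a) \<odot>\<^bsub>V\<^esub> w z \<in> W"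
        if r: "r \<in> carrier R" and z: "z \<in> carrier F" and a: "a \<in> I" for r z a
      proof -
        have rz: "r \<odot>\<^bsub>F\<^esub> z \<in> carrier F" using r z F.smult_closed by simp
        let ?u = "w (r \<odot>\<^bsub>F\<^esub> z) \<ominus>\<^bsub>V\<^esub> r \<odot>\<^bsub>V\<^esub> w z"
        have "h ?u = h (w (r \<odot>\<^bsub>F\<^esub> z)) \<ominus>\<^bsub>F\<^esub> r \<odot>\<^bsub>F\<^esub> h (w z)"
          using w(1)[OF rz] w(1)[OF z] h_diff hh(3) r V.smult_closed by simp
        also have "\<dots> = (r \<odot>\<^bsub>F\<^esub> z \<ominus>\<^bsub>F\<^esub> r \<odot>\<^bsub>F\<^esub> h (w z)) \<ominus>\<^bsub>F\<^esub> (r \<odot>\<^bsub>F\<^esub> z \<ominus>\<^bsub>F\<^esub> h (w (r \<odot>\<^bsub>F\<^esub> z)))"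
          using w(1)[OF rz] w(1)[OF z] hh(1) rz r F.smult_closed by (subst F.M.diff_diff_diff) simp_all
        also have "r \<odot>\<^bsub>F\<^esub> z \<ominus>\<^bsub>F\<^esub> r \<odot>\<^bsub>F\<^esub> h (w z) = r \<odot>\<^bsub>F\<^esub> (z \<ominus>\<^bsub>F\<^esub> h (w z))"
          using w(1)[OF z] hh(1) z r by (simp add: a_minus_def F.smult_r_distr F.smult_minus)
        finally have "h ?u \<in> ?P" using w(2)[OF rz] w(2)[OF z] Ps[OF r] Pd by simp
        then have "?u \<in> L" unfolding L_def using w(1) z rz r V.smult_closed by simp
        then have "a \<odot>\<^bsub>V\<^esub> ?u \<in> W" using LW a by blast
        moreover have "a \<odot>\<^bsub>V\<^esub> ?u = a \<odot>\<^bsub>V\<^esub> w (r \<odot>\<^bsub>F\<^esub> z) \<ominus>\<^bsub>V\<^esub> (r \<otimes> a) \<odot>\<^bsub>V\<^esub> w z"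
          using w(1)[OF rz] w(1)[OF z] Ic[OF a] r V.smult_closed
          by (simp add: a_minus_def V.smult_r_distr V.smult_minus V.smult_assoc)
        ultimately show ?thesis by simp
      qed
    qed
    \<comment> \<open>\<open>h(v)\<close> and the element \<open>-h(v)\<close> of \<open>F p\<close> are values of formal sums that \<open>\<beta>\<close> sends to \<open>v\<close> and \<open>0\<close>
      modulo \<open>W\<close>.\<close>
    let ?T = "{v \<in> carrier V. \<exists>g\<in>carrier V. tensor_sum F I V ?\<beta> (h v) g \<and> g \<ominus>\<^bsub>V\<^esub> v \<in> W}"
    have "v \<in> ?T"
    proof (rule finite_sequences_generated[where I=I])
      show "v \<in> carrier (finite_sequences R)" using Lc[OF v(1)] unfolding V_def .
      show "v i \<in> I" for i by (rule v(2))
      show "\<zero> \<in> I" by (rule I0)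
      have "tensor_sum F I V ?\<beta> (\<zero> \<odot>\<^bsub>F\<^esub> \<zero>\<^bsub>F\<^esub>) (\<zero> \<odot>\<^bsub>V\<^esub> w \<zero>\<^bsub>F\<^esub>)"
        using I0 by (intro tensor_sum.pair) auto
      then have "tensor_sum F I V ?\<beta> (h \<zero>\<^bsub>V\<^esub>) \<zero>\<^bsub>V\<^esub>" using h_zero w(1) by simp
      then have "\<zero>\<^bsub>V\<^esub> \<in> ?T" using W0 by (auto simp: a_minus_def V.M.r_neg intro!: bexI[of _ "\<zero>\<^bsub>V\<^esub>"])
      then show "(\<lambda>i. \<zero>) \<in> ?T" unfolding V_def by simp
      show "x \<oplus>\<^bsub>finite_sequences R\<^esub> z \<in> ?T" if "x \<in> ?T" "z \<in> ?T" for x z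
      proof -
        obtain g g' where x: "x \<in> carrier V" "g \<in> carrier V" "tensor_sum F I V ?\<beta> (h x) g" "g \<ominus>\<^bsub>V\<^esub> x \<in> W"
          and z: "z \<in> carrier V" "g' \<in> carrier V" "tensor_sum F I V ?\<beta> (h z) g'" "g' \<ominus>\<^bsub>V\<^esub> z \<in> W"
          using \<open>x \<in> ?T\<close> \<open>z \<in> ?T\<close> by blast
        have "tensor_sum F I V ?\<beta> (h (x \<oplus>\<^bsub>V\<^esub> z)) (g \<oplus>\<^bsub>V\<^esub> g')"
          using tensor_sum.add[OF x(3) z(3)] hh(2)[OF x(1) z(1)] by simp
        moreover have "(g \<oplus>\<^bsub>V\<^esub> g') \<ominus>\<^bsub>V\<^esub> (x \<oplus>\<^bsub>V\<^esub> z) \<in> W"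
          using V.M.add_diff_add[OF x(2) z(2) x(1) z(1)] Wa[OF x(4) z(4)] by simp
        ultimately have "x \<oplus>\<^bsub>V\<^esub> z \<in> ?T" using x(1,2) z(1,2) by blast
        then show ?thesis unfolding V_def .
      qed
      show "unit_seq R i r \<in> ?T" if r: "r \<in> carrier R" "r \<in> I" for i r
      proof -
        have ts: "tensor_sum F I V ?\<beta> (h (unit_seq R i r)) (r \<odot>\<^bsub>V\<^esub> w (y i))"
          unfolding h_unit[OF r(1)] using y(1) r(2) by (rule tensor_sum.pair)
        have hy: "h (?e i) = y i" using h_unit[of \<one> i] y(1) F.smult_one by simp
        have "h (?e i \<ominus>\<^bsub>V\<^esub> w (y i)) \<in> ?P" using h_diff[OF e w(1)[OF y(1)]] hy w(2)[OF y(1)] by simp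
        then have "?e i \<ominus>\<^bsub>V\<^esub> w (y i) \<in> L" unfolding L_def using e w(1)[OF y(1)] by simp
        then have "\<ominus>\<^bsub>V\<^esub> (r \<odot>\<^bsub>V\<^esub> (?e i \<ominus>\<^bsub>V\<^esub> w (y i))) \<in> W" using LW r(2) Wn by blast
        moreover have "\<ominus>\<^bsub>V\<^esub> (r \<odot>\<^bsub>V\<^esub> (?e i \<ominus>\<^bsub>V\<^esub> w (y i))) = r \<odot>\<^bsub>V\<^esub> w (y i) \<ominus>\<^bsub>V\<^esub> unit_seq R i r"
          unfolding re[OF r(1)] using e w(1)[OF y(1)] r(1) V.smult_closed
          by (simp add: a_minus_def V.smult_r_distr V.smult_minus V.M.minus_add V.M.a_comm)
        ultimately have "r \<odot>\<^bsub>V\<^esub> w (y i) \<ominus>\<^bsub>V\<^esub> unit_seq R i r \<in> W" by simp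
        moreover have "unit_seq R i r \<in> carrier V" unfolding V_def using r(1) by simp
        moreover have "r \<odot>\<^bsub>V\<^esub> w (y i) \<in> carrier V" using w(1)[OF y(1)] r(1) V.smult_closed by simp
        ultimately show ?thesis using ts by blast
      qed
    qed
    then obtain g where g: "g \<in> carrier V" "tensor_sum F I V ?\<beta> (h v) g" "g \<ominus>\<^bsub>V\<^esub> v \<in> W" by blast
    have neg: "\<exists>g\<in>W. tensor_sum F I V ?\<beta> z g" if "z \<in> ?P" for z
      using that
    proof induction
      case (times z b)
      then have b: "b \<in> carrier R" using right_idealD(3)[OF rp] by blast
      have "b \<odot>\<^bsub>V\<^esub> w z \<in> sequences_in R p"
        using V.smult_closed[OF b w(1)[OF times(1)]] w(1)[OF times(1)] ideal.I_l_closed[OF p times(2)]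
        unfolding sequences_in_def V_def finite_sequences_carrier by simp
      moreover have "tensor_sum F I V ?\<beta> (b \<odot>\<^bsub>F\<^esub> z) (b \<odot>\<^bsub>V\<^esub> w z)"
        using times pI by (intro tensor_sum.pair) auto
      ultimately show ?case using pW by blast
    next
      case (add z z')
      then show ?case using tensor_sum.add[of F I V ?\<beta> z _ z'] Wa by blast
    qed
    have vc: "v \<in> carrier V" using Lc[OF v(1)] .
    have "\<zero>\<^bsub>F\<^esub> \<ominus>\<^bsub>F\<^esub> h v \<in> ?P" using v(1) Pd[OF P0] unfolding L_def by blast
    then have "\<ominus>\<^bsub>F\<^esub> h v \<in> ?P" using hh(1)[OF vc] by (simp add: a_minus_def)
    then obtain g' where g': "g' \<in> W" "tensor_sum F I V ?\<beta> (\<ominus>\<^bsub>F\<^esub> h v) g'" using neg by blast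
    have "tensor_sum F I V ?\<beta> \<zero>\<^bsub>F\<^esub> (g \<oplus>\<^bsub>V\<^esub> g')"
      using tensor_sum.add[OF g(2) g'(2)] hh(1)[OF vc] by (simp add: F.M.r_neg)
    then have "g \<oplus>\<^bsub>V\<^esub> g' \<in> W" by (rule zero)
    then have "(g \<oplus>\<^bsub>V\<^esub> g') \<ominus>\<^bsub>V\<^esub> g' \<in> W" using g'(1) by (rule Wd)
    then have gW: "g \<in> W" using g(1) Wc[OF g'(1)] by (simp add: a_minus_def V.M.a_assoc V.M.r_neg)
    have "g \<ominus>\<^bsub>V\<^esub> (g \<ominus>\<^bsub>V\<^esub> v) \<in> W" using gW g(3) by (rule Wd)
    moreover have "g \<ominus>\<^bsub>V\<^esub> (g \<ominus>\<^bsub>V\<^esub> v) = v"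
      using V.M.diff_diff_diff[of v g "\<zero>\<^bsub>V\<^esub>"] g(1) vc V.M.add.inv_one[folded a_inv_def] by (simp add: a_minus_def)
    ultimately show "v \<in> W" by simp
  qed
  have "flat_resolution R p Q L"
    unfolding flat_resolution_def V_def[symmetric]
  proof (intro conjI allI impI)
    fix S assume "submodule S R V \<and> L \<subseteq> S \<and> S <+>\<^bsub>V\<^esub> Q = carrier V"
    then show "S = carrier V" using small by blast
  next
    fix I W v
    assume *: "left_ideal R I \<and> p \<subseteq> I \<and> v \<in> L \<and> (\<forall>i. v i \<in> I) \<and> subgroup W (add_monoid V) \<and>
      sequences_in R p \<subseteq> W \<and> (\<forall>l\<in>L. \<forall>a\<in>I. a \<odot>\<^bsub>V\<^esub> l \<in> W)"
    show "v \<in> W" by (rule pure[of I v W]) (use * in auto)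
  qed (rule L pL LQ)+
  then show ?thesis by blast
qed

section \<open>Noetherian rings with flat delta-covers\<close>

text \<open>
  Modulo \<open>p\<close>, a right inverse \<open>u\<close> of \<open>1 - j\<close> is \<open>1 + j u\<close>, which has a right inverse for the same reason. Hence \<open>u\<close> is
  a unit and \<open>1 - j\<close> is its inverse.
\<close>

lemma (in critical_ideal) left_inverse_mod:
  assumes j: "j \<in> radical_over p"
  obtains u where "u \<in> carrier R" "u \<otimes> (\<one> \<ominus> j) \<ominus> \<one> \<in> p"
proof -
  have J: "right_ideal R (radical_over p)"
    using ideal_right_ideal ideal_radical_over(1)[OF ideal_p] by blast
  have zero: "p +> x = \<zero>\<^bsub>R Quot p\<^esub>" if "x \<in> p" for x
  proof -
    have "\<zero>\<^bsub>R Quot p\<^esub> = p" unfolding FactRing_def by (rule ring.simps)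
    then show ?thesis using a_rcos_zero[OF ideal_p that] by (rule trans[rotated, OF sym])
  qed
  interpret p: ideal p R by (rule ideal_p)
  interpret Q: ring "R Quot p" by (rule p.quotient_is_ring)
  interpret \<pi>: ring_hom_ring R "R Quot p" "(+>) p" by (rule p.rcos_ring_hom_ring)
  have jc: "j \<in> carrier R" using right_idealD(3)[OF J j] .
  obtain u q where u: "u \<in> carrier R" "q \<in> p" "\<one> = q \<oplus> (\<one> \<ominus> j) \<otimes> u"
    using right_ideal_right_inverse[OF right_ideal_p j] by blast
  let ?k = "\<ominus> (j \<otimes> u)"
  have kJ: "?k \<in> radical_over p" using right_idealD(5,6)[OF J] j u(1) by blast
  obtain u' q' where u': "u' \<in> carrier R" "q' \<in> p" "\<one> = q' \<oplus> (\<one> \<ominus> ?k) \<otimes> u'"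
    using right_ideal_right_inverse[OF right_ideal_p kJ] by blast
  have qc: "q \<in> carrier R" "q' \<in> carrier R" using u(2) u'(2) p_carrier by auto
  have "p +> \<one> = p +> (q \<oplus> (\<one> \<ominus> j) \<otimes> u)" using u(3) by simp
  also have "\<dots> = (p +> (\<one> \<ominus> j)) \<otimes>\<^bsub>R Quot p\<^esub> (p +> u)"
    using qc jc u(1) zero[OF u(2)] by simp
  finally have cu: "(p +> (\<one> \<ominus> j)) \<otimes>\<^bsub>R Quot p\<^esub> (p +> u) = \<one>\<^bsub>R Quot p\<^esub>" by simp
  have "u = q \<oplus> (\<one> \<ominus> j) \<otimes> u \<ominus> ?k \<ominus> q"
  proof -
    have "(\<one> \<ominus> j) \<otimes> u \<ominus> ?k = u"
      using jc u(1) by (simp add: minus_eq l_distr l_minus a_assoc l_neg)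
    moreover have "q \<oplus> (\<one> \<ominus> j) \<otimes> u \<ominus> ?k \<ominus> q = ((\<one> \<ominus> j) \<otimes> u \<ominus> ?k) \<oplus> (q \<ominus> q)"
      using jc u(1) qc(1) by (simp add: minus_eq a_ac)
    ultimately show ?thesis using u(1) qc(1) by (simp add: minus_eq r_neg)
  qed
  then have uq: "u = (\<one> \<ominus> ?k) \<ominus> q" using u(3) by simp
  have "p +> u = p +> (\<one> \<ominus> ?k)"
    by (subst uq) (use jc u(1) qc(1) zero[OF u(2)] in \<open>simp add: minus_eq\<close>)
  moreover have "p +> \<one> = p +> (q' \<oplus> (\<one> \<ominus> ?k) \<otimes> u')" using u'(3) by simp
  ultimately have uu': "(p +> u) \<otimes>\<^bsub>R Quot p\<^esub> (p +> u') = \<one>\<^bsub>R Quot p\<^esub>"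
    using qc jc u(1) u'(1) zero[OF u'(2)] by simp
  have "p +> (\<one> \<ominus> j) = p +> u'"
    using Q.inv_unique[OF cu uu'] jc u(1) u'(1) by simp
  then have "p +> (u \<otimes> (\<one> \<ominus> j)) = p +> \<one>" using uu' u(1) jc by simp
  then have "u \<otimes> (\<one> \<ominus> j) \<ominus> \<one> \<in> p"
    using u(1) jc quotient_eq_iff_same_a_r_cos[OF ideal_p] by simp
  then show thesis using that u(1) by blast
qed

text \<open>\<open>left_span R p T v n\<close> is \<open>p + T v\<^sub>0 + \<dots> + T v\<^bsub>n-1\<^esub>\<close>.\<close>

primrec left_span :: "('a, 'r) ring_scheme \<Rightarrow> 'a set \<Rightarrow> 'a set \<Rightarrow> (nat \<Rightarrow> 'a) \<Rightarrow> nat \<Rightarrow> 'a set" where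
  "left_span R p T v 0 = p"
| "left_span R p T v (Suc n) = {g \<oplus>\<^bsub>R\<^esub> t \<otimes>\<^bsub>R\<^esub> v n | g t. g \<in> left_span R p T v n \<and> t \<in> T}"

context critical_ideal
begin

lemma left_span_left_ideal:
  assumes T: "ideal T R" and v: "\<And>i. v i \<in> carrier R"
  shows "left_ideal R (left_span R p T v n)" "p \<subseteq> left_span R p T v n"
proof -
  have Tc: "t \<in> carrier R" if "t \<in> T" for t using ideal.Icarr[OF T that] .
  have T0: "\<zero> \<in> T" and Ta: "t \<in> T \<Longrightarrow> t' \<in> T \<Longrightarrow> t \<oplus> t' \<in> T" for t t'
    using right_idealD(2,4)[OF ideal_right_ideal[OF T]] by auto
  have "left_ideal R (left_span R p T v n) \<and> p \<subseteq> left_span R p T v n"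
  proof (induction n)
    case 0
    show ?case
      using right_idealD[OF right_ideal_p] ideal.I_l_closed[OF ideal_p] by (simp add: left_ideal_def)
  next
    case (Suc n)
    let ?G = "left_span R p T v n"
    have G: "g \<in> carrier R" "\<zero> \<in> ?G" "g \<in> ?G \<Longrightarrow> g' \<in> ?G \<Longrightarrow> g \<oplus> g' \<in> ?G"
      "g \<in> ?G \<Longrightarrow> r \<in> carrier R \<Longrightarrow> r \<otimes> g \<in> ?G" if "g \<in> ?G" for g g' r
      using Suc that unfolding left_ideal_def by auto
    have G0: "\<zero> \<in> ?G" using Suc unfolding left_ideal_def by blast
    have mem: "g \<oplus> t \<otimes> v n \<in> left_span R p T v (Suc n)" if "g \<in> ?G" "t \<in> T" for g t
      using that by auto
    have sub: "g \<in> left_span R p T v (Suc n)" if "g \<in> ?G" for g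
      using mem[OF that T0] G(1)[OF that] v by simp
    have "x \<oplus> x' \<in> left_span R p T v (Suc n)"
      if x: "x \<in> left_span R p T v (Suc n)" "x' \<in> left_span R p T v (Suc n)" for x x'
    proof -
      obtain g t g' t' where gt: "g \<in> ?G" "t \<in> T" "x = g \<oplus> t \<otimes> v n" "g' \<in> ?G" "t' \<in> T" "x' = g' \<oplus> t' \<otimes> v n"
        using x by auto
      have "x \<oplus> x' = (g \<oplus> g') \<oplus> (t \<oplus> t') \<otimes> v n"
        using gt G(1) Tc v by (simp add: l_distr a_ac)
      then show ?thesis using mem[of "g \<oplus> g'" "t \<oplus> t'"] G(3)[OF gt(1,1,4)] Ta[OF gt(2,5)] by simp
    qed
    moreover have "r \<otimes> x \<in> left_span R p T v (Suc n)"
      if x: "x \<in> left_span R p T v (Suc n)" and r: "r \<in> carrier R" for x r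
    proof -
      obtain g t where gt: "g \<in> ?G" "t \<in> T" "x = g \<oplus> t \<otimes> v n" using x by auto
      have "r \<otimes> x = r \<otimes> g \<oplus> (r \<otimes> t) \<otimes> v n"
        using gt G(1) Tc v r by (simp add: r_distr m_assoc)
      then show ?thesis using mem[of "r \<otimes> g" "r \<otimes> t"] G(4)[OF gt(1,1) r] ideal.I_l_closed[OF T gt(2) r] by simp
    qed
    moreover have "left_span R p T v (Suc n) \<subseteq> carrier R" using G(1) Tc v by auto
    ultimately show ?case using sub G0 Suc unfolding left_ideal_def by blast
  qed
  then show "left_ideal R (left_span R p T v n)" "p \<subseteq> left_span R p T v n" by auto
qed

lemma left_span_mem:
  assumes v: "\<And>i. v i \<in> carrier R" and "i < n"
  shows "v i \<in> left_span R p (carrier R) v n"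
  using assms(2)
proof (induction n)
  case (Suc n)
  have G: "\<zero> \<in> left_span R p (carrier R) v n"
    using left_span_left_ideal(1)[where v=v, OF oneideal v, of n] unfolding left_ideal_def by blast
  show ?case
  proof (cases "i = n")
    case True
    have "v i = \<zero> \<oplus> \<one> \<otimes> v n" using True v by simp
    then show ?thesis using G one_closed unfolding left_span.simps by blast
  next
    case False
    then have "v i \<in> left_span R p (carrier R) v n" using Suc by simp
    moreover have "v i = v i \<oplus> \<zero> \<otimes> v n" using v by simp
    ultimately show ?thesis using zero_closed unfolding left_span.simps by blast
  qed
qed simp

lemma left_span_prod:
  assumes T: "ideal T R" and v: "\<And>i. v i \<in> carrier R"
    and "t \<in> T" "g \<in> left_span R p (carrier R) v n"
  shows "t \<otimes> g \<in> left_span R p T v n"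
  using assms(4)
proof (induction n arbitrary: g)
  case 0
  then show ?case using ideal.I_l_closed[OF ideal_p] ideal.Icarr[OF T assms(3)] by simp
next
  case (Suc n)
  then obtain g' r where g: "g' \<in> left_span R p (carrier R) v n" "r \<in> carrier R" "g = g' \<oplus> r \<otimes> v n" by auto
  have gc: "g' \<in> carrier R"
    using g(1) left_span_left_ideal(1)[where v=v, OF oneideal v, of n] unfolding left_ideal_def by blast
  have "t \<otimes> g = t \<otimes> g' \<oplus> (t \<otimes> r) \<otimes> v n"
    using g gc v ideal.Icarr[OF T assms(3)] by (simp add: r_distr m_assoc)
  then show ?case using Suc.IH[OF g(1)] ideal.I_r_closed[OF T assms(3) g(2)] by auto
qed

lemma left_span_subset_p:
  assumes T: "ideal T R" and "\<And>i. i < n \<Longrightarrow> v i \<in> p"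
  shows "left_span R p T v n \<subseteq> p"
  using assms(2)
proof (induction n)
  case (Suc n)
  then have "left_span R p T v n \<subseteq> p" by simp
  then show ?case
    using Suc.prems[of n] right_idealD(4)[OF right_ideal_p] ideal.I_l_closed[OF ideal_p] ideal.Icarr[OF T] by auto
qed simp

text \<open>
  Nakayama's lemma: if all \<open>v\<^sub>i\<close> lie in \<open>p + J v\<^sub>0 + \<dots> + J v\<^bsub>n-1\<^esub>\<close>, the last generator can be eliminated, because
  \<open>(1 - j) v\<^bsub>n-1\<^esub>\<close> lies in the span of the others for some \<open>j \<in> J\<close>.
\<close>

lemma nakayama_left_span:
  assumes v: "\<And>i. v i \<in> carrier R" and "\<And>i. i < n \<Longrightarrow> v i \<in> left_span R p (radical_over p) v n" "i < n"
  shows "v i \<in> p"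
  using assms(2,3)
proof (induction n arbitrary: i)
  case (Suc n)
  let ?J = "radical_over p"
  have J: "ideal ?J R" by (rule ideal_radical_over(1)[OF ideal_p])
  let ?H = "left_span R p ?J v n"
  have H: "left_ideal R ?H" "p \<subseteq> ?H" using left_span_left_ideal[where v=v, OF J v, of n] by auto
  have Hc: "g \<in> carrier R" if "g \<in> ?H" for g using H that unfolding left_ideal_def by blast
  have Hm: "r \<otimes> g \<in> ?H" if "g \<in> ?H" "r \<in> carrier R" for g r using H that unfolding left_ideal_def by blast
  have Ha: "g \<oplus> g' \<in> ?H" if "g \<in> ?H" "g' \<in> ?H" for g g' using H that unfolding left_ideal_def by blast
  have "v n \<in> left_span R p ?J v (Suc n)" using Suc.prems(1)[of n] by simp
  then obtain g j where g: "g \<in> ?H" "j \<in> ?J" "v n = g \<oplus> j \<otimes> v n" by auto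
  have jc: "j \<in> carrier R" using ideal.Icarr[OF J g(2)] .
  obtain u where u: "u \<in> carrier R" "u \<otimes> (\<one> \<ominus> j) \<ominus> \<one> \<in> p" by (rule left_inverse_mod[OF g(2)])
  let ?q = "u \<otimes> (\<one> \<ominus> j) \<ominus> \<one>"
  have qc: "?q \<in> carrier R" using u jc by simp
  have "(\<one> \<ominus> j) \<otimes> v n = v n \<ominus> j \<otimes> v n" using jc v by (simp add: minus_eq l_distr l_minus)
  also have "\<dots> = g \<oplus> j \<otimes> v n \<ominus> j \<otimes> v n" using g(3) by simp
  also have "\<dots> = g" using Hc[OF g(1)] jc v by (simp add: minus_eq a_assoc r_neg)
  finally have g': "(\<one> \<ominus> j) \<otimes> v n = g" .
  have "?q \<otimes> v n = u \<otimes> ((\<one> \<ominus> j) \<otimes> v n) \<ominus> v n"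
    using u(1) jc v by (simp add: minus_eq l_distr l_minus m_assoc)
  then have q: "?q \<otimes> v n = u \<otimes> g \<ominus> v n" unfolding g' .
  have "?q \<otimes> v n \<in> p" using ideal.I_r_closed[OF ideal_p u(2)] v by simp
  then have "u \<otimes> g \<ominus> v n \<in> p" unfolding q .
  then have "\<ominus> (u \<otimes> g \<ominus> v n) \<in> ?H" using H(2) right_idealD(6)[OF right_ideal_p] by blast
  then have "u \<otimes> g \<oplus> \<ominus> (u \<otimes> g \<ominus> v n) \<in> ?H" using Ha Hm[OF g(1) u(1)] by blast
  moreover have "u \<otimes> g \<oplus> \<ominus> (u \<otimes> g \<ominus> v n) = v n"
    using u(1) Hc[OF g(1)] v by (simp add: minus_eq minus_add a_assoc[symmetric] r_neg)
  ultimately have vn: "v n \<in> ?H" by simp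
  have sub: "left_span R p ?J v (Suc n) \<subseteq> ?H"
    using Ha Hm[OF vn] ideal.Icarr[OF J] by auto
  have vi: "v k \<in> p" if "k < n" for k
    using Suc.IH[of k] Suc.prems(1) sub that by (meson less_SucI subsetD)
  then have "v n \<in> p" using left_span_subset_p[OF J, of n v] vn by blast
  then show ?case using vi Suc.prems(2) by (metis less_SucE)
qed simp

end

locale critical_ideal_with_resolutions = critical_ideal +
  assumes resolution: "\<And>Q. submodule Q R (finite_sequences R) \<Longrightarrow> sequences_in R p \<subseteq> Q \<Longrightarrow> \<exists>L. flat_resolution R p Q L"
begin

abbreviation V where "V \<equiv> finite_sequences R"

lemma subgroup_sequences:
  assumes T: "T \<subseteq> carrier V" "(\<lambda>i. \<zero>) \<in> T" "\<And>x y. x \<in> T \<Longrightarrow> y \<in> T \<Longrightarrow> (\<lambda>i. x i \<ominus> y i) \<in> T"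
  shows "subgroup T (add_monoid V)"
proof -
  interpret V: right_module R V by (rule right_module_finite_sequences)
  have Tc: "x i \<in> carrier R" if "x \<in> T" for x i
    using subsetD[OF T(1) that] unfolding finite_sequences_carrier by blast
  have neg: "(\<lambda>i. \<ominus> x i) \<in> T" if "x \<in> T" for x
    using T(3)[OF T(2) that] Tc[OF that] by (simp add: minus_eq)
  have inv: "\<ominus>\<^bsub>V\<^esub> x = (\<lambda>i. \<ominus> x i)" if "x \<in> T" for x
  proof -
    have "(\<lambda>i. \<ominus> x i) \<oplus>\<^bsub>V\<^esub> x = \<zero>\<^bsub>V\<^esub>" using Tc[OF that] by (simp add: l_neg)
    then show ?thesis using V.M.minus_equality[of "\<lambda>i. \<ominus> x i" x] neg[OF that] that T(1) by blast
  qed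
  have add: "(\<lambda>i. x i \<oplus> y i) \<in> T" if "x \<in> T" "y \<in> T" for x y
    using T(3)[OF that(1) neg[OF that(2)]] Tc[OF that(2)] by (simp add: minus_eq)
  show ?thesis
  proof (rule subgroup.intro)
    show "T \<subseteq> carrier (add_monoid V)" "\<one>\<^bsub>add_monoid V\<^esub> \<in> T" using T(1,2) by simp_all
    show "x \<otimes>\<^bsub>add_monoid V\<^esub> y \<in> T" if "x \<in> T" "y \<in> T" for x y using add[OF that] by simp
    show "inv\<^bsub>add_monoid V\<^esub> x \<in> T" if "x \<in> T" for x
    proof -
      have "inv\<^bsub>add_monoid V\<^esub> x = (\<lambda>i. \<ominus> x i)" using inv[OF that] by (simp only: a_inv_def[of V])
      with neg[OF that] show ?thesis by (simp only:)
    qed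
  qed
qed

text \<open>
  The entries of \<open>v \<in> L\<close> generate, together with \<open>p\<close>, a left ideal \<open>G\<close>. By purity they lie in \<open>J G + p\<close>, and Nakayama's
  lemma puts them into \<open>p\<close>.
\<close>

lemma radical_resolution:
  assumes L: "flat_resolution R p (sequences_in R (radical_over p)) L"
  shows "L = sequences_in R p"
proof
  let ?J = "radical_over p"
  have J: "ideal ?J R" "p \<subseteq> ?J" using ideal_radical_over[OF ideal_p] by auto
  show "sequences_in R p \<subseteq> L" using L by (rule flat_resolutionD(2))
  show "L \<subseteq> sequences_in R p"
  proof
    fix v assume vL: "v \<in> L"
    have LJ: "L \<subseteq> sequences_in R ?J" using L by (rule flat_resolutionD(3))
    then have vV: "v \<in> carrier V" using vL unfolding sequences_in_def by blast
    then have v: "v i \<in> carrier R" for i unfolding finite_sequences_carrier by blast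
    obtain n where n: "\<forall>i\<ge>n. v i = \<zero>" using vV unfolding finite_sequences_carrier by blast
    let ?G = "left_span R p (carrier R) v n" and ?H = "left_span R p ?J v n"
    have G: "left_ideal R ?G" "p \<subseteq> ?G" using left_span_left_ideal[where v=v, OF oneideal v, of n] by auto
    have H: "left_ideal R ?H" "p \<subseteq> ?H" using left_span_left_ideal[where v=v, OF J(1) v, of n] by auto
    have Hd: "x \<ominus> y \<in> ?H" if "x \<in> ?H" "y \<in> ?H" for x y
    proof -
      have "y \<in> carrier R" using H(1) that unfolding left_ideal_def by blast
      then have "\<ominus> y = (\<ominus> \<one>) \<otimes> y" by (simp add: l_minus)
      then have "\<ominus> y \<in> ?H" using H(1) that unfolding left_ideal_def by (metis add.inv_closed one_closed)
      then show ?thesis using H(1) that unfolding left_ideal_def a_minus_def by blast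
    qed
    have H0: "\<zero> \<in> ?H" using H(1) unfolding left_ideal_def by blast
    let ?W = "{u \<in> carrier V. \<forall>i. u i \<in> ?H}"
    interpret V: right_module R V by (rule right_module_finite_sequences)
    have "subgroup ?W (add_monoid V)"
      by (rule subgroup_sequences) (use finite_sequences_diff Hd H0 V.M.zero_closed in auto)
    moreover have "sequences_in R p \<subseteq> ?W" using H(2) unfolding sequences_in_def by blast
    moreover have "a \<odot>\<^bsub>V\<^esub> l \<in> ?W" if l: "l \<in> L" and a: "a \<in> ?G" for l a
    proof -
      have "a \<in> carrier R" using a G(1) unfolding left_ideal_def by blast
      then have "a \<odot>\<^bsub>V\<^esub> l \<in> carrier V" using V.smult_closed l LJ unfolding sequences_in_def by blast
      moreover have "l i \<otimes> a \<in> ?H" for i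
        using left_span_prod[OF J(1) v _ a] l LJ unfolding sequences_in_def by blast
      ultimately show ?thesis by simp
    qed
    moreover have "v i \<in> ?G" for i
      using left_span_mem[OF v, of i n] n G(1) unfolding left_ideal_def by (cases "i < n") auto
    ultimately have "v \<in> ?W" using flat_resolutionD(5)[OF L G vL, of ?W] by blast
    then have "v i \<in> p" if "i < n" for i
      using nakayama_left_span[where v=v and n=n, OF v _ that] by blast
    then have "v i \<in> p" for i using n right_idealD(2)[OF right_ideal_p] by (metis not_le)
    then show "v \<in> sequences_in R p" using vV unfolding sequences_in_def by blast
  qed
qed

text \<open>The combination \<open>\<Sum>\<^bsub>i<n\<^esub> a\<^bsub>n-1\<^esub> \<dots> a\<^sub>i v\<^sub>i\<close>.\<close>

primrec weighted_sum :: "(nat \<Rightarrow> 'a) \<Rightarrow> (nat \<Rightarrow> 'a) \<Rightarrow> nat \<Rightarrow> 'a" where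
  "weighted_sum a v 0 = \<zero>"
| "weighted_sum a v (Suc n) = a n \<otimes> (weighted_sum a v n \<oplus> v n)"

text \<open>
  Otherwise primeness of \<open>p\<close> gives elements \<open>a\<^sub>n\<close> of the radical \<open>J\<close> such that no product \<open>a\<^sub>n \<dots> a\<^sub>0\<close> lies in
  \<open>p\<close>. Let \<open>S\<close> be the kernel of the map from \<open>V\<close> to the direct limit of copies of \<open>R / p\<close> along the left
  multiplications by the \<open>a\<^sub>n\<close>. Modulo \<open>S\<close> each basis vector \<open>e\<^sub>i\<close> equals \<open>e\<^bsub>i+1\<^esub> a\<^sub>i\<close>, so \<open>S\<close> together with the sequences
  over \<open>J\<close> spans \<open>V\<close>. By smallness \<open>S = V\<close>, although \<open>e\<^sub>0\<close> does not vanish in the limit.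
\<close>

lemma radical_subset: "radical_over p \<subseteq> p"
proof (rule ccontr)
  let ?J = "radical_over p"
  have J: "ideal ?J R" "p \<subseteq> ?J" using ideal_radical_over[OF ideal_p] by auto
  note Jr = ideal_right_ideal[OF J(1)]
  assume "\<not> ?J \<subseteq> p"
  then have pJ: "p \<subset> ?J" using J(2) by blast
  have "\<exists>a. a \<in> ?J \<and> a \<otimes> c \<notin> p" if "c \<in> carrier R" "c \<notin> p" for c
    using prime_step[OF J(1) pJ that] by (auto simp: Bex_def)
  then obtain A where A: "\<And>c. c \<in> carrier R \<Longrightarrow> c \<notin> p \<Longrightarrow> A c \<in> ?J \<and> A c \<otimes> c \<notin> p" by metis
  define c where "c = rec_nat \<one> (\<lambda>n c. A c \<otimes> c)"
  define a where "a n = A (c n)" for n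
  have c_simps: "c 0 = \<one>" "c (Suc n) = a n \<otimes> c n" for n unfolding c_def a_def by simp_all
  have c: "c n \<in> carrier R \<and> c n \<notin> p" for n
  proof (induction n)
    case 0
    show ?case using p_proper by (simp add: c_simps)
  next
    case (Suc n)
    then have "A (c n) \<in> carrier R" using A right_idealD(3)[OF Jr] by blast
    then show ?case using Suc A by (simp add: c_simps a_def)
  qed
  have aJ: "a n \<in> ?J" for n unfolding a_def using A c by blast
  have ac: "a n \<in> carrier R" for n using right_idealD(3)[OF Jr aJ] .
  interpret V: right_module R V by (rule right_module_finite_sequences)
  have Vc: "v i \<in> carrier R" if "v \<in> carrier V" for v i using that unfolding finite_sequences_carrier by blast
  let ?s = "weighted_sum a"
  have s_closed: "?s v n \<in> carrier R" if "v \<in> carrier V" for v n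
    by (induction n) (use ac Vc[OF that] in auto)
  have s_add: "?s (v \<oplus>\<^bsub>V\<^esub> w) n = ?s v n \<oplus> ?s w n" if "v \<in> carrier V" "w \<in> carrier V" for v w n
    by (induction n)
       (use ac Vc[OF that(1)] Vc[OF that(2)] s_closed[OF that(1)] s_closed[OF that(2)] in \<open>auto simp: r_distr a_ac\<close>)
  have s_smult: "?s (r \<odot>\<^bsub>V\<^esub> v) n = ?s v n \<otimes> r" if "v \<in> carrier V" "r \<in> carrier R" for v r n
    by (induction n) (use ac Vc[OF that(1)] s_closed[OF that(1)] that(2) in \<open>auto simp: l_distr m_assoc\<close>)
  have s_p: "?s v n \<in> p" if "v \<in> sequences_in R p" for v n
    by (induction n)
       (use that right_idealD[OF right_ideal_p] ideal.I_l_closed[OF ideal_p] ac in \<open>auto simp: sequences_in_def\<close>)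
  let ?S = "{v \<in> carrier V. \<exists>n. \<forall>m\<ge>n. ?s v m \<in> p}"
  have S: "submodule ?S R V" unfolding V.submodule_iff
  proof (intro conjI ballI)
    have "\<zero>\<^bsub>V\<^esub> \<in> sequences_in R p"
      using submodule_sequences_in[OF right_ideal_p] unfolding V.submodule_iff by blast
    then show "\<zero>\<^bsub>V\<^esub> \<in> ?S" using s_p V.M.zero_closed by blast
    show "x \<oplus>\<^bsub>V\<^esub> y \<in> ?S" if xy: "x \<in> ?S" "y \<in> ?S" for x y
    proof -
      obtain k m where "\<forall>i\<ge>k. ?s x i \<in> p" "\<forall>i\<ge>m. ?s y i \<in> p" using xy by blast
      then have "\<forall>i\<ge>max k m. ?s (x \<oplus>\<^bsub>V\<^esub> y) i \<in> p"
        using s_add xy right_idealD(4)[OF right_ideal_p] by simp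
      then show ?thesis using V.M.add.m_closed xy by blast
    qed
    show "r \<odot>\<^bsub>V\<^esub> x \<in> ?S" if rx: "r \<in> carrier R" "x \<in> ?S" for r x
    proof -
      obtain k where "\<forall>i\<ge>k. ?s x i \<in> p" using rx by blast
      then have "\<forall>i\<ge>k. ?s (r \<odot>\<^bsub>V\<^esub> x) i \<in> p"
        using s_smult rx right_idealD(5)[OF right_ideal_p] by simp
      then show ?thesis using V.smult_closed rx by blast
    qed
  qed blast
  let ?Q = "sequences_in R ?J"
  have Q: "submodule ?Q R V" by (rule submodule_sequences_in[OF Jr])
  have "sequences_in R p \<subseteq> ?Q" using J(2) unfolding sequences_in_def by blast
  then obtain L where L: "flat_resolution R p ?Q L" using resolution[OF Q] by blast
  have "L \<subseteq> ?S" unfolding radical_resolution[OF L] using s_p unfolding sequences_in_def by blast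
  moreover have "?S <+>\<^bsub>V\<^esub> ?Q = carrier V"
  proof
    show "?S <+>\<^bsub>V\<^esub> ?Q \<subseteq> carrier V" using V.submodule_sum(1)[OF S Q] unfolding V.submodule_iff by blast
    show "carrier V \<subseteq> ?S <+>\<^bsub>V\<^esub> ?Q"
    proof
      fix v assume v: "v \<in> carrier V"
      \<comment> \<open>\<open>w\<close> replaces each \<open>e\<^sub>i v\<^sub>i\<close> by \<open>e\<^bsub>i+1\<^esub> a\<^sub>i v\<^sub>i\<close>.\<close>
      define w where "w i = (case i of 0 \<Rightarrow> \<zero> | Suc k \<Rightarrow> a k \<otimes> v k)" for i
      obtain n where n: "\<forall>i\<ge>n. v i = \<zero>" using v unfolding finite_sequences_carrier by blast
      have wc: "w i \<in> carrier R" for i unfolding w_def using ac Vc[OF v] by (simp split: nat.split)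
      have w0: "\<forall>i\<ge>Suc n. w i = \<zero>" unfolding w_def using n ac by (auto split: nat.split)
      have wV: "w \<in> carrier V" unfolding finite_sequences_carrier using wc w0 by blast
      have "w i \<in> ?J" for i
        unfolding w_def using right_idealD(2,5)[OF Jr] aJ Vc[OF v] by (simp split: nat.split)
      then have wQ: "w \<in> ?Q" unfolding sequences_in_def using wV by blast
      define u where "u i = v i \<ominus> w i" for i
      have "\<forall>i\<ge>Suc n. u i = \<zero>" unfolding u_def using n w0 by (simp add: minus_eq)
      then have uV: "u \<in> carrier V" unfolding finite_sequences_carrier u_def using wc Vc[OF v] by blast
      have "?s u m = w m" for m
      proof (induction m)
        case (Suc m)
        have "w m \<oplus> u m = v m" unfolding u_def using wc Vc[OF v] diff_add_cancel by simp
        then show ?case using Suc by (simp add: w_def)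
      qed (simp add: w_def)
      then have "\<forall>m\<ge>Suc n. ?s u m \<in> p" using w0 right_idealD(2)[OF right_ideal_p] by simp
      then have "u \<in> ?S" using uV by blast
      moreover have "v = u \<oplus>\<^bsub>V\<^esub> w"
        unfolding u_def using wc Vc[OF v] by (auto simp: minus_eq a_assoc l_neg)
      ultimately show "v \<in> ?S <+>\<^bsub>V\<^esub> ?Q" unfolding mem_set_add using wQ by blast
    qed
  qed
  ultimately have "?S = carrier V" by (rule flat_resolutionD(4)[OF L S])
  then have "unit_seq R 0 \<one> \<in> ?S" by simp
  then obtain n where n: "\<forall>m\<ge>n. ?s (unit_seq R 0 \<one>) m \<in> p" by blast
  have "?s (unit_seq R 0 \<one>) (Suc m) = c (Suc m)" for m
  proof (induction m)
    case 0
    show ?case using ac by (simp add: c_simps unit_seq_def)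
  next
    case (Suc m)
    have "?s (unit_seq R 0 \<one>) (Suc (Suc m)) = a (Suc m) \<otimes> (?s (unit_seq R 0 \<one>) (Suc m) \<oplus> unit_seq R 0 \<one> (Suc m))"
      by simp
    also have "\<dots> = a (Suc m) \<otimes> c (Suc m)" unfolding Suc using c[of "Suc m"] by (simp add: unit_seq_def)
    finally show ?case by (simp add: c_simps)
  qed
  then have "c (Suc n) \<in> p" using n by (metis le_SucI order_refl)
  then show False using c by blast
qed

text \<open>
  Apply the resolution to \<open>R / I\<close> for a maximal right ideal \<open>I\<close> above \<open>p\<close>. Purity says that each \<open>l\<close> in the right ideal
  \<open>L0\<close> of first entries satisfies \<open>l \<equiv> e l\<close> modulo \<open>p\<close> for some \<open>e \<in> L0\<close>. As \<open>R\<close> is Noetherian, one \<open>e\<close> serves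
  all \<open>l\<close>, so \<open>R / p\<close> is the direct sum of \<open>L0 / p\<close> and \<open>W / p\<close>, where \<open>W\<close> consists of the elements that \<open>e\<close>
  multiplies into \<open>p\<close>. Since \<open>I / L0\<close> is small in \<open>R / L0\<close>, the intersection \<open>I \<inter> W\<close> lies in every maximal right
  ideal above \<open>p\<close>, hence in \<open>p\<close>. So \<open>W / p\<close> is a minimal right ideal of \<open>R / p\<close>, but there is none.
\<close>

lemma resolutions_impossible: False
proof -
  interpret V: right_module R V by (rule right_module_finite_sequences)
  have Vc: "v i \<in> carrier R" if "v \<in> carrier V" for v i using that unfolding finite_sequences_carrier by blast
  note pr = right_idealD[OF right_ideal_p]
  have "p \<noteq> carrier R" using p_proper by auto
  then obtain I where I: "maximal_right_ideal I" "p \<subseteq> I" using maximal_right_ideal_ex[OF right_ideal_p] by blast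
  then have rI: "right_ideal R I" and I_proper: "I \<noteq> carrier R" unfolding maximal_right_ideal_def by auto
  note Ir = right_idealD[OF rI]
  \<comment> \<open>Modulo \<open>Q\<close>, the coordinate \<open>0\<close> gives \<open>R / I\<close>; the others give copies of \<open>R / p\<close>.\<close>
  let ?Q = "{v \<in> carrier V. v 0 \<in> I \<and> (\<forall>i>0. v i \<in> p)}"
  have Q: "submodule ?Q R V"
    unfolding V.submodule_iff
  proof (intro conjI ballI)
    show "\<zero>\<^bsub>V\<^esub> \<in> ?Q" using V.M.zero_closed Ir(2) pr(2) by simp
    show "x \<oplus>\<^bsub>V\<^esub> y \<in> ?Q" if "x \<in> ?Q" "y \<in> ?Q" for x y
      using that V.M.add.m_closed[of x y] Ir(4) pr(4) by simp
    show "r \<odot>\<^bsub>V\<^esub> x \<in> ?Q" if "r \<in> carrier R" "x \<in> ?Q" for r x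
      using that V.smult_closed[of r x] Ir(5) pr(5) by simp
  qed blast
  have "sequences_in R p \<subseteq> ?Q" using I(2) unfolding sequences_in_def by blast
  then obtain L where L: "flat_resolution R p ?Q L" using resolution[OF Q] by blast
  note sL = flat_resolutionD(1)[OF L] and pL = flat_resolutionD(2)[OF L] and LQ = flat_resolutionD(3)[OF L]
  define L0 where "L0 = (\<lambda>v. v 0) ` L"
  have Lc: "v \<in> carrier V" if "v \<in> L" for v using LQ that by blast
  have rL0: "right_ideal R L0"
    unfolding right_ideal_iff
  proof (intro conjI ballI)
    show "L0 \<subseteq> carrier R" unfolding L0_def using Vc Lc by blast
    have "\<zero>\<^bsub>V\<^esub> \<in> L" using sL unfolding V.submodule_iff by blast
    then show "\<zero> \<in> L0" unfolding L0_def by (intro image_eqI[of _ _ "\<zero>\<^bsub>V\<^esub>"]) simp_all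
    show "x \<oplus> y \<in> L0" if "x \<in> L0" "y \<in> L0" for x y
    proof -
      obtain v w where vw: "v \<in> L" "w \<in> L" "x = v 0" "y = w 0" using \<open>x \<in> L0\<close> \<open>y \<in> L0\<close> unfolding L0_def by blast
      then have "v \<oplus>\<^bsub>V\<^esub> w \<in> L" using sL unfolding V.submodule_iff by blast
      then show ?thesis unfolding L0_def vw by (intro image_eqI[of _ _ "v \<oplus>\<^bsub>V\<^esub> w"]) simp_all
    qed
    show "x \<otimes> r \<in> L0" if "r \<in> carrier R" "x \<in> L0" for r x
    proof -
      obtain v where v: "v \<in> L" "x = v 0" using \<open>x \<in> L0\<close> unfolding L0_def by blast
      then have "r \<odot>\<^bsub>V\<^esub> v \<in> L" using sL that(1) unfolding V.submodule_iff by blast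
      then show ?thesis unfolding L0_def v by (intro image_eqI[of _ _ "r \<odot>\<^bsub>V\<^esub> v"]) simp_all
    qed
  qed
  note L0r = right_idealD[OF rL0]
  have L0I: "L0 \<subseteq> I" unfolding L0_def using LQ by blast
  have unitL: "unit_seq R 0 l \<in> L" if l: "l \<in> L0" for l
  proof -
    obtain v where v: "v \<in> L" "l = v 0" using l unfolding L0_def by blast
    have vV: "v \<in> carrier V" using Lc v(1) .
    obtain n where n: "\<forall>i\<ge>n. v i = \<zero>" using vV unfolding finite_sequences_carrier by blast
    let ?w = "\<lambda>i. if i = 0 then \<zero> else v i"
    have "\<forall>i\<ge>n. ?w i = \<zero>" using n by simp
    moreover have "\<forall>i. ?w i \<in> carrier R" using Vc[OF vV] by simp
    ultimately have "?w \<in> carrier V" unfolding finite_sequences_carrier by blast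
    then have "?w \<in> sequences_in R p" unfolding sequences_in_def using LQ v(1) pr(2) by auto
    then have "?w \<in> L" using pL by blast
    moreover have "?w \<oplus>\<^bsub>V\<^esub> unit_seq R 0 l = v"
      using Vc[OF vV] v(2) by (auto simp: unit_seq_def)
    ultimately show ?thesis
      using V.submodule_add_cancel[OF sL, of ?w "unit_seq R 0 l"] v(1) L0r(3)[OF l] by simp
  qed
  have pL0: "p \<subseteq> L0"
  proof
    fix b assume b: "b \<in> p"
    moreover have "unit_seq R 0 b i \<in> p" for i using b pr(2) by (simp add: unit_seq_def)
    ultimately have "unit_seq R 0 b \<in> sequences_in R p"
      unfolding sequences_in_def using unit_seq_carrier pr(3) by blast
    then show "b \<in> L0" unfolding L0_def using pL by (intro image_eqI[of _ _ "unit_seq R 0 b"]) (auto simp: unit_seq_def)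
  qed
  \<comment> \<open>Purity for the left ideal \<open>R l + p\<close>.\<close>
  have local: "\<exists>e\<in>L0. l \<ominus> e \<otimes> l \<in> p" if l: "l \<in> L0" for l
  proof -
    have lc: "l \<in> carrier R" using L0r(3)[OF l] .
    define G where "G = left_span R p (carrier R) (\<lambda>i. l) (Suc 0)"
    have G: "left_ideal R G" "p \<subseteq> G" "l \<in> G"
      unfolding G_def
      using left_span_left_ideal[OF oneideal, of "\<lambda>i. l" "Suc 0", OF lc]
        left_span_mem[of "\<lambda>i. l" 0 "Suc 0", OF lc zero_less_Suc] by this
    have Gmem: "\<exists>g r. g \<in> p \<and> r \<in> carrier R \<and> a = g \<oplus> r \<otimes> l" if "a \<in> G" for a
      using that unfolding G_def by auto
    let ?W = "{u \<in> carrier V. \<exists>e\<in>L0. u 0 \<ominus> e \<otimes> l \<in> p}"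
    have "subgroup ?W (add_monoid V)"
    proof (rule subgroup_sequences)
      show "(\<lambda>i. \<zero>) \<in> ?W"
        using V.M.zero_closed L0r(2) pr(2) lc by (auto intro!: bexI[of _ \<zero>] simp: minus_eq)
      show "(\<lambda>i. x i \<ominus> y i) \<in> ?W" if xy: "x \<in> ?W" "y \<in> ?W" for x y
      proof -
        obtain e e' where e: "e \<in> L0" "x 0 \<ominus> e \<otimes> l \<in> p" "e' \<in> L0" "y 0 \<ominus> e' \<otimes> l \<in> p" using xy by blast
        have cc: "x 0 \<in> carrier R" "y 0 \<in> carrier R" "e \<in> carrier R" "e' \<in> carrier R"
          using xy Vc e L0r(3) by auto
        have "(x 0 \<ominus> y 0) \<ominus> (e \<ominus> e') \<otimes> l = (x 0 \<ominus> e \<otimes> l) \<ominus> (y 0 \<ominus> e' \<otimes> l)"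
          using cc lc by (simp add: minus_eq l_distr l_minus minus_add a_ac)
        then have "(x 0 \<ominus> y 0) \<ominus> (e \<ominus> e') \<otimes> l \<in> p" using pr(7)[OF e(2,4)] by simp
        moreover have "e \<ominus> e' \<in> L0" using L0r(7) e by blast
        moreover have "(\<lambda>i. x i \<ominus> y i) \<in> carrier V" using finite_sequences_diff xy by blast
        ultimately show ?thesis by blast
      qed
    qed blast
    moreover have "sequences_in R p \<subseteq> ?W"
    proof
      fix u assume u: "u \<in> sequences_in R p"
      then have "u 0 \<ominus> \<zero> \<otimes> l \<in> p" using lc pr(3) unfolding sequences_in_def by (simp add: minus_eq)
      then show "u \<in> ?W" using u L0r(2) unfolding sequences_in_def by blast
    qed
    moreover have "a \<odot>\<^bsub>V\<^esub> v \<in> ?W" if v: "v \<in> L" and a: "a \<in> G" for v a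
    proof -
      obtain g r where gr: "g \<in> p" "r \<in> carrier R" "a = g \<oplus> r \<otimes> l" using Gmem[OF a] by blast
      have cc: "v 0 \<in> carrier R" "g \<in> carrier R" "a \<in> carrier R"
        using Vc Lc v pr(3) gr lc by auto
      have "v 0 \<otimes> a \<ominus> (v 0 \<otimes> r) \<otimes> l = v 0 \<otimes> g"
        using cc gr lc by (simp add: r_distr minus_eq m_assoc a_assoc r_neg)
      then have "v 0 \<otimes> a \<ominus> (v 0 \<otimes> r) \<otimes> l \<in> p" using ideal.I_l_closed[OF ideal_p gr(1) cc(1)] by simp
      moreover have "v 0 \<otimes> r \<in> L0" using L0r(5) gr(2) v unfolding L0_def by blast
      moreover have "a \<odot>\<^bsub>V\<^esub> v \<in> carrier V" using V.smult_closed cc(3) Lc[OF v] by blast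
      ultimately show ?thesis by auto
    qed
    moreover have "unit_seq R 0 l i \<in> G" for i using G unfolding left_ideal_def unit_seq_def by simp
    ultimately have "unit_seq R 0 l \<in> ?W"
      using flat_resolutionD(5)[OF L G(1,2) unitL[OF l], of ?W] by blast
    then show ?thesis by (simp add: unit_seq_def)
  qed
  \<comment> \<open>Choose \<open>e\<close> so that the right ideal of all \<open>l \<in> L0\<close> with \<open>l \<equiv> e l\<close> is maximal.\<close>
  obtain e where e: "e \<in> L0" "\<And>l. l \<in> L0 \<Longrightarrow> l \<ominus> e \<otimes> l \<in> p"
  proof -
    let ?K = "\<lambda>e. {l \<in> L0. l \<ominus> e \<otimes> l \<in> p}"
    let ?F = "?K ` L0"
    have K: "right_ideal R (?K e)" if "e \<in> L0" for e
    proof -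
      have ec: "e \<in> carrier R" using L0r(3)[OF that] .
      have "(x \<oplus> y) \<ominus> e \<otimes> (x \<oplus> y) = (x \<ominus> e \<otimes> x) \<oplus> (y \<ominus> e \<otimes> y)" if "x \<in> L0" "y \<in> L0" for x y
        using that L0r(3) ec by (simp add: r_distr add_diff_add)
      moreover have "x \<otimes> r \<ominus> e \<otimes> (x \<otimes> r) = (x \<ominus> e \<otimes> x) \<otimes> r" if "x \<in> L0" "r \<in> carrier R" for x r
        using that L0r(3) ec by (simp add: minus_eq l_distr l_minus m_assoc)
      ultimately show ?thesis
        unfolding right_ideal_iff using L0r pr(2,4,5) ec by (auto simp: minus_eq)
    qed
    obtain M where M: "M \<in> ?F" "\<And>B. B \<in> ?F \<Longrightarrow> M \<subseteq> B \<Longrightarrow> B = M"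
      using right_noetherian_maximal[OF noetherian, of "?K \<zero>" ?F] K L0r(2) by blast
    then obtain e where eM: "e \<in> L0" "M = ?K e" by blast
    have ec: "e \<in> carrier R" using L0r(3) eM by blast
    have "l \<ominus> e \<otimes> l \<in> p" if l: "l \<in> L0" for l
    proof -
      have lc: "l \<in> carrier R" using L0r(3)[OF l] .
      have "l \<ominus> e \<otimes> l \<in> L0" using L0r(5,7) l eM(1) lc by blast
      then obtain e2 where e2: "e2 \<in> L0" "(l \<ominus> e \<otimes> l) \<ominus> e2 \<otimes> (l \<ominus> e \<otimes> l) \<in> p" using local by blast
      have e2c: "e2 \<in> carrier R" using L0r(3)[OF e2(1)] .
      \<comment> \<open>\<open>1 - e'\<close> is the product \<open>(1 - e2) (1 - e)\<close>.\<close>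
      let ?e' = "e \<oplus> (e2 \<ominus> e2 \<otimes> e)"
      have e': "?e' \<in> L0" using L0r(4,5,7) eM(1) e2(1) ec by blast
      have eq: "x \<ominus> ?e' \<otimes> x = (x \<ominus> e \<otimes> x) \<ominus> e2 \<otimes> (x \<ominus> e \<otimes> x)" if "x \<in> carrier R" for x
        using that ec e2c by (simp add: minus_eq l_distr r_distr l_minus r_minus minus_add m_assoc a_assoc)
      have "?K e \<subseteq> ?K ?e'"
      proof
        fix x assume x: "x \<in> ?K e"
        then have "x \<in> carrier R" using L0r(3) by blast
        then show "x \<in> ?K ?e'" using x eq pr(7) ideal.I_l_closed[OF ideal_p _ e2c] by simp
      qed
      then have "?K ?e' = ?K e" using M(2)[of "?K ?e'"] e' eM(2) by blast
      moreover have "l \<in> ?K ?e'" using l eq[OF lc] e2(2) by simp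
      ultimately show ?thesis by blast
    qed
    then show thesis using that eM(1) by blast
  qed
  have ec: "e \<in> carrier R" using L0r(3)[OF e(1)] .
  let ?W = "{w \<in> carrier R. e \<otimes> w \<in> p}"
  have W: "right_ideal R ?W" by (rule right_ideal_vimage[OF right_ideal_p ec right_ideal_carrier])
  note Wr = right_idealD[OF W]
  have pW: "p \<subseteq> ?W" using pr(3) ideal.I_l_closed[OF ideal_p _ ec] by blast
  have L0W: "\<exists>l w. l \<in> L0 \<and> w \<in> ?W \<and> r = l \<oplus> w" if r: "r \<in> carrier R" for r
  proof -
    have er: "e \<otimes> r \<in> L0" using L0r(5) e(1) r by blast
    have "e \<otimes> (r \<ominus> e \<otimes> r) = e \<otimes> r \<ominus> e \<otimes> (e \<otimes> r)" using ec r by (simp add: minus_eq r_distr r_minus)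
    then have "r \<ominus> e \<otimes> r \<in> ?W" using e(2)[OF er] ec r by simp
    moreover have "r = e \<otimes> r \<oplus> (r \<ominus> e \<otimes> r)" using diff_add_cancel ec r by simp
    ultimately show ?thesis using er by blast
  qed
  have WL0: "w \<in> p" if "w \<in> ?W" "w \<in> L0" for w
  proof -
    have "e \<otimes> w \<oplus> (w \<ominus> e \<otimes> w) \<in> p" using e(2) that pr(4) by blast
    then show ?thesis using diff_add_cancel[of w "e \<otimes> w"] that ec by simp
  qed
  have small: "S = carrier R" if S: "right_ideal R S" "L0 \<subseteq> S" "\<And>r. r \<in> carrier R \<Longrightarrow> \<exists>s i. s \<in> S \<and> i \<in> I \<and> r = s \<oplus> i" for S
  proof -
    note Sr = right_idealD[OF S(1)]
    let ?S = "{v \<in> carrier V. v 0 \<in> S}"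
    have sS: "submodule ?S R V"
      unfolding V.submodule_iff
    proof (intro conjI ballI)
      show "\<zero>\<^bsub>V\<^esub> \<in> ?S" using V.M.zero_closed Sr(2) by simp
      show "x \<oplus>\<^bsub>V\<^esub> y \<in> ?S" if "x \<in> ?S" "y \<in> ?S" for x y
        using that V.M.add.m_closed[of x y] Sr(4) by simp
      show "r \<odot>\<^bsub>V\<^esub> x \<in> ?S" if "r \<in> carrier R" "x \<in> ?S" for r x
        using that V.smult_closed[of r x] Sr(5) by simp
    qed blast
    have "carrier V \<subseteq> ?S <+>\<^bsub>V\<^esub> ?Q"
    proof
      fix v assume v: "v \<in> carrier V"
      obtain s i where si: "s \<in> S" "i \<in> I" "v 0 = s \<oplus> i" using S(3) Vc[OF v] by blast
      obtain n where n: "\<forall>k\<ge>n. v k = \<zero>" using v unfolding finite_sequences_carrier by blast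
      have "\<forall>k\<ge>Suc n. (v(0 := s)) k = \<zero>" using n by auto
      then have "v(0 := s) \<in> carrier V" using Vc[OF v] Sr(3)[OF si(1)] unfolding finite_sequences_carrier by auto
      then have "v(0 := s) \<in> ?S" using si(1) by simp
      moreover have "unit_seq R 0 i \<in> ?Q" using si(2) Ir(3) pr(2) by (simp, simp add: unit_seq_def)
      moreover have "v = v(0 := s) \<oplus>\<^bsub>V\<^esub> unit_seq R 0 i" using si(3) Vc[OF v] by (auto simp: unit_seq_def)
      ultimately show "v \<in> ?S <+>\<^bsub>V\<^esub> ?Q" unfolding mem_set_add by blast
    qed
    then have "?S <+>\<^bsub>V\<^esub> ?Q = carrier V"
      using V.submodule_sum(1)[OF sS Q] unfolding V.submodule_iff by blast
    moreover have "L \<subseteq> ?S" using Lc S(2) unfolding L0_def by blast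
    ultimately have "?S = carrier V" using flat_resolutionD(4)[OF L sS] by blast
    then have "unit_seq R 0 \<one> \<in> ?S" by simp
    then have "\<one> \<in> S" by (simp add: unit_seq_def)
    then show ?thesis using right_ideal_one S(1) by blast
  qed
  have "I \<inter> ?W \<subseteq> radical_over p"
  proof
    fix x assume x: "x \<in> I \<inter> ?W"
    have "x \<in> I'" if I': "maximal_right_ideal I'" "p \<subseteq> I'" for I'
    proof (rule ccontr)
      assume xI': "x \<notin> I'"
      have rI': "right_ideal R I'" using I'(1) unfolding maximal_right_ideal_def by blast
      note I'r = right_idealD[OF rI']
      have rIW: "right_ideal R (I \<inter> ?W)" using rI W by (rule right_ideal_Int)
      have full: "I' <+>\<^bsub>R\<^esub> (I \<inter> ?W) = carrier R"
        using x xI' by (intro maximal_right_ideal_sum[OF I'(1) rIW]) blast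
      have rI'W: "right_ideal R (I' \<inter> ?W)" using rI' W by (rule right_ideal_Int)
      let ?S = "L0 <+>\<^bsub>R\<^esub> (I' \<inter> ?W)"
      note sS = right_ideal_sum[OF rL0 rI'W]
      have "?S = carrier R"
      proof (rule small[OF sS(1,2)])
        fix r assume r: "r \<in> carrier R"
        obtain l w where lw: "l \<in> L0" "w \<in> ?W" "r = l \<oplus> w" using L0W[OF r] by blast
        have "w \<in> I' <+>\<^bsub>R\<^esub> (I \<inter> ?W)" using full lw(2) by simp
        then obtain i y where iy: "i \<in> I'" "y \<in> I \<inter> ?W" "w = i \<oplus> y" unfolding mem_set_add by blast
        have cc: "l \<in> carrier R" "i \<in> carrier R" "y \<in> carrier R" using lw L0r(3) iy I'r(3) Ir(3) by auto
        have "y \<oplus> i \<in> ?W" using lw(2) iy(3) cc a_comm by simp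
        then have "i \<in> ?W" using right_ideal_add_cancel[OF W _ cc(2), of y] iy(2) by blast
        then have "l \<oplus> i \<in> ?S" unfolding mem_set_add using lw(1) iy(1) by blast
        moreover have "r = (l \<oplus> i) \<oplus> y" using lw(3) iy(3) cc by (simp add: a_assoc)
        ultimately show "\<exists>s i. s \<in> ?S \<and> i \<in> I \<and> r = s \<oplus> i" using iy(2) by blast
      qed
      then have "x \<in> ?S" using x by blast
      then obtain l t where lt: "l \<in> L0" "t \<in> I' \<inter> ?W" "x = l \<oplus> t" unfolding mem_set_add by blast
      have cc: "l \<in> carrier R" "t \<in> carrier R" using lt L0r(3) I'r(3) by auto
      have "t \<oplus> l \<in> ?W" using x lt(3) cc a_comm by simp
      then have "l \<in> ?W" using right_ideal_add_cancel[OF W _ cc(1), of t] lt(2) by blast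
      then have "l \<in> I'" using WL0 lt(1) I'(2) by blast
      then show False using xI' lt I'r(4) by blast
    qed
    then show "x \<in> radical_over p" unfolding radical_over_def using x by blast
  qed
  then have "I \<inter> ?W \<subseteq> p" using radical_subset by blast
  then have "\<not> p \<subset> ?W" using maximal_right_ideal_meets[OF I W] by blast
  then have Wp: "?W = p" using pW by blast
  have "\<one> \<in> I"
  proof -
    obtain l w where "l \<in> L0" "w \<in> ?W" "\<one> = l \<oplus> w" using L0W[of \<one>] by blast
    then have "l \<in> I" "w \<in> I" using L0I Wp I(2) by auto
    then show ?thesis using Ir(4) \<open>\<one> = l \<oplus> w\<close> by simp
  qed
  then show False using right_ideal_one[OF rI] I_proper by blast
qed

end

theorem proposition3p13:
  fixes R :: "('a, 'r) ring_scheme"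
  assumes "ring R"
    and "infinite (UNIV :: 'm set)" and "carrier R \<lesssim> (UNIV :: 'm set)"
    and "right_G_delta_perfect TYPE('m) TYPE('f) R"
  shows "right_noetherian R \<longleftrightarrow> right_artinian R"
proof
  show "right_noetherian R" if "right_artinian R"
    using ring.right_artinian_imp_right_noetherian[OF assms(1) that] .
next
  assume noe: "right_noetherian R"
  show "right_artinian R"
  proof (rule ccontr)
    assume "\<not> right_artinian R"
    then obtain p where p: "critical_ideal R p" using ring.critical_ideal_ex[OF assms(1) noe] by blast
    have "\<exists>L. flat_resolution R p Q L"
      if "submodule Q R (finite_sequences R)" "sequences_in R p \<subseteq> Q" for Q
      using flat_delta_cover_resolution[OF assms critical_ideal.ideal_p[OF p]
          critical_ideal.essential_maximal_right_ideal[OF p] that] .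
    then have "critical_ideal_with_resolutions R p"
      using p unfolding critical_ideal_with_resolutions_def critical_ideal_with_resolutions_axioms_def by blast
    then show False by (rule critical_ideal_with_resolutions.resolutions_impossible)
  qed
qed

end
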